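(* Let $n\ge 2$, let $U\subset\mathbb{R}^n$ be a connected open set, let $X=(X_1,\dots,X_m)$ be real smooth vector fields on $U$ satisfying Hörmander's condition (H), and let $\Omega\subset\subset U$ be a bounded open subset with generalized Métivier index $\tilde\nu$. Then: (1) For any $\varepsilon>0$ and $u\in\mathcal{H}_{X,0}^1(\Omega)\cap L^\infty(\Omega)$, we have $$\int_\Omega|u|^2\ln|u|\,dx\le\varepsilon\|Xu\|^2_{L^2(\Omega)}+M(\varepsilon)\|u\|^2_{L^2(\Omega)}+\|u\|^2_{L^2(\Omega)}\ln\|u\|_{L^2(\Omega)},$$ where $M(\varepsilon)=\ln C_0-\frac{\tilde\nu}4\ln\varepsilon$, and $C_0>0$ is the positive constant in the ultracontractivity estimate $$\|P^\Omega_tf\|_{L^\infty(\Omega)}\le C_0t^{-\frac{\tilde\nu}4}\|f\|_{L^2(\Omega)}\qquad\forall t>0,\ f\in L^2(\Omega)$$ for the heat semigroup $P^\Omega_t$. (2) Suppose that $p\ge1$ and $k$ is a positive integer with $kp\le\tilde\nu$. Then for any $u\in\mathcal{W}^{k,p}_{X,0}(\Omega)$ with $\|u\|_{L^p(\Omega)}=1$, we have $$\frac Ce\sum_{|J|=k}\|X^Ju\|_{L^p(\Omega)}\ \ge\ \ln\left(C\sum_{|J|=k}\|X^Ju\|_{L^p(\Omega)}\right)\ \ge\ \frac k{\tilde\nu}\int_\Omega|u|^p\ln|u|^p\,dx,$$ where $C>0$ is the positive constant in the Sobolev inequalities (S) stated in the context.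
   Context: Condition (H): there is a smallest positive integer $s_0$ such that $X_1,\dots,X_m$ together with their commutators of length at most $s_0$ span $\mathbb{R}^n$ at each point of $U$. $\Omega\subset\subset U$ means $\overline\Omega$ is a compact subset of $U$. $Xu=(X_1u,\dots,X_mu)$, $|Xu|=(\sum_j|X_ju|^2)^{1/2}$. As usual $0\ln0=0$. For a multi-index $J=(j_1,\dots,j_l)$ with $1\le j_i\le m$ and length $|J|=l$, $X^J=X_{j_1}\cdots X_{j_l}$, and $X^J=\mathrm{id}$ if $|J|=0$. $\mathcal{W}_X^{k,p}(U)=\{u\in L^p(U): X^Ju\in L^p(U)\ \forall |J|\le k\}$, with norm $\|u\|^p_{\mathcal{W}_X^{k,p}(U)}=\sum_{|J|\le k}\|X^Ju\|^p_{L^p(U)}$; $\mathcal{W}_{X,0}^{k,p}(\Omega)$ is the closure of $C_0^\infty(\Omega)$ in $\mathcal{W}_X^{k,p}(U)$, and $\mathcal{H}^k_{X,0}(\Omega)=\mathcal{W}^{k,2}_{X,0}(\Omega)$. Sobolev inequalities (S), as asserted in the source: for any bounded open $\Omega\subset\subset U$ and any $p\ge1$ there exists a positive constant $C>0$ such that (i) if $kp<\tilde\nu$ and $\frac1q=\frac1p-\frac k{\tilde\nu}$, then $\|u\|_{L^q(\Omega)}\le C\sum_{|J|=k}\|X^Ju\|_{L^p(\Omega)}$ for all $u\in\mathcal{W}^{k,p}_{X,0}(\Omega)$; (ii) if $kp=\tilde\nu$ and $1\le q<\infty$, then also $\|u\|_{L^q(\Omega)}\le C\sum_{|J|=k}\|X^Ju\|_{L^p(\Omega)}$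 for all $u\in\mathcal{W}^{k,p}_{X,0}(\Omega)$. $\mathcal{L}_\Omega$ is the positive self-adjoint operator in $L^2(\Omega)$ generated by the closed symmetric form $\mathcal{Q}(u,v)=\int_\Omega Xu\cdot Xv\,dx$ with domain $\mathcal{H}^1_{X,0}(\Omega)$, i.e. $\mathcal{Q}(u,v)=(\mathcal{L}_\Omega u,v)_{L^2(\Omega)}$ for $u\in\mathrm{dom}(\mathcal{L}_\Omega)$, $v\in\mathcal{H}^1_{X,0}(\Omega)$; $P^\Omega_t=e^{-t\mathcal{L}_\Omega}$ is its heat semigroup. For $x\in U$, let $V_j(x)\subset\mathbb{R}^n$ be the span of the values at $x$ of all iterated commutators $[X_{i_1},[\dots,[X_{i_{r-1}},X_{i_r}]\dots]]$ of length $r\le j$, $\nu_j(x)=\dim V_j(x)$, $\nu_0(x)=0$, and $s(x)$ the smallest integer with $V_{s(x)}(x)=\mathbb{R}^n$. Pointwise homogeneous dimension: $\nu(x)=\sum_{j=1}^{s(x)}j(\nu_j(x)-\nu_{j-1}(x))$. Generalized Métivier index: $\tilde\nu=\max_{x\in\overline\Omega}\nu(x)$. *)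

theory Defs
  imports "HOL-Analysis.Analysis" "HOL-Probability.Essential_Supremum"
begin

section \<open>Smooth functions and vector fields\<close>

definition partial_deriv :: "'n::finite \<Rightarrow> (real^'n \<Rightarrow> 'b::real_normed_vector) \<Rightarrow> real^'n \<Rightarrow> 'b" where
  "partial_deriv i f x = frechet_derivative f (at x) (axis i 1)"

fun partial_derivs :: "'n::finite list \<Rightarrow> (real^'n \<Rightarrow> 'b::real_normed_vector) \<Rightarrow> real^'n \<Rightarrow> 'b" where
  "partial_derivs [] f = f"
| "partial_derivs (i # is) f = partial_deriv i (partial_derivs is f)"

text \<open>Requiring every iterated partial derivative to be differentiable makes all of them
  exist and be continuous, so on an open set this is \<open>C\<^sup>\<infinity>\<close>.\<close>

definition smooth_on :: "(real^'n::finite) set \<Rightarrow> (real^'n \<Rightarrow> 'b::real_normed_vector) \<Rightarrow> bool" where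
  "smooth_on S f \<longleftrightarrow> (\<forall>is. \<forall>x\<in>S. partial_derivs is f differentiable (at x))"

definition test_functions :: "(real^'n::finite) set \<Rightarrow> (real^'n \<Rightarrow> real) set" where
  "test_functions S =
     {\<phi>. smooth_on UNIV \<phi> \<and> compact (closure {x. \<phi> x \<noteq> 0}) \<and> closure {x. \<phi> x \<noteq> 0} \<subseteq> S}"

definition divergence :: "(real^'n::finite \<Rightarrow> real^'n) \<Rightarrow> real^'n \<Rightarrow> real" where
  "divergence F x = (\<Sum>i\<in>UNIV. partial_deriv i F x $ i)"

text \<open>A vector field \<open>Y = \<Sum>\<^sub>k Y\<^sub>k \<partial>\<^sub>k\<close> is given by its coefficient vector. In
  coefficients, \<open>[Y, Z] = DZ \<cdot> Y - DY \<cdot> Z\<close>.\<close>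

definition lie_bracket ::
  "(real^'n::finite \<Rightarrow> real^'n) \<Rightarrow> (real^'n \<Rightarrow> real^'n) \<Rightarrow> real^'n \<Rightarrow> real^'n" where
  "lie_bracket Y Z x = frechet_derivative Z (at x) (Y x) - frechet_derivative Y (at x) (Z x)"

text \<open>\<open>commutator X [i\<^sub>1, \<dots>, i\<^sub>r] = [X\<^sub>i\<^sub>1, [\<dots>, [X\<^sub>i\<^sub>r\<^sub>-\<^sub>1, X\<^sub>i\<^sub>r] \<dots>]]\<close>; the value on the empty list
  is never used.\<close>

fun commutator ::
  "('m \<Rightarrow> real^'n::finite \<Rightarrow> real^'n) \<Rightarrow> 'm list \<Rightarrow> real^'n \<Rightarrow> real^'n" where
  "commutator X [] = (\<lambda>x. 0)"
| "commutator X [i] = X i"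
| "commutator X (i # j # I) = lie_bracket (X i) (commutator X (j # I))"

definition comm_span :: "('m \<Rightarrow> real^'n::finite \<Rightarrow> real^'n) \<Rightarrow> nat \<Rightarrow> real^'n \<Rightarrow> (real^'n) set" where
  "comm_span X j x = span {commutator X I x | I. I \<noteq> [] \<and> length I \<le> j}"

text \<open>A smallest such \<open>s\<^sub>0\<close> exists as soon as some \<open>s\<^sub>0\<close> does.\<close>

definition hormander :: "(real^'n::finite) set \<Rightarrow> ('m \<Rightarrow> real^'n \<Rightarrow> real^'n) \<Rightarrow> bool" where
  "hormander U X \<longleftrightarrow> (\<exists>s0>0. \<forall>x\<in>U. comm_span X s0 x = UNIV)"

definition hormander_step :: "('m \<Rightarrow> real^'n::finite \<Rightarrow> real^'n) \<Rightarrow> real^'n \<Rightarrow> nat" where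
  "hormander_step X x = (LEAST s. comm_span X s x = UNIV)"

definition hom_dim :: "('m \<Rightarrow> real^'n::finite \<Rightarrow> real^'n) \<Rightarrow> real^'n \<Rightarrow> nat" where
  "hom_dim X x = (\<Sum>j = 1..hormander_step X x. j * (dim (comm_span X j x) - dim (comm_span X (j - 1) x)))"

definition metivier_index :: "('m \<Rightarrow> real^'n::finite \<Rightarrow> real^'n) \<Rightarrow> (real^'n) set \<Rightarrow> nat" where
  "metivier_index X \<Omega> = Max (hom_dim X ` closure \<Omega>)"


section \<open>Lebesgue spaces\<close>

text \<open>Elements of \<open>L\<^sup>p(S)\<close> are represented by functions on the whole space of which only the
  values on \<open>S\<close>, up to null sets, matter.\<close>

definition Lp :: "real \<Rightarrow> (real^'n::finite) set \<Rightarrow> (real^'n \<Rightarrow> real) set" where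
  "Lp p S = {f \<in> borel_measurable (lebesgue_on S). integrable (lebesgue_on S) (\<lambda>x. \<bar>f x\<bar> powr p)}"

definition Lp_norm :: "real \<Rightarrow> (real^'n::finite) set \<Rightarrow> (real^'n \<Rightarrow> 'b::real_normed_vector) \<Rightarrow> real" where
  "Lp_norm p S f = (integral\<^sup>L (lebesgue_on S) (\<lambda>x. norm (f x) powr p)) powr (1 / p)"

definition Linf_norm :: "(real^'n::finite) set \<Rightarrow> (real^'n \<Rightarrow> real) \<Rightarrow> ennreal" where
  "Linf_norm S f = esssup (lebesgue_on S) (\<lambda>x. ennreal \<bar>f x\<bar>)"

definition Linf :: "(real^'n::finite) set \<Rightarrow> (real^'n \<Rightarrow> real) set" where
  "Linf S = {f \<in> borel_measurable (lebesgue_on S). Linf_norm S f < \<infinity>}"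

definition locally_integrable :: "(real^'n::finite) set \<Rightarrow> (real^'n \<Rightarrow> real) \<Rightarrow> bool" where
  "locally_integrable S f \<longleftrightarrow> (\<forall>K. compact K \<and> K \<subseteq> S \<longrightarrow> integrable (lebesgue_on K) f)"


section \<open>Weak derivatives and Sobolev spaces\<close>

text \<open>The transpose of the operator \<open>X\<^sub>j\<close> is \<open>\<phi> \<mapsto> - div (\<phi> X\<^sub>j)\<close>, and the transpose of
  \<open>X\<^sup>J = X\<^sub>j\<^sub>1 \<cdots> X\<^sub>j\<^sub>l\<close> applies the transpose of \<open>X\<^sub>j\<^sub>1\<close> first.\<close>

fun transpose_op ::
  "('m \<Rightarrow> real^'n::finite \<Rightarrow> real^'n) \<Rightarrow> 'm list \<Rightarrow> (real^'n \<Rightarrow> real) \<Rightarrow> real^'n \<Rightarrow> real" where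
  "transpose_op X [] \<phi> = \<phi>"
| "transpose_op X (j # J) \<phi> = transpose_op X J (\<lambda>x. - divergence (\<lambda>y. \<phi> y *\<^sub>R X j y) x)"

definition has_weak_deriv ::
  "(real^'n::finite) set \<Rightarrow> ('m \<Rightarrow> real^'n \<Rightarrow> real^'n) \<Rightarrow> 'm list \<Rightarrow>
    (real^'n \<Rightarrow> real) \<Rightarrow> (real^'n \<Rightarrow> real) \<Rightarrow> bool" where
  "has_weak_deriv U X J u g \<longleftrightarrow>
     locally_integrable U u \<and> locally_integrable U g \<and>
     (\<forall>\<phi>\<in>test_functions U.
        integral\<^sup>L (lebesgue_on U) (\<lambda>x. g x * \<phi> x) =
        integral\<^sup>L (lebesgue_on U) (\<lambda>x. u x * transpose_op X J \<phi> x))"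

text \<open>\<open>X\<^sup>J u\<close>; determined almost everywhere on \<open>U\<close> when it exists.\<close>

definition weak_deriv ::
  "(real^'n::finite) set \<Rightarrow> ('m \<Rightarrow> real^'n \<Rightarrow> real^'n) \<Rightarrow> 'm list \<Rightarrow>
    (real^'n \<Rightarrow> real) \<Rightarrow> real^'n \<Rightarrow> real" where
  "weak_deriv U X J u = (SOME g. has_weak_deriv U X J u g)"

definition weak_grad ::
  "(real^'n::finite) set \<Rightarrow> ('m::finite \<Rightarrow> real^'n \<Rightarrow> real^'n) \<Rightarrow>
    (real^'n \<Rightarrow> real) \<Rightarrow> real^'n \<Rightarrow> real^'m" where
  "weak_grad U X u x = (\<chi> j. weak_deriv U X [j] u x)"

definition sobolev ::
  "(real^'n::finite) set \<Rightarrow> ('m::finite \<Rightarrow> real^'n \<Rightarrow> real^'n) \<Rightarrow> nat \<Rightarrow> real \<Rightarrow>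
    (real^'n \<Rightarrow> real) set" where
  "sobolev U X k p =
     {u \<in> Lp p U. \<forall>J. length J \<le> k \<longrightarrow> (\<exists>g\<in>Lp p U. has_weak_deriv U X J u g)}"

definition sobolev_norm ::
  "(real^'n::finite) set \<Rightarrow> ('m::finite \<Rightarrow> real^'n \<Rightarrow> real^'n) \<Rightarrow> nat \<Rightarrow> real \<Rightarrow>
    (real^'n \<Rightarrow> real) \<Rightarrow> real" where
  "sobolev_norm U X k p u =
     (\<Sum>J | length J \<le> k. Lp_norm p U (weak_deriv U X J u) powr p) powr (1 / p)"

definition sobolev0 ::
  "(real^'n::finite) set \<Rightarrow> ('m::finite \<Rightarrow> real^'n \<Rightarrow> real^'n) \<Rightarrow> (real^'n) set \<Rightarrow> nat \<Rightarrow> real \<Rightarrow>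
    (real^'n \<Rightarrow> real) set" where
  "sobolev0 U X \<Omega> k p =
     {u \<in> sobolev U X k p. \<forall>e>0. \<exists>\<phi>\<in>test_functions \<Omega>. sobolev_norm U X k p (\<lambda>x. u x - \<phi> x) < e}"

abbreviation H1_0 ::
  "(real^'n::finite) set \<Rightarrow> ('m::finite \<Rightarrow> real^'n \<Rightarrow> real^'n) \<Rightarrow> (real^'n) set \<Rightarrow>
    (real^'n \<Rightarrow> real) set" where
  "H1_0 U X \<Omega> \<equiv> sobolev0 U X \<Omega> 1 2"

definition top_order_sum ::
  "(real^'n::finite) set \<Rightarrow> ('m::finite \<Rightarrow> real^'n \<Rightarrow> real^'n) \<Rightarrow> (real^'n) set \<Rightarrow> nat \<Rightarrow> real \<Rightarrow>
    (real^'n \<Rightarrow> real) \<Rightarrow> real" where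
  "top_order_sum U X \<Omega> k p u = (\<Sum>J | length J = k. Lp_norm p \<Omega> (weak_deriv U X J u))"

text \<open>\<open>C\<close> is an admissible constant in the Sobolev inequalities for \<open>\<Omega>\<close>, \<open>k\<close> and \<open>p\<close>. In the
  critical case \<open>k p = \<nu>\<close> the same \<open>C\<close> serves all exponents \<open>q\<close>.\<close>

definition sobolev_constant ::
  "(real^'n::finite) set \<Rightarrow> ('m::finite \<Rightarrow> real^'n \<Rightarrow> real^'n) \<Rightarrow> (real^'n) set \<Rightarrow> nat \<Rightarrow> real \<Rightarrow>
    real \<Rightarrow> bool" where
  "sobolev_constant U X \<Omega> k p C \<longleftrightarrow>
     (let \<nu> = real (metivier_index X \<Omega>) in
       (real k * p < \<nu> \<longrightarrow>
          (\<forall>q. 1 / q = 1 / p - real k / \<nu> \<longrightarrow>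
             (\<forall>u\<in>sobolev0 U X \<Omega> k p.
                u \<in> Lp q \<Omega> \<and> Lp_norm q \<Omega> u \<le> C * top_order_sum U X \<Omega> k p u))) \<and>
       (real k * p = \<nu> \<longrightarrow>
          (\<forall>q\<ge>1. \<forall>u\<in>sobolev0 U X \<Omega> k p.
                u \<in> Lp q \<Omega> \<and> Lp_norm q \<Omega> u \<le> C * top_order_sum U X \<Omega> k p u)))"


section \<open>The operator \<open>\<L>\<^sub>\<Omega>\<close> and its heat semigroup\<close>

text \<open>The graph of the self-adjoint operator in \<open>L\<^sup>2(\<Omega>)\<close> associated with the closed form
  \<open>\<Q>(u, v) = \<integral>\<^sub>\<Omega> Xu \<cdot> Xv\<close> on \<open>\<H>\<^sup>1\<^sub>X\<^sub>,\<^sub>0(\<Omega>)\<close>: \<open>f\<close> is in the domain with image \<open>g\<close>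
  iff \<open>f\<close> is in the form domain and \<open>\<Q>(f, v) = (g, v)\<close> for all \<open>v\<close> there. Elements of the
  form domain live on \<open>U\<close> and vanish almost everywhere off \<open>\<Omega>\<close>, whereas \<open>f\<close> matters on \<open>\<Omega>\<close> only;
  hence the representative \<open>u\<close>.\<close>

definition form_operator ::
  "(real^'n::finite) set \<Rightarrow> ('m::finite \<Rightarrow> real^'n \<Rightarrow> real^'n) \<Rightarrow> (real^'n) set \<Rightarrow>
    (real^'n \<Rightarrow> real) \<Rightarrow> (real^'n \<Rightarrow> real) \<Rightarrow> bool" where
  "form_operator U X \<Omega> f g \<longleftrightarrow>
     f \<in> Lp 2 \<Omega> \<and> g \<in> Lp 2 \<Omega> \<and>
     (\<exists>u\<in>H1_0 U X \<Omega>. (AE x in lebesgue_on \<Omega>. u x = f x) \<and>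
        (\<forall>v\<in>H1_0 U X \<Omega>.
           integral\<^sup>L (lebesgue_on \<Omega>) (\<lambda>x. weak_grad U X u x \<bullet> weak_grad U X v x) =
           integral\<^sup>L (lebesgue_on \<Omega>) (\<lambda>x. g x * v x)))"

text \<open>Strongly continuous semigroup of bounded linear operators on \<open>L\<^sup>2(S)\<close>. Linearity and
  boundedness make each \<open>P t\<close> well defined on almost-everywhere classes.\<close>

definition C0_semigroup ::
  "(real^'n::finite) set \<Rightarrow> (real \<Rightarrow> (real^'n \<Rightarrow> real) \<Rightarrow> (real^'n \<Rightarrow> real)) \<Rightarrow> bool" where
  "C0_semigroup S P \<longleftrightarrow>
     (\<forall>t\<ge>0. \<forall>f\<in>Lp 2 S. P t f \<in> Lp 2 S) \<and>
     (\<forall>t\<ge>0. \<forall>f\<in>Lp 2 S. \<forall>g\<in>Lp 2 S. \<forall>a b.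
        AE x in lebesgue_on S. P t (\<lambda>y. a * f y + b * g y) x = a * P t f x + b * P t g x) \<and>
     (\<forall>t\<ge>0. \<exists>B. \<forall>f\<in>Lp 2 S. Lp_norm 2 S (P t f) \<le> B * Lp_norm 2 S f) \<and>
     (\<forall>f\<in>Lp 2 S. AE x in lebesgue_on S. P 0 f x = f x) \<and>
     (\<forall>s\<ge>0. \<forall>t\<ge>0. \<forall>f\<in>Lp 2 S. AE x in lebesgue_on S. P (s + t) f x = P s (P t f) x) \<and>
     (\<forall>f\<in>Lp 2 S. ((\<lambda>t. Lp_norm 2 S (\<lambda>x. P t f x - f x)) \<longlongrightarrow> 0) (at_right 0))"

text \<open>Graph of the infinitesimal generator.\<close>

definition generator ::
  "(real^'n::finite) set \<Rightarrow> (real \<Rightarrow> (real^'n \<Rightarrow> real) \<Rightarrow> (real^'n \<Rightarrow> real)) \<Rightarrow>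
    (real^'n \<Rightarrow> real) \<Rightarrow> (real^'n \<Rightarrow> real) \<Rightarrow> bool" where
  "generator S P f g \<longleftrightarrow>
     f \<in> Lp 2 S \<and> g \<in> Lp 2 S \<and>
     ((\<lambda>t. Lp_norm 2 S (\<lambda>x. (P t f x - f x) / t - g x)) \<longlongrightarrow> 0) (at_right 0)"

text \<open>\<open>P t = exp (- t \<L>\<^sub>\<Omega>)\<close>: the semigroup generated by \<open>- \<L>\<^sub>\<Omega>\<close> (unique up to null sets).\<close>

definition heat_semigroup ::
  "(real^'n::finite) set \<Rightarrow> ('m::finite \<Rightarrow> real^'n \<Rightarrow> real^'n) \<Rightarrow> (real^'n) set \<Rightarrow>
    (real \<Rightarrow> (real^'n \<Rightarrow> real) \<Rightarrow> (real^'n \<Rightarrow> real)) \<Rightarrow> bool" where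
  "heat_semigroup U X \<Omega> P \<longleftrightarrow>
     C0_semigroup \<Omega> P \<and>
     (\<forall>f g. generator \<Omega> P f g \<longleftrightarrow> form_operator U X \<Omega> f (\<lambda>x. - g x))"

definition ultracontractive ::
  "(real^'n::finite) set \<Rightarrow> (real \<Rightarrow> (real^'n \<Rightarrow> real) \<Rightarrow> (real^'n \<Rightarrow> real)) \<Rightarrow> real \<Rightarrow> real \<Rightarrow> bool" where
  "ultracontractive \<Omega> P \<nu> C0 \<longleftrightarrow>
     (\<forall>t>0. \<forall>f\<in>Lp 2 \<Omega>.
        Linf_norm \<Omega> (P t f) \<le> ennreal (C0 * t powr (- (\<nu> / 4)) * Lp_norm 2 \<Omega> f))"

end

(* (1) Let A = P_t and let B be multiplication by |u|.  Ultracontractivity says that B A has norm at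
   most K = C_0 t^(-nu/4) ||u|| on L^2.  By the Cordes inequality ||B^s A^s|| <= ||B A||^s, which for
   s = 2^-n needs only a spectral-radius computation (||B^(1/2) A^(1/2)||^2 is the spectral
   radius of A^(1/2) B A^(1/2), hence of B A), we get
     (P_{st} u, |u|^s u) <= K^s ||u||^2,
   with equality at s = 0.  Comparing the terms of first order in s = 2^-n, together with
   (u - P_r u, u) <= r ||Xu||^2, is the claim for t = epsilon.  Neither positivity of P_t nor complex
   interpolation is needed.  That P_t is symmetric follows by differentiating (P_r f, P_{t-r} g) in r
   for f, g in the domain of the generator; the two-sided derivative needs P_t to be bounded
   uniformly for t away from 0, which ultracontractivity provides.  The domain is dense because it
   contains the test functions, for which weak derivatives are classical.

   (2) Jensen's inequality for the probability measure |u|^p dx bounds (1/p - 1/q) times the entropy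
   of |u|^p by ln ||u||_q; then the Sobolev inequality applies, and in the critical case q tends to
   infinity. *)

theory Submission
  imports Defs
begin

section \<open>Symmetric semigroups and the Cordes inequality\<close>

text \<open>The logarithms arise by differentiation: paired with u, the bound ||B^s A^s|| <= K^s is
  an equality at s = 0, so its derivative there is an inequality, and ln K at t = epsilon splits
  into M(epsilon) + ln ||u||. Boundedness of u makes multiplication by |u|^s a bounded operator and
  lets the quotients (|u|^s - 1) u / s be dominated uniformly in s. Dyadic exponents call for square
  roots only, and these are at hand for both operators: P_{t/2} squares to P_t, and |u|^(s/2)
  squares to |u|^s. The obstacle is that P is given merely as a strongly continuous semigroup with
  prescribed generator, acting on functions up to null sets. Symmetry of P_t and its comparison with
  the Dirichlet form have to be recovered from the generator, and the generator is accessible on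
  test functions, where everything is classical. Hence the separation into an abstract argument in
  an inner product space and a verification of its assumptions.\<close>

text \<open>The derivative of \<open>a powr h\<close> at \<open>h = 0\<close>, taken along
  \<open>h = 1 / 2 ^ n\<close>. With \<open>a = K\<close> it yields the constant of the inequality;
  with \<open>a\<close> a value of |u| it yields the integrand.\<close>

lemma powr_diff_quotient_tendsto:
  assumes "(a::real) > 0"
  shows "(\<lambda>n. 2 ^ n * (a powr (1 / 2 ^ n) - 1)) \<longlonglongrightarrow> ln a"
proof -
  have "((\<lambda>h. a powr h) has_real_derivative ln a) (at 0)"
    using assms by (auto intro!: derivative_eq_intros)
  then have "((\<lambda>h. (a powr h - 1) / h) \<longlongrightarrow> ln a) (at 0)" using assms by (simp add: DERIV_def)
  moreover have "filterlim (\<lambda>n. 1 / 2 ^ n :: real) (at 0) sequentially"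
    unfolding filterlim_at by (auto intro!: LIMSEQ_divide_realpow_zero)
  ultimately have "(\<lambda>n. (a powr (1 / 2 ^ n) - 1) / (1 / 2 ^ n)) \<longlonglongrightarrow> ln a" by (rule filterlim_compose)
  then show ?thesis by (simp add: mult.commute)
qed

text \<open>A constant factor is harmless under roots of growing order: if \<open>y / z\<close>
  exceeded 1, its powers would be unbounded, while \<open>M\<close> bounds those of order
  \<open>2 ^ n\<close>.\<close>

lemma le_of_power_le:
  fixes y z M :: real
  assumes "y \<ge> 0" "z > 0" and le: "\<And>n. y ^ (2 ^ n) \<le> M * z ^ (2 ^ n)"
  shows "y \<le> z"
proof (rule ccontr)
  assume "\<not> y \<le> z"
  then have gt: "y / z > 1" using \<open>z > 0\<close> by simp
  obtain N where N: "M < (y / z) ^ N" using real_arch_pow[OF gt] by blast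
  have "(y / z) ^ N \<le> (y / z) ^ (2 ^ N)"
    using gt by (intro power_increasing) (auto intro: less_imp_le[OF less_exp])
  also have "\<dots> \<le> M" using le[of N] \<open>z > 0\<close> by (simp add: power_divide field_simps)
  finally show False using N by simp
qed

text \<open>The case of exponent \<open>1/2\<close> of the Cordes inequality \<open>\<parallel>B\<^sup>s A\<^sup>s\<parallel> \<le> \<parallel>B A\<parallel>\<^sup>s\<close>, where
  \<open>a = A\<^sup>1\<^sup>/\<^sup>2\<close> and \<open>b = B\<^sup>1\<^sup>/\<^sup>2\<close>: the spectral radius of \<open>a b b a\<close> is that of \<open>b b a a\<close>.\<close>

lemma cordes_sqrt:
  fixes a b :: "'a::real_inner \<Rightarrow> 'a"
  assumes V: "\<And>x. x \<in> V \<Longrightarrow> a x \<in> V" "\<And>x. x \<in> V \<Longrightarrow> b x \<in> V"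
    and sym: "\<And>x y. x \<in> V \<Longrightarrow> y \<in> V \<Longrightarrow> a x \<bullet> y = x \<bullet> a y"
      "\<And>x y. x \<in> V \<Longrightarrow> y \<in> V \<Longrightarrow> b x \<bullet> y = x \<bullet> b y"
    and bd: "\<And>x. x \<in> V \<Longrightarrow> norm (a x) \<le> Ka * norm x"
      "\<And>x. x \<in> V \<Longrightarrow> norm (b x) \<le> Kb * norm x" "Ka \<ge> 0" "Kb \<ge> 0"
    and K: "\<And>x. x \<in> V \<Longrightarrow> norm (b (b (a (a x)))) \<le> K * norm x" "K > 0"
    and x: "x \<in> V"
  shows "norm (b (a x)) \<le> sqrt K * norm x"
proof (cases "x = 0")
  case True
  then have "a x = 0" using bd(1)[OF x] by simp
  then show ?thesis using bd(2)[OF V(1)[OF x]] True by simp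
next
  case False
  \<comment> \<open>\<open>T\<close> is symmetric and \<open>T x \<bullet> x\<close> is the square
    of \<open>norm (b (a x))\<close>, so the bound \<open>K\<close> for \<open>T\<close> at
    \<open>x\<close> gives the claim.\<close>
  define T where "T y = a (b (b (a y)))" for y
  have TV: "y \<in> V \<Longrightarrow> T y \<in> V" for y unfolding T_def using V by blast
  have TnV: "y \<in> V \<Longrightarrow> (T ^^ n) y \<in> V" for y n by (induction n) (auto intro: TV)
  have Tsym: "T y \<bullet> z = y \<bullet> T z" if "y \<in> V" "z \<in> V" for y z
    using that unfolding T_def by (simp add: sym V)
  have Tnsym: "(T ^^ n) y \<bullet> z = y \<bullet> (T ^^ n) z" if "y \<in> V" "z \<in> V" for y z n
    using that
  proof (induction n arbitrary: y z)
    case (Suc n)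
    have "(T ^^ Suc n) y \<bullet> z = (T ^^ n) y \<bullet> T z" using Suc.prems by (simp add: Tsym TnV)
    also have "\<dots> = y \<bullet> (T ^^ n) (T z)" using Suc TV by blast
    finally show ?case by (simp add: funpow_swap1)
  qed simp
  \<comment> \<open>Log-convexity of moments: by symmetry and Cauchy-Schwarz, ||T^N x||^2 <= ||x||
    ||T^(2N) x||. Doubling N repeatedly bounds a power of \<open>norm (T x)\<close> by a single
    orbit point, so only the growth rate of the orbit matters.\<close>
  have pow: "norm (T x) ^ (2 ^ n) \<le> norm ((T ^^ (2 ^ n)) x) * norm x ^ (2 ^ n - 1)" for n
  proof (induction n)
    case (Suc n)
    have "(norm ((T ^^ (2 ^ n)) x))\<^sup>2 = (T ^^ (2 ^ n)) x \<bullet> (T ^^ (2 ^ n)) x"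
      by (simp add: power2_norm_eq_inner)
    also have "\<dots> = x \<bullet> (T ^^ (2 ^ n)) ((T ^^ (2 ^ n)) x)" using Tnsym x TnV by blast
    also have "(T ^^ (2 ^ n)) ((T ^^ (2 ^ n)) x) = (T ^^ (2 ^ Suc n)) x"
      by (simp add: mult_2 funpow_add)
    also have "x \<bullet> \<dots> \<le> norm x * norm ((T ^^ (2 ^ Suc n)) x)" by (rule norm_cauchy_schwarz)
    finally have *: "(norm ((T ^^ (2 ^ n)) x))\<^sup>2 \<le> norm x * norm ((T ^^ (2 ^ Suc n)) x)" .
    have e: "Suc (2 * (2 ^ n - 1)) = 2 ^ Suc n - (1::nat)"
      using one_le_power[of "2::nat" n] by (simp del: one_le_power; linarith)
    have "norm (T x) ^ (2 ^ Suc n) = (norm (T x) ^ (2 ^ n))\<^sup>2"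
      by (simp add: mult.commute flip: power_mult)
    also have "\<dots> \<le> (norm ((T ^^ (2 ^ n)) x) * norm x ^ (2 ^ n - 1))\<^sup>2"
      by (intro power_mono Suc) simp
    also have "\<dots> = (norm ((T ^^ (2 ^ n)) x))\<^sup>2 * norm x ^ (2 * (2 ^ n - 1))"
      by (simp add: power_mult_distrib power_mult mult.commute flip: power_mult)
    also have "\<dots> \<le> norm x * norm ((T ^^ (2 ^ Suc n)) x) * norm x ^ (2 * (2 ^ n - 1))"
      by (intro mult_right_mono *) simp
    also have "\<dots> = norm ((T ^^ (2 ^ Suc n)) x) * norm x ^ Suc (2 * (2 ^ n - 1))" by simp
    finally show ?case unfolding e .
  qed simp
  have "norm (T x) \<le> K * norm x"
  proof (rule le_of_power_le)
    fix n
    \<comment> \<open>Regrouping (a b b a)^(N+1) as a (b b a a)^N b b a leaves all but a fixed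
      number of factors in the product that \<open>K\<close> controls; the outer ones contribute a
      constant independent of \<open>N\<close>.\<close>
    have R: "norm ((T ^^ Suc N) y) \<le> Ka * Kb * Kb * Ka * K ^ N * norm y" if "y \<in> V" for y N
    proof -
      have *: "(T ^^ Suc N) y = a (((\<lambda>z. b (b (a (a z)))) ^^ N) (b (b (a y))))"
        by (induction N) (auto simp: T_def)
      have iter: "((\<lambda>z. b (b (a (a z)))) ^^ N) z \<in> V
          \<and> norm (((\<lambda>z. b (b (a (a z)))) ^^ N) z) \<le> K ^ N * norm z" if "z \<in> V" for z
      proof (induction N)
        case (Suc N)
        define z' where "z' = ((\<lambda>z. b (b (a (a z)))) ^^ N) z"
        have z': "z' \<in> V" "norm z' \<le> K ^ N * norm z" using Suc by (auto simp: z'_def)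
        have "norm (b (b (a (a z')))) \<le> K * (K ^ N * norm z)"
          using K(1)[OF z'(1)] mult_left_mono[OF z'(2), of K] K(2) by linarith
        then show ?case using V z'(1) by (simp add: mult.assoc flip: z'_def)
      qed (use that in auto)
      have bba: "norm (b (b (a y))) \<le> Kb * (Kb * (Ka * norm y))"
        using bd(2)[OF V(2)[OF V(1)[OF that]]] mult_left_mono[OF bd(2)[OF V(1)[OF that]] bd(4)]
          mult_left_mono[OF mult_left_mono[OF bd(1)[OF that] bd(4)] bd(4)] by linarith
      have y': "b (b (a y)) \<in> V" using V that by blast
      have "norm ((T ^^ Suc N) y) \<le> Ka * norm (((\<lambda>z. b (b (a (a z)))) ^^ N) (b (b (a y))))"
        unfolding * by (rule bd(1)) (use iter[OF y'] in blast)
      also have "\<dots> \<le> Ka * (K ^ N * norm (b (b (a y))))"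
        using iter[OF y'] bd(3) by (intro mult_left_mono) auto
      also have "\<dots> \<le> Ka * (K ^ N * (Kb * (Kb * (Ka * norm y))))"
        using bd K bba by (intro mult_left_mono) auto
      finally show ?thesis by (simp add: mult_ac)
    qed
    define N where "N = (2::nat) ^ n - 1"
    have N: "2 ^ n = Suc N" by (simp add: N_def)
    have "norm (T x) ^ (2 ^ n) \<le> (Ka * Kb * Kb * Ka * K ^ N * norm x) * norm x ^ N"
      using pow[of n] R[OF x, of N] unfolding N
      by (auto elim!: order_trans intro!: mult_right_mono)
    \<comment> \<open>Only \<open>K ^ N\<close> is available, whereas the exponent is
      \<open>2 ^ n = Suc N\<close>; dividing the constant by \<open>K\<close> supplies the missing
      factor.\<close>
    also have "\<dots> = Ka * Kb * Kb * Ka / K * (K * norm x) ^ (2 ^ n)"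
      using K unfolding N by (simp add: field_simps)
    finally show "norm (T x) ^ (2 ^ n) \<le> Ka * Kb * Kb * Ka / K * (K * norm x) ^ (2 ^ n)" .
  qed (use False K in auto)
  then have "T x \<bullet> x \<le> K * norm x * norm x"
    by (meson norm_cauchy_schwarz norm_ge_zero mult_right_mono order_trans)
  moreover have "T x \<bullet> x = (norm (b (a x)))\<^sup>2"
    unfolding T_def using x by (simp add: sym V power2_norm_eq_inner)
  ultimately have "(norm (b (a x)))\<^sup>2 \<le> (sqrt K * norm x)\<^sup>2"
    using K by (simp add: power_mult_distrib power2_eq_square[of "norm x"] mult.assoc)
  then show ?thesis by (rule power2_le_imp_le) (use K in simp)
qed

text \<open>Each halving of the exponent is one use of \<open>cordes_sqrt\<close>:
  \<open>P (s / 2)\<close> is a square root of \<open>P s\<close>, \<open>b (Suc n)\<close> is one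
  of \<open>b n\<close>, and \<open>K\<close> is replaced by its root. The bounds of the single
  operators may depend on \<open>s\<close> and \<open>n\<close>, since \<open>cordes_sqrt\<close>
  returns a bound free of them.\<close>

lemma cordes_dyadic:
  fixes P :: "real \<Rightarrow> 'a::real_inner \<Rightarrow> 'a" and b :: "nat \<Rightarrow> 'a \<Rightarrow> 'a"
  assumes V: "\<And>s x. s > 0 \<Longrightarrow> x \<in> V \<Longrightarrow> P s x \<in> V" "\<And>n x. x \<in> V \<Longrightarrow> b n x \<in> V"
    and sym: "\<And>s x y. s > 0 \<Longrightarrow> x \<in> V \<Longrightarrow> y \<in> V \<Longrightarrow> P s x \<bullet> y = x \<bullet> P s y"
      "\<And>n x y. x \<in> V \<Longrightarrow> y \<in> V \<Longrightarrow> b n x \<bullet> y = x \<bullet> b n y"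
    and bd: "\<And>s. s > 0 \<Longrightarrow> \<exists>B\<ge>0. \<forall>x\<in>V. norm (P s x) \<le> B * norm x"
      "\<And>n. \<exists>B\<ge>0. \<forall>x\<in>V. norm (b n x) \<le> B * norm x"
    and sq: "\<And>s x. s > 0 \<Longrightarrow> x \<in> V \<Longrightarrow> P (s / 2) (P (s / 2) x) = P s x"
      "\<And>n x. x \<in> V \<Longrightarrow> b (Suc n) (b (Suc n) x) = b n x"
    and K: "\<And>x. x \<in> V \<Longrightarrow> norm (b 0 (P t x)) \<le> K * norm x" "K > 0"
    and t: "t > 0" and x: "x \<in> V"
  shows "norm (b n (P (t / 2 ^ n) x)) \<le> K powr (1 / 2 ^ n) * norm x"
  using x
proof (induction n arbitrary: x)
  case 0
  then show ?case using K by simp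
next
  case (Suc n)
  define s where "s = t / 2 ^ n"
  have s: "s > 0" "s / 2 > 0" "t / 2 ^ Suc n = s / 2" using t by (auto simp: s_def)
  obtain Ka where Ka: "Ka \<ge> 0" "\<forall>x\<in>V. norm (P (s / 2) x) \<le> Ka * norm x" using bd(1)[OF s(2)] by blast
  obtain Kb where Kb: "Kb \<ge> 0" "\<forall>x\<in>V. norm (b (Suc n) x) \<le> Kb * norm x" using bd(2) by blast
  have "norm (b (Suc n) (P (s / 2) x)) \<le> sqrt (K powr (1 / 2 ^ n)) * norm x"
  proof (rule cordes_sqrt[where V = V and a = "P (s / 2)" and b = "b (Suc n)" and Ka = Ka and Kb = Kb])
    fix y assume y: "y \<in> V"
    show "norm (b (Suc n) (b (Suc n) (P (s / 2) (P (s / 2) y)))) \<le> K powr (1 / 2 ^ n) * norm y"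
      using Suc.IH[OF y] y s by (simp add: sq V flip: s_def)
  qed (use V sym Ka Kb Suc.prems K s in auto)
  also have "sqrt (K powr (1 / 2 ^ n)) = K powr (1 / 2 ^ Suc n)"
    using K by (simp add: powr_half_sqrt[symmetric] powr_powr mult.commute)
  finally show ?case unfolding s(3) .
qed

section \<open>Semigroups whose generator is symmetric and densely defined\<close>

text \<open>\<open>V\<close> stands for the classes of functions on one set, inside a type that
  cannot depend on the set. Continuity is assumed at time 0, and \<open>P_locally_bounded\<close>
  carries it to later times from both sides. \<open>gen\<close> is the full generator:
  \<open>dom\<close> is an equivalence, so that membership in the domain can also be established, as
  in \<open>gen_P\<close>.\<close>

locale densely_symmetric_semigroup =
  fixes V :: "'a::real_inner set" and P :: "real \<Rightarrow> 'a \<Rightarrow> 'a"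
    and gen :: "'a \<Rightarrow> 'a \<Rightarrow> bool"
  assumes subspace: "subspace V"
    and P_V: "\<And>t x. t \<ge> 0 \<Longrightarrow> x \<in> V \<Longrightarrow> P t x \<in> V"
    and P_lin: "\<And>t x y a b. t \<ge> 0 \<Longrightarrow> x \<in> V \<Longrightarrow> y \<in> V \<Longrightarrow>
      P t (a *\<^sub>R x + b *\<^sub>R y) = a *\<^sub>R P t x + b *\<^sub>R P t y"
    and P_bound: "\<And>t. t \<ge> 0 \<Longrightarrow> \<exists>B\<ge>0. \<forall>x\<in>V. norm (P t x) \<le> B * norm x"
    and P_0: "\<And>x. x \<in> V \<Longrightarrow> P 0 x = x"
    and P_add: "\<And>s t x. s \<ge> 0 \<Longrightarrow> t \<ge> 0 \<Longrightarrow> x \<in> V \<Longrightarrow> P (s + t) x = P s (P t x)"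
    and P_cont: "\<And>x. x \<in> V \<Longrightarrow> ((\<lambda>t. P t x) \<longlongrightarrow> x) (at_right 0)"
    and P_locally_bounded: "\<And>r. r > 0 \<Longrightarrow> \<exists>B\<ge>0. \<forall>t\<ge>r. \<forall>x\<in>V. norm (P t x) \<le> B * norm x"
    and dom: "\<And>x y. gen x y \<longleftrightarrow>
      x \<in> V \<and> y \<in> V \<and> ((\<lambda>t. (1 / t) *\<^sub>R (P t x - x)) \<longlongrightarrow> y) (at_right 0)"
    and gen_sym: "\<And>x y x' y'. gen x y \<Longrightarrow> gen x' y' \<Longrightarrow> y \<bullet> x' = x \<bullet> y'"
    and gen_dense: "V \<subseteq> closure {x. \<exists>y. gen x y}"
begin

lemma diff_V: "x \<in> V \<Longrightarrow> y \<in> V \<Longrightarrow> x - y \<in> V"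
  using subspace by (rule subspace_diff)

lemma scale_V: "x \<in> V \<Longrightarrow> c *\<^sub>R x \<in> V"
  using subspace by (rule subspace_scale)

lemma P_diff: "t \<ge> 0 \<Longrightarrow> x \<in> V \<Longrightarrow> y \<in> V \<Longrightarrow> P t (x - y) = P t x - P t y"
  using P_lin[of t x y 1 "-1"] by simp

lemma P_scale: "t \<ge> 0 \<Longrightarrow> x \<in> V \<Longrightarrow> P t (c *\<^sub>R x) = c *\<^sub>R P t x"
  using P_lin[of t x x c 0] by simp

lemma P_tendsto:
  assumes "t \<ge> 0" "\<And>z. f z \<in> V" "y \<in> V" "(f \<longlongrightarrow> y) F"
  shows "((\<lambda>z. P t (f z)) \<longlongrightarrow> P t y) F"
proof -
  obtain B where B: "B \<ge> 0" "\<forall>x\<in>V. norm (P t x) \<le> B * norm x" using P_bound assms by blast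
  have "((\<lambda>z. P t (f z) - P t y) \<longlongrightarrow> 0) F"
  proof (rule tendsto_0_le[where K = B])
    show "((\<lambda>z. f z - y) \<longlongrightarrow> 0) F" using assms by (simp add: LIM_zero)
    show "\<forall>\<^sub>F z in F. norm (P t (f z) - P t y) \<le> norm (f z - y) * B"
      using B assms diff_V by (simp add: mult.commute flip: P_diff)
  qed
  then show ?thesis by (simp add: LIM_zero_cancel)
qed

text \<open>\<open>P r\<close> commutes with the difference quotients of the semigroup at 0 and is
  bounded, so their limit may be taken inside.\<close>

lemma gen_P:
  assumes "gen x y" "r \<ge> 0"
  shows "gen (P r x) (P r y)"
proof -
  have V: "x \<in> V" "y \<in> V" and lim: "((\<lambda>t. (1 / t) *\<^sub>R (P t x - x)) \<longlongrightarrow> y) (at_right 0)"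
    using assms(1) dom by auto
  obtain B where B: "B \<ge> 0" "\<forall>x\<in>V. norm (P r x) \<le> B * norm x" using P_bound assms by blast
  have "((\<lambda>t. (1 / t) *\<^sub>R (P t (P r x) - P r x) - P r y) \<longlongrightarrow> 0) (at_right 0)"
  proof (rule tendsto_0_le[where K = B])
    show "((\<lambda>t. (1 / t) *\<^sub>R (P t x - x) - y) \<longlongrightarrow> 0) (at_right 0)" using lim by (simp add: LIM_zero)
    have "norm ((1 / t) *\<^sub>R (P t (P r x) - P r x) - P r y) \<le> norm ((1 / t) *\<^sub>R (P t x - x) - y) * B"
      if "t > 0" for t
    proof -
      have "P t (P r x) = P r (P t x)"
        using P_add[of t r x] P_add[of r t x] V that assms by (simp add: add.commute)
      then have "(1 / t) *\<^sub>R (P t (P r x) - P r x) - P r y = P r ((1 / t) *\<^sub>R (P t x - x) - y)"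
        using V that assms by (simp add: P_diff P_scale diff_V scale_V P_V)
      then show ?thesis using B V that by (simp add: diff_V scale_V P_V mult.commute)
    qed
    then show "\<forall>\<^sub>F t in at_right 0. norm ((1 / t) *\<^sub>R (P t (P r x) - P r x) - P r y)
        \<le> norm ((1 / t) *\<^sub>R (P t x - x) - y) * B"
      by (intro eventually_at_rightI[of 0 1]) auto
  qed
  then show ?thesis using V assms dom P_V by (simp add: LIM_zero_iff)
qed

text \<open>The right derivative is \<open>gen_P\<close>. In the left quotient the operator
  \<open>P (r - h)\<close> itself varies with \<open>h\<close>, so a bound uniform in
  \<open>h\<close> is needed; \<open>h < r / 2\<close> keeps all these times in the range of
  \<open>P_locally_bounded\<close>.\<close>

lemma P_has_vector_derivative:
  assumes "gen x y" "r > 0"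
  shows "((\<lambda>t. P t x) has_vector_derivative P r y) (at r)"
proof -
  have V: "x \<in> V" "y \<in> V" and lim: "((\<lambda>t. (1 / t) *\<^sub>R (P t x - x)) \<longlongrightarrow> y) (at_right 0)"
    using assms(1) dom by auto
  define D where "D h = (1 / h) *\<^sub>R (P (r + h) x - P r x)" for h
  have "((\<lambda>t. (1 / t) *\<^sub>R (P t (P r x) - P r x)) \<longlongrightarrow> P r y) (at_right 0)"
    using gen_P[OF assms(1), of r] assms dom by simp
  then have right: "(D \<longlongrightarrow> P r y) (at_right 0)"
    by (rule Lim_transform_eventually)
      (use V assms in \<open>auto intro!: eventually_at_rightI[of 0 1] simp: D_def add.commute[of r] P_add\<close>)
  obtain B where B: "B \<ge> 0" "\<forall>t\<ge>r/2. \<forall>x\<in>V. norm (P t x) \<le> B * norm x"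
    using P_locally_bounded[of "r / 2"] assms by auto
  have "((\<lambda>h. D (- h) - P r y) \<longlongrightarrow> 0) (at_right 0)"
  proof (rule tendsto_0_le[where K = B])
    have "((\<lambda>h. norm ((1 / h) *\<^sub>R (P h x - x) - y) + norm (P h y - y)) \<longlongrightarrow> 0 + 0) (at_right 0)"
      using lim P_cont[OF V(2)] by (intro tendsto_add tendsto_norm_zero LIM_zero)
    then show "((\<lambda>h. norm ((1 / h) *\<^sub>R (P h x - x) - y) + norm (P h y - y)) \<longlongrightarrow> 0) (at_right 0)" by simp
    have "norm (D (- h) - P r y) \<le> norm (norm ((1 / h) *\<^sub>R (P h x - x) - y) + norm (P h y - y)) * B"
      if h: "0 < h" "h < r / 2" for h
    proof -
      have rh: "r - h \<ge> r / 2" "r - h \<ge> 0" using h by auto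
      have *: "P r z = P (r - h) (P h z)" if "z \<in> V" for z using P_add[of "r - h" h z] that rh h by simp
      have "D (- h) = P (r - h) ((1 / h) *\<^sub>R (P h x - x))"
        unfolding D_def using V h rh
        by (simp add: P_diff P_scale diff_V scale_V P_V * scaleR_diff_right)
      moreover have "P r y = P (r - h) y + P (r - h) (P h y - y)"
        using V h rh by (simp add: P_diff P_V *)
      \<comment> \<open>The error splits into that of the quotient of \<open>x\<close> at 0 and the
        continuity error of \<open>y\<close> at 0, both under the same operator
        \<open>P (r - h)\<close>.\<close>
      ultimately have "D (- h) - P r y = P (r - h) ((1 / h) *\<^sub>R (P h x - x) - y) - P (r - h) (P h y - y)"
        using V h rh by (simp add: P_diff diff_V scale_V P_V)
      also have "norm \<dots> \<le> B * norm ((1 / h) *\<^sub>R (P h x - x) - y) + B * norm (P h y - y)"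
        using B rh V h by (intro order_trans[OF norm_triangle_ineq4] add_mono) (auto simp: diff_V scale_V P_V)
      finally show ?thesis by (simp add: algebra_simps)
    qed
    then show "\<forall>\<^sub>F h in at_right 0. norm (D (- h) - P r y)
        \<le> norm (norm ((1 / h) *\<^sub>R (P h x - x) - y) + norm (P h y - y)) * B"
      using assms by (intro eventually_at_rightI[of 0 "r / 2"]) auto
  qed
  then have "(D \<longlongrightarrow> P r y) (at_left 0)"
    by (simp add: LIM_zero_iff filterlim_at_left_to_right)
  with right have "(D \<longlongrightarrow> P r y) (at 0)" by (simp add: filterlim_split_at)
  then have "((\<lambda>h. norm (D h - P r y)) \<longlongrightarrow> 0) (at 0)" by (simp add: LIM_zero tendsto_norm_zero)
  then have "((\<lambda>h. norm (P (r + h) x - P r x - h *\<^sub>R P r y) / norm h) \<longlongrightarrow> 0) (at 0)"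
  proof (rule Lim_transform_eventually)
    have "norm (D h - P r y) = norm (P (r + h) x - P r x - h *\<^sub>R P r y) / norm h" if "h \<noteq> 0" for h
    proof -
      have "D h - P r y = (1 / h) *\<^sub>R (P (r + h) x - P r x - h *\<^sub>R P r y)"
        using that by (simp add: D_def scaleR_diff_right)
      then show ?thesis by simp
    qed
    then show "\<forall>\<^sub>F h in at 0. norm (D h - P r y) = norm (P (r + h) x - P r x - h *\<^sub>R P r y) / norm h"
      by (auto simp: eventually_at_filter)
  qed
  then show ?thesis
    unfolding has_vector_derivative_def has_derivative_at by (simp add: bounded_linear_scaleR_left)
qed

text \<open>One-sided continuity at 0 suffices because 0 is the left endpoint of the interval; at
  all other points differentiability gives continuity.\<close>

lemma P_continuous_on:
  assumes "gen x y"
  shows "continuous_on {0..s} (\<lambda>t. P t x)"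
  unfolding continuous_on_def
proof
  fix r assume r: "r \<in> {0..s}"
  have V: "x \<in> V" using assms dom by auto
  show "((\<lambda>t. P t x) \<longlongrightarrow> P r x) (at r within {0..s})"
  proof (cases "r = 0")
    case True
    then have "((\<lambda>t. P t x) \<longlongrightarrow> P r x) (at_right r)" using P_cont[OF V] P_0[OF V] by simp
    then show ?thesis
      by (rule tendsto_mono[rotated]) (auto simp: True at_within_def intro: le_infI2)
  next
    case False
    then have "isCont (\<lambda>t. P t x) r"
      using P_has_vector_derivative[OF assms, of r] r has_vector_derivative_continuous by auto
    then show ?thesis unfolding isCont_def by (rule tendsto_within_subset) simp
  qed
qed

text \<open>\<open>gen_P\<close> keeps both \<open>P r f\<close> and \<open>P (s - r) g\<close> in
  the domain, so \<open>gen_sym\<close> makes the two terms of the product rule cancel, and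
  \<open>H\<close> takes the same value at 0 and at \<open>s\<close>.\<close>

lemma P_sym_gen:
  assumes "gen f f'" "gen g g'" "s > 0"
  shows "P s f \<bullet> g = f \<bullet> P s g"
proof -
  have V: "f \<in> V" "g \<in> V" using assms dom by auto
  define H where "H r = P r f \<bullet> P (s - r) g" for r
  have "continuous_on {0..s} (\<lambda>r. P (s - r) g)"
    by (rule continuous_on_compose2[OF P_continuous_on[OF assms(2), of s]]) (auto intro!: continuous_intros)
  then have "continuous_on {0..s} H" unfolding H_def
    by (intro continuous_on_inner P_continuous_on[OF assms(1)])
  moreover have "DERIV H r :> 0" if r: "0 < r" "r < s" for r
  proof -
    have "((\<lambda>r. s - r) has_real_derivative - 1) (at r)" by (auto intro!: derivative_eq_intros)
    then have d2: "((\<lambda>r. P (s - r) g) has_vector_derivative (- 1) *\<^sub>R P (s - r) g') (at r)"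
      using vector_diff_chain_at[of "\<lambda>r. s - r" "-1" r "\<lambda>t. P t g"] 
        P_has_vector_derivative[OF assms(2), of "s - r"] r
      by (simp add: o_def has_real_derivative_iff_has_vector_derivative)
    have "(H has_vector_derivative (P r f \<bullet> ((- 1) *\<^sub>R P (s - r) g') + P r f' \<bullet> P (s - r) g)) (at r)"
      unfolding H_def
      by (rule bounded_bilinear.has_vector_derivative[OF bounded_bilinear_inner
            P_has_vector_derivative[OF assms(1) r(1)] d2])
    moreover have "P r f' \<bullet> P (s - r) g = P r f \<bullet> P (s - r) g'"
      using gen_sym gen_P assms r by simp
    ultimately show ?thesis by (simp add: has_real_derivative_iff_has_vector_derivative)
  qed
  ultimately have "H s = H 0" using DERIV_isconst2[of 0 s H s] assms by auto
  then show ?thesis using V by (simp add: H_def P_0)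
qed

lemma P_sym:
  assumes "x \<in> V" "y \<in> V" "s > 0"
  shows "P s x \<bullet> y = x \<bullet> P s y"
proof -
  have "x \<in> closure {x. \<exists>y. gen x y}" using gen_dense assms(1) by (rule subsetD)
  then obtain X where X: "\<And>n. \<exists>x'. gen (X n) x'" "X \<longlonglongrightarrow> x"
    by (auto simp: closure_sequential)
  have "y \<in> closure {x. \<exists>y. gen x y}" using gen_dense assms(2) by (rule subsetD)
  then obtain Y where Y: "\<And>n. \<exists>x'. gen (Y n) x'" "Y \<longlonglongrightarrow> y"
    by (auto simp: closure_sequential)
  have "X n \<in> V" "Y n \<in> V" for n using X(1)[of n] Y(1)[of n] dom by auto
  then have lim: "(\<lambda>n. P s (X n)) \<longlonglongrightarrow> P s x" "(\<lambda>n. P s (Y n)) \<longlonglongrightarrow> P s y"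
    using X Y assms by (auto intro!: P_tendsto)
  have "(\<lambda>n. P s (X n) \<bullet> Y n) \<longlonglongrightarrow> P s x \<bullet> y" by (intro tendsto_inner lim Y)
  moreover have "(\<lambda>n. X n \<bullet> P s (Y n)) \<longlonglongrightarrow> x \<bullet> P s y" by (intro tendsto_inner lim X)
  moreover have "P s (X n) \<bullet> Y n = X n \<bullet> P s (Y n)" for n
    using X(1) Y(1) P_sym_gen assms(3) by blast
  ultimately show ?thesis by (simp add: LIMSEQ_unique)
qed

text \<open>The quotient \<open>((f, f) - (P\<^sub>s f, f)) / s\<close> increases as \<open>s\<close> is halved because
  \<open>(f, f) - 2 (P\<^sub>s f, f) + (P\<^sub>2\<^sub>s f, f) = \<parallel>P\<^sub>s f - f\<parallel>\<^sup>2\<close>.\<close>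

lemma P_form_bound:
  assumes "gen f g" "s > 0"
  shows "(f - P s f) \<bullet> f \<le> - s * (g \<bullet> f)"
proof -
  have V: "f \<in> V" and lim: "((\<lambda>t. (1 / t) *\<^sub>R (P t f - f)) \<longlongrightarrow> g) (at_right 0)"
    using assms(1) dom by auto
  \<comment> \<open>\<open>m\<close> carries the opposite sign, so \<open>m r / r\<close> decreases
    when \<open>r\<close> is halved.\<close>
  define m where "m r = (P r f - f) \<bullet> f" for r
  have half: "2 * m (r / 2) \<le> m r" if "r > 0" for r
  proof -
    have "P r f = P (r / 2) (P (r / 2) f)" using P_add[of "r / 2" "r / 2" f] that V by simp
    then have "P r f \<bullet> f = P (r / 2) f \<bullet> P (r / 2) f" using P_sym[of "P (r / 2) f" f "r / 2"] that V P_V by simp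
    then have "m r - 2 * m (r / 2) = (P (r / 2) f - f) \<bullet> (P (r / 2) f - f)"
      unfolding m_def by (simp add: inner_diff_left inner_diff_right inner_commute)
    also have "\<dots> \<ge> 0" by simp
    finally show ?thesis by simp
  qed
  have iter: "2 ^ n * m (s / 2 ^ n) \<le> m s" for n
  proof (induction n)
    case (Suc n)
    have "2 ^ Suc n * m (s / 2 ^ Suc n) = 2 ^ n * (2 * m (s / 2 ^ n / 2))" by (simp add: mult.commute)
    also have "\<dots> \<le> 2 ^ n * m (s / 2 ^ n)" using half[of "s / 2 ^ n"] assms by (intro mult_left_mono) auto
    also have "\<dots> \<le> m s" by (rule Suc)
    finally show ?case .
  qed simp
  \<comment> \<open>Along \<open>s / 2 ^ n\<close> the quotients tend to
    \<open>g \<bullet> f\<close> by the definition of the generator, and each of them is at most the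
    quotient at \<open>s\<close>.\<close>
  have "filterlim (\<lambda>n. s / 2 ^ n) (at_right 0) sequentially"
    unfolding filterlim_at
    using assms by (auto intro!: LIMSEQ_divide_realpow_zero)
  then have "(\<lambda>n. ((1 / (s / 2 ^ n)) *\<^sub>R (P (s / 2 ^ n) f - f)) \<bullet> f) \<longlonglongrightarrow> g \<bullet> f"
    by (intro tendsto_inner tendsto_const filterlim_compose[OF lim])
  then have "g \<bullet> f \<le> m s / s"
    proof (rule LIMSEQ_le_const2, intro exI allI impI)
    fix n
    have "((1 / (s / 2 ^ n)) *\<^sub>R (P (s / 2 ^ n) f - f)) \<bullet> f = 2 ^ n * m (s / 2 ^ n) / s"
      by (simp add: m_def)
    also have "\<dots> \<le> m s / s" using iter assms by (intro divide_right_mono) auto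
    finally show "((1 / (s / 2 ^ n)) *\<^sub>R (P (s / 2 ^ n) f - f)) \<bullet> f \<le> m s / s" .
  qed
  then show ?thesis using assms unfolding m_def by (simp add: field_simps inner_diff_left)
qed

text \<open>In the application \<open>b n\<close> multiplies by |u| to the power
  \<open>1 / 2 ^ n\<close> and \<open>w\<close> is the class of u ln |u|, so that
  \<open>w \<bullet> u\<close> is the entropy integral; \<open>Q\<close> is the Dirichlet energy of
  \<open>u\<close>.\<close>

lemma log_sobolev:
  fixes b :: "nat \<Rightarrow> 'a \<Rightarrow> 'a"
  assumes bV: "\<And>n x. x \<in> V \<Longrightarrow> b n x \<in> V"
    and b_sym: "\<And>n x y. x \<in> V \<Longrightarrow> y \<in> V \<Longrightarrow> b n x \<bullet> y = x \<bullet> b n y"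
    and b_bound: "\<And>n. \<exists>B\<ge>0. \<forall>x\<in>V. norm (b n x) \<le> B * norm x"
    and b_square: "\<And>n x. x \<in> V \<Longrightarrow> b (Suc n) (b (Suc n) x) = b n x"
    and K: "\<And>x. x \<in> V \<Longrightarrow> norm (b 0 (P t x)) \<le> K * norm x" "K > 0"
    and t: "t > 0" and u: "u \<in> V"
    and Q: "\<And>s. s > 0 \<Longrightarrow> (u - P s u) \<bullet> u \<le> s * Q"
    and w: "(\<lambda>n. 2 ^ n *\<^sub>R (b n u - u)) \<longlonglongrightarrow> w"
  shows "w \<bullet> u \<le> t * Q + ln K * (norm u)\<^sup>2"
proof -
  define \<sigma> :: "nat \<Rightarrow> real" where "\<sigma> n = 1 / 2 ^ n" for n
  have \<sigma>: "\<sigma> n > 0" "\<sigma> n \<noteq> 0" for n by (simp_all add: \<sigma>_def)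
  have \<sigma>0: "\<sigma> \<longlonglongrightarrow> 0" unfolding \<sigma>_def by (rule LIMSEQ_divide_realpow_zero) simp
  \<comment> \<open>With T = \<open>P (t * \<sigma> n)\<close>, the difference (T u, b u) - (u, u)
    is (T u, b u - u) - (u - T u, u). The last pairing is at most \<open>t * \<sigma> n * Q\<close>;
    division by \<open>\<sigma> n\<close> turns \<open>b u - u\<close> into a difference
    quotient.\<close>
  have ineq: "P (t * \<sigma> n) u \<bullet> (2 ^ n *\<^sub>R (b n u - u)) - t * Q \<le> (K powr \<sigma> n - 1) / \<sigma> n * (norm u)\<^sup>2" for n
  proof -
    have "norm (b n (P (t * \<sigma> n) u)) \<le> K powr \<sigma> n * norm u"
      unfolding \<sigma>_def
      using cordes_dyadic[of V P b t K u n] P_V P_sym P_bound P_add[symmetric] assms by auto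
    then have "b n (P (t * \<sigma> n) u) \<bullet> u \<le> K powr \<sigma> n * norm u * norm u"
      by (meson norm_cauchy_schwarz norm_ge_zero mult_right_mono order_trans)
    moreover have "b n (P (t * \<sigma> n) u) \<bullet> u = P (t * \<sigma> n) u \<bullet> b n u"
      using P_V[of "t * \<sigma> n" u] b_sym t \<sigma>[of n] u by simp
    moreover have "(u - P (t * \<sigma> n) u) \<bullet> u \<le> t * \<sigma> n * Q" using Q t \<sigma> by simp
    ultimately have "P (t * \<sigma> n) u \<bullet> (b n u - u) - t * \<sigma> n * Q \<le> (K powr \<sigma> n - 1) * (norm u)\<^sup>2"
      by (simp add: algebra_simps power2_eq_square inner_diff_left inner_diff_right dot_square_norm)
    then have "(P (t * \<sigma> n) u \<bullet> (b n u - u) - t * \<sigma> n * Q) / \<sigma> n \<le> (K powr \<sigma> n - 1) * (norm u)\<^sup>2 / \<sigma> n"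
      using \<sigma>[of n] by (intro divide_right_mono) auto
    then show ?thesis using \<sigma>[of n] by (simp add: diff_divide_distrib) (simp add: \<sigma>_def field_simps)
  qed
  \<comment> \<open>Both factors of the pairing converge in norm:
    \<open>P (t * \<sigma> n) u\<close> to \<open>u\<close> by strong continuity, the quotients of
    \<open>b n\<close> to \<open>w\<close> by hypothesis.\<close>
  have "filterlim (\<lambda>n. t * \<sigma> n) (at_right 0) sequentially"
    unfolding filterlim_at using \<sigma>0 t \<sigma> by (auto intro!: tendsto_eq_intros)
  then have "(\<lambda>n. P (t * \<sigma> n) u) \<longlonglongrightarrow> u"
    using filterlim_compose[OF P_cont[OF u]] by blast
  then have L: "(\<lambda>n. P (t * \<sigma> n) u \<bullet> (2 ^ n *\<^sub>R (b n u - u)) - t * Q) \<longlonglongrightarrow> u \<bullet> w - t * Q"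
    by (intro tendsto_intros w)
  have "(\<lambda>n. (K powr \<sigma> n - 1) / \<sigma> n) \<longlonglongrightarrow> ln K"
    using powr_diff_quotient_tendsto[OF K(2)] by (simp add: \<sigma>_def mult.commute)
  then have R: "(\<lambda>n. (K powr \<sigma> n - 1) / \<sigma> n * (norm u)\<^sup>2) \<longlonglongrightarrow> ln K * (norm u)\<^sup>2"
    by (intro tendsto_intros)
  have "u \<bullet> w - t * Q \<le> ln K * (norm u)\<^sup>2"
    by (rule LIMSEQ_le[OF L R]) (use ineq in auto)
  then show ?thesis by (simp add: inner_commute)
qed

end

section \<open>The Hilbert space of square-integrable functions\<close>

definition square_integrable :: "(real^'n::finite \<Rightarrow> real) \<Rightarrow> bool" where
  "square_integrable f \<longleftrightarrow> f \<in> borel_measurable lebesgue \<and> integrable lebesgue (\<lambda>x. (f x)\<^sup>2)"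

lemma square_integrable_mult:
  assumes "square_integrable f" "square_integrable g"
  shows "integrable lebesgue (\<lambda>x. f x * g x)"
proof (rule Bochner_Integration.integrable_bound)
  show "integrable lebesgue (\<lambda>x. (f x)\<^sup>2 + (g x)\<^sup>2)"
    using assms by (auto simp: square_integrable_def)
  show "(\<lambda>x. f x * g x) \<in> borel_measurable lebesgue"
    using assms by (auto simp: square_integrable_def)
  have "\<bar>f x * g x\<bar> \<le> (f x)\<^sup>2 + (g x)\<^sup>2" for x
    using sum_squares_bound[of "\<bar>f x\<bar>" "\<bar>g x\<bar>"] zero_le_power2[of "f x"] zero_le_power2[of "g x"]
      mult_nonneg_nonneg[of "\<bar>f x\<bar>" "\<bar>g x\<bar>"] unfolding abs_mult power2_abs by linarith
  then show "AE x in lebesgue. norm (f x * g x) \<le> norm ((f x)\<^sup>2 + (g x)\<^sup>2)"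
    by (auto simp: abs_of_nonneg)
qed

lemma square_integrable_zero: "square_integrable (\<lambda>x. 0)"
  by (simp add: square_integrable_def)

lemma square_integrable_add:
  assumes "square_integrable f" "square_integrable g"
  shows "square_integrable (\<lambda>x. f x + g x)"
  using assms square_integrable_mult[OF assms]
  by (auto simp: square_integrable_def power2_sum mult.assoc)

lemma square_integrable_scale:
  assumes "square_integrable f"
  shows "square_integrable (\<lambda>x. c * f x)"
  using assms by (auto simp: square_integrable_def power_mult_distrib)

lemma square_integrable_diff:
  assumes "square_integrable f" "square_integrable g"
  shows "square_integrable (\<lambda>x. f x - g x)"
  using square_integrable_add[OF assms(1) square_integrable_scale[OF assms(2), of "-1"]] by simp

\<comment> \<open>Almost-everywhere classes make the inner product definite, as the abstract
  argument requires. The relation is partial because only square-integrable functions have a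
  class.\<close>
quotient_type 'n L2 = "real^('n::finite) \<Rightarrow> real" / partial:
  "\<lambda>f g. square_integrable f \<and> square_integrable g \<and> (AE x in lebesgue. f x = g x)"
proof (rule part_equivpI)
  show "\<exists>f :: real^'n \<Rightarrow> real. square_integrable f \<and> square_integrable f \<and> (AE x in lebesgue. f x = f x)"
    by (rule exI[of _ "\<lambda>x. 0"]) (simp add: square_integrable_zero)
qed (auto intro!: sympI transpI)

instantiation L2 :: (finite) real_inner
begin

lift_definition zero_L2 :: "'a L2" is "\<lambda>x. 0"
  by (simp add: square_integrable_zero)

lift_definition plus_L2 :: "'a L2 \<Rightarrow> 'a L2 \<Rightarrow> 'a L2" is "\<lambda>f g x. f x + g x"
  by (auto simp: square_integrable_add)

lift_definition minus_L2 :: "'a L2 \<Rightarrow> 'a L2 \<Rightarrow> 'a L2" is "\<lambda>f g x. f x - g x"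
  by (auto simp: square_integrable_diff)

lift_definition scaleR_L2 :: "real \<Rightarrow> 'a L2 \<Rightarrow> 'a L2" is "\<lambda>c f x. c * f x"
  by (auto simp: square_integrable_scale)

lift_definition inner_L2 :: "'a L2 \<Rightarrow> 'a L2 \<Rightarrow> real" is "\<lambda>f g. (LINT x|lebesgue. f x * g x)"
  by (intro integral_cong_AE) (auto simp: square_integrable_def)

definition uminus_L2 :: "'a L2 \<Rightarrow> 'a L2" where "uminus_L2 x = 0 - x"
definition norm_L2 :: "'a L2 \<Rightarrow> real" where "norm_L2 x = sqrt (x \<bullet> x)"
definition dist_L2 :: "'a L2 \<Rightarrow> 'a L2 \<Rightarrow> real" where "dist_L2 x y = norm (x - y)"
definition sgn_L2 :: "'a L2 \<Rightarrow> 'a L2" where "sgn_L2 x = inverse (norm x) *\<^sub>R x"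
definition uniformity_L2 :: "('a L2 \<times> 'a L2) filter" where
  "uniformity_L2 = (INF e\<in>{0<..}. principal {(x, y). dist x y < e})"
definition open_L2 :: "'a L2 set \<Rightarrow> bool" where
  "open_L2 U = (\<forall>x\<in>U. \<forall>\<^sub>F (x', y) in uniformity. x' = x \<longrightarrow> y \<in> U)"

instance
proof
  fix x y z :: "'a L2" and a b r :: real
  show "x + y + z = x + (y + z)"
    by transfer (auto simp: add.assoc intro!: square_integrable_add)
  show "x + y = y + x"
    by transfer (auto simp: add.commute intro!: square_integrable_add)
  show "0 + x = x" by transfer auto
  show "- x + x = 0" unfolding uminus_L2_def
    by transfer (auto intro!: square_integrable_add square_integrable_diff square_integrable_zero
        simp: square_integrable_scale[where c="-1", simplified])
  show "x - y = x + - y" unfolding uminus_L2_def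
    by transfer (auto intro!: square_integrable_add square_integrable_diff square_integrable_zero
        simp: square_integrable_scale[where c="-1", simplified])
  show "a *\<^sub>R (x + y) = a *\<^sub>R x + a *\<^sub>R y"
    by transfer (auto simp: distrib_left intro!: square_integrable_add square_integrable_scale)
  show "(a + b) *\<^sub>R x = a *\<^sub>R x + b *\<^sub>R x"
    by transfer (auto simp: distrib_right intro!: square_integrable_add square_integrable_scale)
  show "a *\<^sub>R b *\<^sub>R x = (a * b) *\<^sub>R x"
    by transfer (auto simp: mult.assoc intro!: square_integrable_scale)
  show "1 *\<^sub>R x = x" by transfer auto
  show "x \<bullet> y = y \<bullet> x" by transfer (simp add: mult.commute)
  show "(x + y) \<bullet> z = x \<bullet> z + y \<bullet> z"
    by transfer (auto simp: distrib_right square_integrable_mult)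
  show "(r *\<^sub>R x) \<bullet> y = r * (x \<bullet> y)"
    by transfer (simp add: mult.assoc)
  show "0 \<le> x \<bullet> x" by transfer simp
  show "x \<bullet> x = 0 \<longleftrightarrow> x = 0"
    by transfer
      (subst integral_nonneg_eq_0_iff_AE, auto simp: square_integrable_mult square_integrable_zero)
qed (simp_all only: norm_L2_def dist_L2_def sgn_L2_def uniformity_L2_def open_L2_def)

end

section \<open>Classes of functions on a measurable set\<close>

lemma Lp2_iff:
  "f \<in> Lp 2 S \<longleftrightarrow> f \<in> borel_measurable (lebesgue_on S) \<and> integrable (lebesgue_on S) (\<lambda>x. (f x)\<^sup>2)"
  by (simp add: Lp_def)

text \<open>The dictionary between functions that matter on \<open>S\<close> only and
  representatives on the whole space: extension by zero keeps measurability and the integral of the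
  square.\<close>

lemma Lp2_restrict_iff:
  assumes "S \<in> sets lebesgue"
  shows "f \<in> Lp 2 S \<longleftrightarrow> square_integrable (\<lambda>x. if x \<in> S then f x else 0)"
proof -
  have "(\<lambda>x. (if x \<in> S then f x else 0)\<^sup>2) = (\<lambda>x. indicator S x *\<^sub>R (f x)\<^sup>2)"
    by (auto simp: indicator_def)
  then show ?thesis
    unfolding Lp2_iff square_integrable_def using assms
    by (simp add: borel_measurable_if integrable_restrict_space)
qed

lemma integral_lebesgue_on:
  fixes f :: "real^'n::finite \<Rightarrow> real"
  assumes "S \<in> sets lebesgue"
  shows "integral\<^sup>L (lebesgue_on S) f = (LINT x|lebesgue. (if x \<in> S then f x else 0))"
  using assms by (subst integral_restrict_space) (auto intro!: Bochner_Integration.integral_cong)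

lemma AE_lebesgue_on:
  assumes "S \<in> sets lebesgue"
  shows "(AE x in lebesgue_on S. Q x) \<longleftrightarrow> (AE x in lebesgue. x \<in> S \<longrightarrow> Q x)"
  using assms by (simp add: AE_restrict_space_iff)

text \<open>As a type cannot depend on \<open>S\<close>, elements of \<open>L\<^sup>2(S)\<close> are extended by zero to the whole space.\<close>

definition L2_class :: "(real^'n::finite) set \<Rightarrow> (real^'n \<Rightarrow> real) \<Rightarrow> 'n L2" where
  "L2_class S f = abs_L2 (\<lambda>x. if x \<in> S then f x else 0)"

lemma Lp2_lincomb:
  assumes "S \<in> sets lebesgue" "f \<in> Lp 2 S" "g \<in> Lp 2 S"
  shows "(\<lambda>x. a * f x + b * g x) \<in> Lp 2 S"
proof -
  have "square_integrable (\<lambda>x. a * (if x \<in> S then f x else 0) + b * (if x \<in> S then g x else 0))"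
    using assms by (intro square_integrable_add square_integrable_scale) (auto simp: Lp2_restrict_iff)
  also have "(\<lambda>x. a * (if x \<in> S then f x else 0) + b * (if x \<in> S then g x else 0)) =
    (\<lambda>x. if x \<in> S then a * f x + b * g x else 0)" by auto
  finally show ?thesis using assms by (simp add: Lp2_restrict_iff)
qed

lemma Lp2_diff: "S \<in> sets lebesgue \<Longrightarrow> f \<in> Lp 2 S \<Longrightarrow> g \<in> Lp 2 S \<Longrightarrow> (\<lambda>x. f x - g x) \<in> Lp 2 S"
  using Lp2_lincomb[of S f g 1 "-1"] by simp

lemma Lp2_scale: "S \<in> sets lebesgue \<Longrightarrow> f \<in> Lp 2 S \<Longrightarrow> (\<lambda>x. c * f x) \<in> Lp 2 S"
  using Lp2_lincomb[of S f f c 0] by simp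

lemma Lp2_mult_integrable:
  assumes "S \<in> sets lebesgue" "f \<in> Lp 2 S" "g \<in> Lp 2 S"
  shows "integrable (lebesgue_on S) (\<lambda>x. f x * g x)"
proof -
  have "integrable lebesgue (\<lambda>x. (if x \<in> S then f x else 0) * (if x \<in> S then g x else 0))"
    using assms by (intro square_integrable_mult) (auto simp: Lp2_restrict_iff)
  also have "(\<lambda>x. (if x \<in> S then f x else 0) * (if x \<in> S then g x else 0)) =
    (\<lambda>x. indicator S x *\<^sub>R (f x * g x))" by (auto simp: indicator_def)
  finally show ?thesis using assms by (simp add: integrable_restrict_space)
qed

lemma L2_class_lincomb:
  assumes "S \<in> sets lebesgue" "f \<in> Lp 2 S" "g \<in> Lp 2 S"
  shows "L2_class S (\<lambda>x. a * f x + b * g x) = a *\<^sub>R L2_class S f + b *\<^sub>R L2_class S g"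
proof -
  have "(\<lambda>x. if x \<in> S then a * f x + b * g x else 0) =
    (\<lambda>x. a * (if x \<in> S then f x else 0) + b * (if x \<in> S then g x else 0))" by auto
  then show ?thesis using assms unfolding L2_class_def
    by (simp add: plus_L2.abs_eq scaleR_L2.abs_eq Lp2_restrict_iff square_integrable_scale)
qed

lemma L2_class_diff:
  "S \<in> sets lebesgue \<Longrightarrow> f \<in> Lp 2 S \<Longrightarrow> g \<in> Lp 2 S \<Longrightarrow>
    L2_class S (\<lambda>x. f x - g x) = L2_class S f - L2_class S g"
  using L2_class_lincomb[of S f g 1 "-1"] by simp

lemma L2_class_scale:
  "S \<in> sets lebesgue \<Longrightarrow> f \<in> Lp 2 S \<Longrightarrow> L2_class S (\<lambda>x. c * f x) = c *\<^sub>R L2_class S f"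
  using L2_class_lincomb[of S f f c 0] by simp

lemma inner_L2_class:
  assumes "S \<in> sets lebesgue" "f \<in> Lp 2 S" "g \<in> Lp 2 S"
  shows "L2_class S f \<bullet> L2_class S g = (LINT x|lebesgue_on S. f x * g x)"
proof -
  have "(\<lambda>x. (if x \<in> S then f x else 0) * (if x \<in> S then g x else 0)) =
    (\<lambda>x. if x \<in> S then f x * g x else 0)" by auto
  then show ?thesis using assms unfolding L2_class_def
    by (simp add: inner_L2.abs_eq Lp2_restrict_iff integral_lebesgue_on)
qed

lemma L2_class_eq_iff:
  assumes "S \<in> sets lebesgue" "f \<in> Lp 2 S" "g \<in> Lp 2 S"
  shows "L2_class S f = L2_class S g \<longleftrightarrow> (AE x in lebesgue_on S. f x = g x)"
proof -
  have "L2_class S f = L2_class S g \<longleftrightarrow>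
      (AE x in lebesgue. (if x \<in> S then f x else 0) = (if x \<in> S then g x else 0))"
    using assms unfolding L2_class_def
    using Quotient3_rel[OF Quotient3_L2, of "\<lambda>x. if x \<in> S then f x else 0" "\<lambda>x. if x \<in> S then g x else 0"]
    by (simp add: Lp2_restrict_iff)
  also have "\<dots> \<longleftrightarrow> (AE x in lebesgue. x \<in> S \<longrightarrow> f x = g x)" by (intro AE_cong) auto
  finally show ?thesis using assms by (simp add: AE_lebesgue_on)
qed

lemma norm_L2_class_square:
  assumes "S \<in> sets lebesgue" "f \<in> Lp 2 S"
  shows "(norm (L2_class S f))\<^sup>2 = (LINT x|lebesgue_on S. (f x)\<^sup>2)"
  unfolding power2_norm_eq_inner using inner_L2_class[OF assms assms(2)] by (simp add: power2_eq_square)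

lemma Lp_norm_2: "Lp_norm 2 S f = sqrt ((LINT x|lebesgue_on S. (norm (f x))\<^sup>2))"
  unfolding Lp_norm_def by (simp add: powr_half_sqrt)

lemma norm_L2_class:
  assumes "S \<in> sets lebesgue" "f \<in> Lp 2 S"
  shows "norm (L2_class S f) = Lp_norm 2 S f"
  using norm_L2_class_square[OF assms] by (simp add: Lp_norm_2 real_sqrt_unique)

section \<open>Smooth functions\<close>

text \<open>Derivatives up to order \<open>n\<close> are required to be differentiable, so the index
  \<open>n\<close> means differentiability of order \<open>n + 1\<close>. The recursion removes the
  derivative that acts first, which turns closure under sums and products into an induction on
  \<open>n\<close>.\<close>

primrec Ck :: "nat \<Rightarrow> (real^'n::finite) set \<Rightarrow> (real^'n \<Rightarrow> 'b::real_normed_vector) \<Rightarrow> bool" where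
  "Ck 0 S f \<longleftrightarrow> (\<forall>x\<in>S. f differentiable (at x))"
| "Ck (Suc n) S f \<longleftrightarrow> (\<forall>x\<in>S. f differentiable (at x)) \<and> (\<forall>i. Ck n S (partial_deriv i f))"

lemma partial_derivs_snoc: "partial_derivs (is @ [i]) f = partial_derivs is (partial_deriv i f)"
  by (induction "is") auto

text \<open>In \<open>partial_derivs\<close> the head of the list acts last and its last entry acts
  first; the lists are therefore split at the end to match the recursion of
  \<open>Ck\<close>.\<close>

lemma Ck_iff: "Ck n S f \<longleftrightarrow> (\<forall>is. length is \<le> n \<longrightarrow> (\<forall>x\<in>S. partial_derivs is f differentiable (at x)))"
proof (induction n arbitrary: f)
  case (Suc n)
  have "(\<forall>is. length is \<le> Suc n \<longrightarrow> Q is) \<longleftrightarrow> Q [] \<and> (\<forall>i is. length is \<le> n \<longrightarrow> Q (is @ [i]))"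
    for Q :: "'n list \<Rightarrow> bool"
    by (metis (no_types, lifting) Suc_le_mono le0 length_append_singleton list.size(3) rev_exhaust)
  from this[of "\<lambda>is. \<forall>x\<in>S. partial_derivs is f differentiable (at x)"] show ?case
    by (auto simp: Suc partial_derivs_snoc)
qed simp

lemma smooth_on_iff: "smooth_on S f \<longleftrightarrow> (\<forall>n. Ck n S f)"
  unfolding smooth_on_def Ck_iff by blast

lemma Ck_differentiable: "Ck n S f \<Longrightarrow> x \<in> S \<Longrightarrow> f differentiable (at x)"
  by (cases n) auto

lemma Ck_Suc_D: "Ck (Suc n) S f \<Longrightarrow> Ck n S f"
  by (auto simp: Ck_iff)

lemma smooth_on_differentiable: "smooth_on S f \<Longrightarrow> x \<in> S \<Longrightarrow> f differentiable (at x)"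
  unfolding smooth_on_iff using Ck_differentiable by blast

lemma smooth_on_partial_deriv: "smooth_on S f \<Longrightarrow> smooth_on S (partial_deriv i f)"
  unfolding smooth_on_iff by (metis Ck.simps(2))

lemma smooth_on_isCont: "smooth_on S f \<Longrightarrow> x \<in> S \<Longrightarrow> isCont f x"
  by (meson differentiable_imp_continuous_within smooth_on_differentiable)

lemma smooth_on_subset: "smooth_on S f \<Longrightarrow> T \<subseteq> S \<Longrightarrow> smooth_on T f"
  by (auto simp: smooth_on_def)

lemma smooth_on_Un: "smooth_on S f \<Longrightarrow> smooth_on T f \<Longrightarrow> smooth_on (S \<union> T) f"
  by (auto simp: smooth_on_def)

lemma partial_deriv_eq: "(f has_derivative f') (at x) \<Longrightarrow> partial_deriv i f x = f' (axis i 1)"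
  unfolding partial_deriv_def by (metis frechet_derivative_at)

lemma partial_deriv_cong_open:
  assumes "open S" "x \<in> S" "f differentiable (at x)" "\<And>y. y \<in> S \<Longrightarrow> f y = g y"
  shows "partial_deriv i f x = partial_deriv i g x"
  unfolding partial_deriv_def
  using frechet_derivative_transform_within_open[OF assms(3,1,2,4)] by simp

lemma differentiable_transform_open:
  assumes "f differentiable (at x)" "open S" "x \<in> S" "\<And>y. y \<in> S \<Longrightarrow> f y = g y"
  shows "g differentiable (at x)"
proof -
  obtain D where "(f has_derivative D) (at x)" using assms(1) by (auto simp: differentiable_def)
  then have "(g has_derivative D) (at x)" using assms(2-4) by (rule has_derivative_transform_within_open)
  then show ?thesis by (auto simp: differentiable_def)
qed

lemma Ck_cong:
  assumes "open S" "Ck n S f" "\<And>x. x \<in> S \<Longrightarrow> f x = g x"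
  shows "Ck n S g"
  using assms(2,3)
proof (induction n arbitrary: f g)
  case 0
  then show ?case using assms(1) by (auto intro: differentiable_transform_open[of f])
next
  case (Suc n)
  then have d: "\<forall>x\<in>S. f differentiable (at x)" by simp
  then have "\<forall>x\<in>S. g differentiable (at x)"
    using assms(1) Suc.prems(2) differentiable_transform_open[of f _ S g] by blast
  moreover have "Ck n S (partial_deriv i g)" for i
  proof (rule Suc.IH[of "partial_deriv i f"])
    show "Ck n S (partial_deriv i f)" using Suc.prems(1) by simp
    show "partial_deriv i f x = partial_deriv i g x" if "x \<in> S" for x
      using assms(1) that d Suc.prems(2) by (intro partial_deriv_cong_open[of S]) auto
  qed
  ultimately show ?case by simp
qed

lemma smooth_on_cong:
  "open S \<Longrightarrow> smooth_on S f \<Longrightarrow> (\<And>x. x \<in> S \<Longrightarrow> f x = g x) \<Longrightarrow> smooth_on S g"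
  unfolding smooth_on_iff using Ck_cong by blast

lemma partial_deriv_const: "partial_deriv i (\<lambda>x. c) = (\<lambda>x. 0)"
  by (rule ext) (rule partial_deriv_eq[OF has_derivative_const])

lemma Ck_const: "Ck n S (\<lambda>x. c)"
  by (induction n arbitrary: c) (auto simp: partial_deriv_const)

lemma Ck_add:
  assumes "open S"
  shows "Ck n S f \<Longrightarrow> Ck n S g \<Longrightarrow> Ck n S (\<lambda>x. f x + g x)"
proof (induction n arbitrary: f g)
  case (Suc n)
  have "Ck n S (partial_deriv i (\<lambda>x. f x + g x))" for i
  proof (rule Ck_cong[OF assms(1)])
    show "Ck n S (\<lambda>x. partial_deriv i f x + partial_deriv i g x)" using Suc by simp
    fix x assume "x \<in> S"
    then have "((\<lambda>x. f x + g x) has_derivative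
        (\<lambda>v. frechet_derivative f (at x) v + frechet_derivative g (at x) v)) (at x)"
      using Suc.prems by (intro has_derivative_add) (auto simp: frechet_derivative_works)
    then show "partial_deriv i f x + partial_deriv i g x = partial_deriv i (\<lambda>x. f x + g x) x"
      by (simp add: partial_deriv_eq) (simp add: partial_deriv_def)
  qed
  then show ?case using Suc.prems by simp
qed simp

lemma Ck_linear:
  assumes "open S" "bounded_linear L"
  shows "Ck n S f \<Longrightarrow> Ck n S (\<lambda>x. L (f x))"
proof (induction n arbitrary: f)
  case 0
  then show ?case using assms(2)
    by (auto intro: differentiable_compose bounded_linear_imp_differentiable)
next
  case (Suc n)
  have d: "((\<lambda>x. L (f x)) has_derivative (\<lambda>v. L (frechet_derivative f (at x) v))) (at x)" if "x \<in> S" for x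
    using that Suc.prems bounded_linear.has_derivative[OF assms(2)] by (auto simp: frechet_derivative_works)
  have "Ck n S (partial_deriv i (\<lambda>x. L (f x)))" for i
  proof (rule Ck_cong[OF assms(1)])
    show "Ck n S (\<lambda>x. L (partial_deriv i f x))" using Suc by simp
    fix x assume "x \<in> S"
    then show "L (partial_deriv i f x) = partial_deriv i (\<lambda>x. L (f x)) x"
      using partial_deriv_eq[OF d] by (simp add: partial_deriv_def)
  qed
  then show ?case using d by (auto simp: differentiable_def)
qed

text \<open>The Leibniz rule, for products of functions and for multiples of vector fields at once.
  The factor that is not differentiated gives up one order by \<open>Ck_Suc_D\<close>.\<close>

lemma Ck_bilinear:
  assumes "open S" "bounded_bilinear h"
  shows "Ck n S f \<Longrightarrow> Ck n S g \<Longrightarrow> Ck n S (\<lambda>x. h (f x) (g x))"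
proof (induction n arbitrary: f g)
  case 0
  then show ?case
    unfolding Ck.simps differentiable_def using bounded_bilinear.FDERIV[OF assms(2)] by blast
next
  case (Suc n)
  have d: "((\<lambda>x. h (f x) (g x)) has_derivative
      (\<lambda>v. h (f x) (frechet_derivative g (at x) v) + h (frechet_derivative f (at x) v) (g x))) (at x)"
    if "x \<in> S" for x
    using that Suc.prems by (intro bounded_bilinear.FDERIV[OF assms(2)]) (auto simp: frechet_derivative_works)
  have "Ck n S (partial_deriv i (\<lambda>x. h (f x) (g x)))" for i
  proof (rule Ck_cong[OF assms(1)])
    show "Ck n S (\<lambda>x. h (f x) (partial_deriv i g x) + h (partial_deriv i f x) (g x))"
      using Suc.prems by (intro Ck_add[OF assms(1)] Suc.IH) (auto intro: Ck_Suc_D simp del: Ck.simps simp: Ck.simps(2))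
    fix x assume "x \<in> S"
    then show "h (f x) (partial_deriv i g x) + h (partial_deriv i f x) (g x) = partial_deriv i (\<lambda>x. h (f x) (g x)) x"
      using partial_deriv_eq[OF d] by (simp add: partial_deriv_def)
  qed
  then show ?case using d by (auto simp: differentiable_def)
qed

lemma smooth_on_const: "smooth_on S (\<lambda>x. c)"
  by (simp add: smooth_on_iff Ck_const)

lemma smooth_on_add: "open S \<Longrightarrow> smooth_on S f \<Longrightarrow> smooth_on S g \<Longrightarrow> smooth_on S (\<lambda>x. f x + g x)"
  by (simp add: smooth_on_iff Ck_add)

lemma smooth_on_linear: "open S \<Longrightarrow> bounded_linear L \<Longrightarrow> smooth_on S f \<Longrightarrow> smooth_on S (\<lambda>x. L (f x))"
  by (simp add: smooth_on_iff Ck_linear)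

lemma smooth_on_bilinear:
  "open S \<Longrightarrow> bounded_bilinear h \<Longrightarrow> smooth_on S f \<Longrightarrow> smooth_on S g \<Longrightarrow> smooth_on S (\<lambda>x. h (f x) (g x))"
  by (simp add: smooth_on_iff Ck_bilinear)

lemma smooth_on_uminus:
  fixes f :: "real^'n::finite \<Rightarrow> 'b::real_normed_vector"
  shows "open S \<Longrightarrow> smooth_on S f \<Longrightarrow> smooth_on S (\<lambda>x. - f x)"
  by (rule smooth_on_linear[OF _ bounded_linear_minus[OF bounded_linear_ident]])

lemma smooth_on_diff:
  fixes f :: "real^'n::finite \<Rightarrow> 'b::real_normed_vector"
  shows "open S \<Longrightarrow> smooth_on S f \<Longrightarrow> smooth_on S g \<Longrightarrow> smooth_on S (\<lambda>x. f x - g x)"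
  using smooth_on_add[of S f "\<lambda>x. - g x"] smooth_on_uminus[of S g] by simp

lemma smooth_on_mult:
  fixes f :: "real^'n::finite \<Rightarrow> real"
  shows "open S \<Longrightarrow> smooth_on S f \<Longrightarrow> smooth_on S g \<Longrightarrow> smooth_on S (\<lambda>x. f x * g x)"
  by (rule smooth_on_bilinear[OF _ bounded_bilinear_mult])

lemma smooth_on_scaleR:
  "open S \<Longrightarrow> smooth_on S f \<Longrightarrow> smooth_on S g \<Longrightarrow> smooth_on S (\<lambda>x. f x *\<^sub>R g x)"
  by (rule smooth_on_bilinear[OF _ bounded_bilinear_scaleR])

lemma smooth_on_nth: "open S \<Longrightarrow> smooth_on S f \<Longrightarrow> smooth_on S (\<lambda>x. f x $ i)"
  by (rule smooth_on_linear[OF _ bounded_linear_vec_nth])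

lemma smooth_on_sum:
  assumes "open S" "\<And>i. i \<in> I \<Longrightarrow> smooth_on S (f i)"
  shows "smooth_on S (\<lambda>x. \<Sum>i\<in>I. f i x)"
  using assms(2) by (induction I rule: infinite_finite_induct) (auto intro: smooth_on_const smooth_on_add assms(1))

lemma smooth_on_prod:
  fixes f :: "'i \<Rightarrow> real^'n::finite \<Rightarrow> real"
  assumes "open S" "\<And>i. i \<in> I \<Longrightarrow> smooth_on S (f i)"
  shows "smooth_on S (\<lambda>x. \<Prod>i\<in>I. f i x)"
  using assms(2) by (induction I rule: infinite_finite_induct) (auto intro: smooth_on_const smooth_on_mult assms(1))

text \<open>\<open>h\<close> lists the successive derivatives of one function of a real variable. A
  partial derivative leads from \<open>h k\<close> to a constant multiple of
  \<open>h (Suc k)\<close> at the same argument, so the induction has to range over all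
  \<open>k\<close>.\<close>

lemma smooth_on_coordinate:
  fixes h :: "nat \<Rightarrow> real \<Rightarrow> real"
  assumes "\<And>k t. (h k has_real_derivative h (Suc k) t) (at t)"
  shows "smooth_on UNIV (\<lambda>x::real^'n::finite. h k (c * x $ i + d))"
proof -
  have D: "((\<lambda>x::real^'n. h k (c * x $ i + d)) has_derivative (\<lambda>v. h (Suc k) (c * x $ i + d) * (c * v $ i))) (at x)"
    for k x
  proof -
    have "((\<lambda>x::real^'n. c * x $ i + d) has_derivative (\<lambda>v. c * v $ i)) (at x)"
      by (auto intro!: derivative_eq_intros bounded_linear.has_derivative[OF bounded_linear_vec_nth])
    from has_derivative_compose[OF this assms[of k, unfolded has_field_derivative_def]]
    show ?thesis by simp
  qed
  have "Ck n UNIV (\<lambda>x::real^'n. h k (c * x $ i + d))" for n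
  proof (induction n arbitrary: k)
    case 0
    then show ?case using D by (auto simp: differentiable_def)
  next
    case (Suc n)
    have "partial_deriv j (\<lambda>x::real^'n. h k (c * x $ i + d)) =
        (\<lambda>x. h (Suc k) (c * x $ i + d) * (c * axis j 1 $ i))" for j
      by (rule ext) (rule partial_deriv_eq[OF D])
    then have "Ck n UNIV (partial_deriv j (\<lambda>x::real^'n. h k (c * x $ i + d)))" for j
      using Ck_linear[OF open_UNIV bounded_linear_mult_left Suc.IH] by simp
    then show ?case using D by (auto simp: differentiable_def)
  qed
  then show ?thesis by (simp add: smooth_on_iff)
qed

section \<open>A smooth function that vanishes on a half-line\<close>

text \<open>With y = 1/t, the derivative of p(y) exp(-y) with respect to t is y^2 (p(y) - p'(y))
  exp(-y); \<open>[:0, 0, 1:]\<close> is the factor y^2.\<close>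

fun bump_poly :: "nat \<Rightarrow> real poly" where
  "bump_poly 0 = 1"
| "bump_poly (Suc k) = [:0, 0, 1:] * (bump_poly k - pderiv (bump_poly k))"

text \<open>\<open>bump_deriv k\<close> is the \<open>k\<close>-th derivative of \<open>t \<mapsto> exp (- 1 / t)\<close>, extended by \<open>0\<close> to \<open>t \<le> 0\<close>.\<close>

definition bump_deriv :: "nat \<Rightarrow> real \<Rightarrow> real" where
  "bump_deriv k t = (if t > 0 then poly (bump_poly k) (1 / t) * exp (- (1 / t)) else 0)"

lemma poly_exp_at_top: "((\<lambda>y::real. poly p y * exp (- y)) \<longlongrightarrow> 0) at_top"
proof -
  have "((\<lambda>y. \<Sum>i\<le>degree p. coeff p i * (y ^ i / exp y)) \<longlongrightarrow> (\<Sum>i\<le>degree p. coeff p i * 0)) at_top"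
    by (intro tendsto_intros tendsto_power_div_exp_0)
  then show ?thesis
    by (simp add: poly_altdef sum_distrib_right exp_minus divide_inverse mult.assoc)
qed

lemma poly_exp_at_right: "((\<lambda>t::real. poly p (1 / t) * exp (- (1 / t))) \<longlongrightarrow> 0) (at_right 0)"
  using filterlim_compose[OF poly_exp_at_top filterlim_inverse_at_top_right, of p]
  by (simp add: inverse_eq_divide)

text \<open>Away from 0 this is the recursion of \<open>bump_poly\<close>, or trivial. At 0 the
  right difference quotient is again a polynomial in 1/h times exp(-1/h), where the division by
  \<open>h\<close> adds the factor \<open>[:0, 1:]\<close>, and it tends to 0.\<close>

lemma bump_deriv_derivative: "(bump_deriv k has_real_derivative bump_deriv (Suc k) t) (at t)"
proof -
  consider "t > 0" | "t < 0" | "t = 0" by linarith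
  then show ?thesis
  proof cases
    case 1
    have "((\<lambda>t. poly (bump_poly k) (1 / t) * exp (- (1 / t))) has_real_derivative bump_deriv (Suc k) t) (at t)"
      using 1 unfolding bump_deriv_def
      by (auto intro!: derivative_eq_intros simp: field_simps power2_eq_square)
    then show ?thesis
      by (rule has_field_derivative_transform_within_open[of _ _ _ "{0<..}"]) (use 1 in \<open>auto simp: bump_deriv_def\<close>)
  next
    case 2
    have "((\<lambda>t. 0) has_real_derivative 0) (at t)" by simp
    then have "(bump_deriv k has_real_derivative 0) (at t)"
      by (rule has_field_derivative_transform_within_open[of _ _ _ "{..<0}"]) (use 2 in \<open>auto simp: bump_deriv_def\<close>)
    then show ?thesis using 2 by (simp add: bump_deriv_def)
  next
    case 3
    have "((\<lambda>h. bump_deriv k h / h) \<longlongrightarrow> 0) (at_right 0)"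
    proof (rule Lim_transform_eventually[OF poly_exp_at_right[of "[:0, 1:] * bump_poly k"]])
      show "\<forall>\<^sub>F h in at_right 0. poly ([:0, 1:] * bump_poly k) (1 / h) * exp (- (1 / h)) = bump_deriv k h / h"
        by (rule eventually_at_rightI[of 0 1]) (auto simp: bump_deriv_def)
    qed
    moreover have "((\<lambda>h. bump_deriv k h / h) \<longlongrightarrow> 0) (at_left 0)"
      by (rule Lim_transform_eventually[OF tendsto_const])
        (auto simp: bump_deriv_def eventually_at_filter)
    ultimately show ?thesis unfolding 3 DERIV_def
      by (simp add: filterlim_split_at bump_deriv_def[of _ 0])
  qed
qed

lemma bump_nonneg: "bump_deriv 0 t \<ge> 0" and bump_le_1: "bump_deriv 0 t \<le> 1"
  by (auto simp: bump_deriv_def)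

lemma bump_eq_0: "t \<le> 0 \<Longrightarrow> bump_deriv 0 t = 0"
  by (auto simp: bump_deriv_def)

lemma bump_tendsto_1:
  assumes "a > 0"
  shows "(\<lambda>m. bump_deriv 0 (real m * a - 1)) \<longlonglongrightarrow> 1"
proof -
  have top: "filterlim (\<lambda>m. real m * a - 1) at_top sequentially"
    using assms
    by (intro filterlim_tendsto_add_at_top[of "\<lambda>_. -1" "-1", unfolded add.commute[of "-1"], simplified]
         filterlim_at_top_mult_tendsto_pos[OF tendsto_const _ filterlim_real_sequentially]) auto
  then have "(\<lambda>m. exp (- (1 / (real m * a - 1)))) \<longlonglongrightarrow> exp (- 0)"
    by (intro tendsto_intros) (auto intro!: real_tendsto_divide_at_top[OF tendsto_const])
  moreover have "\<forall>\<^sub>F m in sequentially. exp (- (1 / (real m * a - 1))) = bump_deriv 0 (real m * a - 1)"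
    using filterlim_at_top_dense[THEN iffD1, OF top, rule_format, of 0]
    by eventually_elim (simp add: bump_deriv_def)
  ultimately show ?thesis by (auto intro: Lim_transform_eventually)
qed

section \<open>Test functions\<close>

lemma square_le_square: "\<bar>a\<bar> \<le> b \<Longrightarrow> (a::real)\<^sup>2 \<le> b\<^sup>2"
  using power_mono[of "\<bar>a\<bar>" b 2] by simp

text \<open>Dominated convergence in L^2: a square-integrable majorant \<open>w\<close> of the
  sequence also bounds its limit, so the squared differences are at most 4 w^2.\<close>

lemma L2_class_tendsto:
  fixes f :: "nat \<Rightarrow> real^'n::finite \<Rightarrow> real"
  assumes S: "S \<in> sets lebesgue" and fm: "\<And>m. f m \<in> borel_measurable (lebesgue_on S)"
    and gm: "g \<in> borel_measurable (lebesgue_on S)" and w: "w \<in> Lp 2 S"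
    and bd: "\<And>m. AE x in lebesgue_on S. \<bar>f m x\<bar> \<le> w x"
    and lim: "AE x in lebesgue_on S. (\<lambda>m. f m x) \<longlonglongrightarrow> g x"
  shows "(\<And>m. f m \<in> Lp 2 S)" "g \<in> Lp 2 S" "(\<lambda>m. L2_class S (f m)) \<longlonglongrightarrow> L2_class S g"
proof -
  have dom: "h \<in> Lp 2 S" if "h \<in> borel_measurable (lebesgue_on S)" "AE x in lebesgue_on S. \<bar>h x\<bar> \<le> w x" for h
    unfolding Lp2_iff
  proof (rule conjI[OF that(1)], rule Bochner_Integration.integrable_bound)
    show "integrable (lebesgue_on S) (\<lambda>x. (w x)\<^sup>2)" using w by (simp add: Lp2_iff)
    show "(\<lambda>x. (h x)\<^sup>2) \<in> borel_measurable (lebesgue_on S)" using that by simp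
    show "AE x in lebesgue_on S. norm ((h x)\<^sup>2) \<le> norm ((w x)\<^sup>2)"
      using that(2) by eventually_elim (simp add: square_le_square)
  qed
  have all: "AE x in lebesgue_on S. \<forall>m. \<bar>f m x\<bar> \<le> w x" using bd by (simp add: AE_all_countable)
  with lim have gw: "AE x in lebesgue_on S. \<bar>g x\<bar> \<le> w x"
  proof eventually_elim
    case (elim x)
    then show ?case by (intro LIMSEQ_le_const2[OF tendsto_rabs[OF elim(1)]]) auto
  qed
  show fL: "f m \<in> Lp 2 S" for m by (rule dom[OF fm bd])
  show gL: "g \<in> Lp 2 S" by (rule dom[OF gm gw])
  have "(\<lambda>m. (LINT x|lebesgue_on S. (f m x - g x)\<^sup>2)) \<longlonglongrightarrow> (LINT x|lebesgue_on S. 0)"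
  proof (rule integral_dominated_convergence[where w = "\<lambda>x. 4 * (w x)\<^sup>2"])
    show "integrable (lebesgue_on S) (\<lambda>x. 4 * (w x)\<^sup>2)" using w by (simp add: Lp2_iff)
    show "AE x in lebesgue_on S. (\<lambda>m. (f m x - g x)\<^sup>2) \<longlonglongrightarrow> 0"
      using lim by eventually_elim (auto intro!: tendsto_eq_intros)
    fix m
    show "AE x in lebesgue_on S. norm ((f m x - g x)\<^sup>2) \<le> 4 * (w x)\<^sup>2"
      using bd[of m] gw
    proof eventually_elim
      case (elim x)
      then have "\<bar>f m x - g x\<bar> \<le> 2 * w x" by linarith
      from square_le_square[OF this] show ?case by (simp add: power_mult_distrib)
    qed
  qed (use fm gm in measurable)
  then have "(\<lambda>m. (norm (L2_class S (f m) - L2_class S g))\<^sup>2) \<longlonglongrightarrow> 0"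
    using norm_L2_class_square[OF S Lp2_diff[OF S fL gL]] by (simp add: L2_class_diff[OF S fL gL])
  then have "(\<lambda>m. norm (L2_class S (f m) - L2_class S g)) \<longlonglongrightarrow> 0"
    using tendsto_real_sqrt[of "\<lambda>m. (norm (L2_class S (f m) - L2_class S g))\<^sup>2" 0] by simp
  then show "(\<lambda>m. L2_class S (f m)) \<longlonglongrightarrow> L2_class S g"
    by (simp add: tendsto_norm_zero_iff LIM_zero_iff)
qed

lemma Lp2_bounded:
  assumes "S \<in> lmeasurable" "f \<in> borel_measurable (lebesgue_on S)" "AE x in lebesgue_on S. \<bar>f x\<bar> \<le> B"
  shows "f \<in> Lp 2 S"
  unfolding Lp2_iff
proof (intro conjI assms finite_measure.integrable_const_bound[OF finite_measure_lebesgue_on])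
  show "AE x in lebesgue_on S. norm ((f x)\<^sup>2) \<le> B\<^sup>2"
    using assms(3) by eventually_elim (simp add: square_le_square)
qed (use assms in measurable)

lemma smooth_on_UNIV_of_support:
  assumes "open V" "smooth_on V f" "closed K" "K \<subseteq> V" "\<And>x. x \<notin> K \<Longrightarrow> f x = 0"
  shows "smooth_on UNIV f"
proof -
  have "smooth_on (- K) f"
    by (rule smooth_on_cong[OF _ smooth_on_const[of _ 0]]) (use assms in auto)
  then have "smooth_on (V \<union> - K) f" using assms smooth_on_Un by blast
  moreover have "V \<union> - K = UNIV" using assms by auto
  ultimately show ?thesis by simp
qed

text \<open>Any compact \<open>K\<close> off which \<open>f\<close> vanishes may stand for the
  support, and smoothness has to be known on \<open>V\<close> only, where the vector fields are
  smooth; off \<open>K\<close> it is automatic.\<close>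

lemma test_functionsI:
  assumes "open V" "smooth_on V f" "compact K" "K \<subseteq> V" "\<And>x. x \<notin> K \<Longrightarrow> f x = 0"
  shows "f \<in> test_functions V"
proof -
  have cl: "closure {x. f x \<noteq> 0} \<subseteq> K"
    using assms by (intro closure_minimal) (auto intro: compact_imp_closed)
  have "smooth_on UNIV f"
    by (rule smooth_on_UNIV_of_support[OF assms(1,2) compact_imp_closed[OF assms(3)] assms(4,5)])
  moreover have "compact (closure {x. f x \<noteq> 0})"
    using cl assms(3) by (metis closed_closure compact_Int_closed inf.absorb_iff2)
  ultimately show ?thesis using cl assms unfolding test_functions_def by auto
qed

lemma test_functionsE:
  assumes "f \<in> test_functions V"
  obtains K where "compact K" "K \<subseteq> V" "\<And>x. x \<notin> K \<Longrightarrow> f x = 0"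
  using assms closure_subset[of "{x. f x \<noteq> 0}"] unfolding test_functions_def by blast

lemma test_functions_smooth: "f \<in> test_functions V \<Longrightarrow> smooth_on S f"
  unfolding test_functions_def using smooth_on_subset by blast

lemma test_functions_mono: "V \<subseteq> W \<Longrightarrow> test_functions V \<subseteq> test_functions W"
  unfolding test_functions_def by auto

lemma test_functions_continuous: "f \<in> test_functions V \<Longrightarrow> continuous_on S f"
  by (intro continuous_at_imp_continuous_on ballI smooth_on_isCont[OF test_functions_smooth[of f V UNIV]]) auto

lemma continuous_measurable_lebesgue_on:
  fixes f :: "real^'n::finite \<Rightarrow> real"
  assumes "continuous_on UNIV f"
  shows "f \<in> borel_measurable (lebesgue_on S)"
  using borel_measurable_continuous_onI[OF assms] by (intro measurable_restrict_space1 measurable_completion) auto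

lemma continuous_compact_support:
  fixes f :: "real^'n::finite \<Rightarrow> 'b::euclidean_space"
  assumes "continuous_on UNIV f" "compact K" "\<And>x. x \<notin> K \<Longrightarrow> f x = 0"
  shows "integrable lborel f" "integrable lebesgue f" "\<exists>B. \<forall>x. norm (f x) \<le> B"
proof -
  have "(\<lambda>x. indicator K x *\<^sub>R f x) = f" using assms(3) by (auto simp: indicator_def)
  then show lb: "integrable lborel f"
    using borel_integrable_compact[OF assms(2) continuous_on_subset[OF assms(1)]] by auto
  then show "integrable lebesgue f"
    by (subst integrable_completion) (auto intro: borel_measurable_integrable)
  have "bounded (f ` K)"
    using assms by (intro compact_imp_bounded compact_continuous_image) (auto intro: continuous_on_subset)
  then obtain B where B: "\<forall>y\<in>f ` K. norm y \<le> B" by (auto simp: bounded_iff)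
  show "\<exists>B. \<forall>x. norm (f x) \<le> B"
  proof (intro exI allI)
    fix x show "norm (f x) \<le> max B 0" using B assms(3)[of x] by (cases "x \<in> K") force+
  qed
qed

lemma test_functions_bounded:
  assumes "f \<in> test_functions V"
  obtains B where "\<And>x. \<bar>f x\<bar> \<le> B"
proof -
  obtain K where K: "compact K" "K \<subseteq> V" "\<And>x. x \<notin> K \<Longrightarrow> f x = 0" using test_functionsE[OF assms] by metis
  from continuous_compact_support(3)[OF test_functions_continuous[OF assms] K(1,3)]
  obtain B where "\<And>x. norm (f x) \<le> B" by blast
  then show ?thesis by (intro that[of B]) simp
qed

lemma test_functions_integrable:
  assumes "f \<in> test_functions V"
  shows "integrable lborel f" "integrable lebesgue f"
proof -
  obtain K where K: "compact K" "K \<subseteq> V" "\<And>x. x \<notin> K \<Longrightarrow> f x = 0" using test_functionsE[OF assms] by metis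
  note cont = test_functions_continuous[OF assms]
  show "integrable lborel f" by (rule continuous_compact_support(1)[OF cont K(1,3)])
  show "integrable lebesgue f" by (rule continuous_compact_support(2)[OF cont K(1,3)])
qed

section \<open>Integrals of derivatives with compact support\<close>

lemma partial_deriv_zero_off:
  assumes "closed K" "\<And>y. y \<notin> K \<Longrightarrow> f y = 0" "x \<notin> K"
  shows "partial_deriv i f x = 0"
proof -
  have "partial_deriv i (\<lambda>x. 0) x = partial_deriv i f x"
    using assms by (intro partial_deriv_cong_open[of "- K"]) auto
  then show ?thesis by (simp add: partial_deriv_const)
qed

lemma partial_deriv_nth:
  assumes "F differentiable (at x)"
  shows "partial_deriv i (\<lambda>y. F y $ j) x = partial_deriv i F x $ j"
proof -
  have "(F has_derivative frechet_derivative F (at x)) (at x)" using assms by (simp add: frechet_derivative_works)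
  from partial_deriv_eq[OF bounded_linear.has_derivative[OF bounded_linear_vec_nth this]]
  show ?thesis by (simp add: partial_deriv_def)
qed

text \<open>By translation invariance every difference quotient of \<open>h\<close> in direction
  \<open>e\<close> has integral 0, and these quotients converge dominatedly to the partial
  derivative.\<close>

lemma integral_partial_deriv_zero:
  fixes h :: "real^'n::finite \<Rightarrow> real"
  assumes h: "smooth_on UNIV h" and K: "compact K" "\<And>x. x \<notin> K \<Longrightarrow> h x = 0"
  shows "integral\<^sup>L lborel (partial_deriv i h) = 0"
proof -
  define e where "e = (axis i 1 :: real^'n)"
  have e: "norm e = 1" by (simp add: e_def)
  have cont: "continuous_on UNIV h"
    by (intro continuous_at_imp_continuous_on ballI smooth_on_isCont[OF h]) auto
  have contd: "continuous_on UNIV (partial_deriv i h)"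
    by (intro continuous_at_imp_continuous_on ballI smooth_on_isCont[OF smooth_on_partial_deriv[OF h]]) auto
  have d0: "partial_deriv i h x = 0" if "x \<notin> K" for x
    using partial_deriv_zero_off[of K h x] K that compact_imp_closed by blast
  obtain B where B: "\<And>x. \<bar>partial_deriv i h x\<bar> \<le> B"
    using continuous_compact_support(3)[OF contd K(1) d0] by auto
  have B0: "B \<ge> 0" using B[of 0] by linarith
  obtain R where R: "\<And>x. x \<in> K \<Longrightarrow> norm x \<le> R" using compact_imp_bounded[OF K(1)] by (auto simp: bounded_iff)
  have der: "((\<lambda>t. h (x + t *\<^sub>R e)) has_real_derivative partial_deriv i h (x + t *\<^sub>R e)) (at t)" for x t
  proof -
    have "((\<lambda>t. x + t *\<^sub>R e) has_derivative (\<lambda>s. s *\<^sub>R e)) (at t)"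
      by (auto intro!: derivative_eq_intros)
    moreover have dh: "(h has_derivative frechet_derivative h (at (x + t *\<^sub>R e))) (at (x + t *\<^sub>R e))"
      using smooth_on_differentiable[OF h] frechet_derivative_works by blast
    ultimately have "((\<lambda>t. h (x + t *\<^sub>R e)) has_derivative
        (\<lambda>s. frechet_derivative h (at (x + t *\<^sub>R e)) (s *\<^sub>R e))) (at t)"
      by (rule has_derivative_compose)
    moreover have "frechet_derivative h (at (x + t *\<^sub>R e)) (s *\<^sub>R e) = partial_deriv i h (x + t *\<^sub>R e) * s" for s
      using linear_scale[OF has_derivative_linear[OF dh], of s e] by (simp add: partial_deriv_def e_def)
    ultimately show ?thesis by (simp add: has_field_derivative_def)
  qed
  define q where "q m x = real (Suc m) * (h (x + (1 / real (Suc m)) *\<^sub>R e) - h x)" for m x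
  have ih: "integrable lborel h" by (rule continuous_compact_support(1)[OF cont K])
  have int_q: "integral\<^sup>L lborel (q m) = 0" for m
  proof -
    define c where "c = (1 / real (Suc m)) *\<^sub>R e"
    have hb: "h \<in> borel_measurable lborel" using borel_measurable_integrable[OF ih] .
    have "integral\<^sup>L lborel h = integral\<^sup>L (distr lborel borel ((+) c)) h" by (simp add: lborel_distr_plus)
    also have "\<dots> = (LINT x|lborel. h (c + x))" using hb by (subst integral_distr) auto
    finally have 1: "(LINT x|lborel. h (x + c)) = integral\<^sup>L lborel h" by (simp add: add.commute)
    have "integrable (distr lborel borel ((+) c)) h" using ih by (simp add: lborel_distr_plus)
    then have 2: "integrable lborel (\<lambda>x. h (x + c))" using hb by (subst (asm) integrable_distr_eq) (auto simp: add.commute)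
    show ?thesis unfolding q_def c_def[symmetric] using 1 2 ih by simp
  qed
  have "(\<lambda>m. integral\<^sup>L lborel (q m)) \<longlonglongrightarrow> integral\<^sup>L lborel (partial_deriv i h)"
  \<comment> \<open>The steps \<open>1 / real (Suc m)\<close> are at most 1, so all quotients vanish
    outside the ball of radius \<open>R + 1\<close>; inside it the mean value theorem bounds them by
    \<open>B\<close>.\<close>
  proof (rule integral_dominated_convergence[where w = "\<lambda>x. B * indicator (cball 0 (R + 1)) x"])
    show "partial_deriv i h \<in> borel_measurable lborel"
      using borel_measurable_continuous_onI[OF contd] by simp
    have [measurable]: "h \<in> borel_measurable borel" by (rule borel_measurable_continuous_onI[OF cont])
    show "q m \<in> borel_measurable lborel" for m unfolding q_def by measurable
    show "integrable lborel (\<lambda>x. B * indicator (cball 0 (R + 1)) x)"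
      using emeasure_lborel_cball_finite by (intro integrable_mult_right) (simp add: integrable_indicator_iff)
    show "AE x in lborel. (\<lambda>m. q m x) \<longlonglongrightarrow> partial_deriv i h x"
    proof (rule AE_I2)
      fix x
      have "((\<lambda>t. (h (x + t *\<^sub>R e) - h x) / t) \<longlongrightarrow> partial_deriv i h x) (at 0)"
        using der[of x 0] by (simp add: DERIV_def)
      moreover have "filterlim (\<lambda>m. 1 / real (Suc m)) (at 0) sequentially"
        unfolding filterlim_at using LIMSEQ_Suc[OF lim_1_over_n] by auto
      ultimately have "(\<lambda>m. (h (x + (1 / real (Suc m)) *\<^sub>R e) - h x) / (1 / real (Suc m))) \<longlonglongrightarrow> partial_deriv i h x"
        by (rule filterlim_compose)
      then show "(\<lambda>m. q m x) \<longlonglongrightarrow> partial_deriv i h x" by (simp add: q_def mult.commute)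
    qed
    fix m
    show "AE x in lborel. norm (q m x) \<le> B * indicator (cball 0 (R + 1)) x"
    proof (rule AE_I2)
      fix x
      define t where "t = 1 / real (Suc m)"
      have t: "0 < t" "t \<le> 1" by (auto simp: t_def)
      show "norm (q m x) \<le> B * indicator (cball 0 (R + 1)) x"
      proof (cases "norm x \<le> R + 1")
        case True
        obtain z where "h (x + t *\<^sub>R e) - h (x + 0 *\<^sub>R e) = (t - 0) * partial_deriv i h (x + z *\<^sub>R e)"
          using MVT2[OF t(1), of "\<lambda>t. h (x + t *\<^sub>R e)" "\<lambda>t. partial_deriv i h (x + t *\<^sub>R e)"] der by blast
        then have "q m x = partial_deriv i h (x + z *\<^sub>R e)"
          unfolding q_def t_def[symmetric] by (simp add: t_def)
        then show ?thesis using B True by (simp add: indicator_def)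
      next
        case False
        have "norm x \<le> norm (x + t *\<^sub>R e) + norm (t *\<^sub>R e)" using norm_triangle_ineq4[of "x + t *\<^sub>R e" "t *\<^sub>R e"] by simp
        then have "norm (x + t *\<^sub>R e) > R" using False t e by simp
        then have "x \<notin> K" "x + t *\<^sub>R e \<notin> K" using R False t by force+
        then show ?thesis using K(2) B0 by (simp add: q_def t_def)
      qed
    qed
  qed
  then show ?thesis using int_q by (simp add: LIMSEQ_const_iff)
qed

lemma integral_divergence_zero:
  assumes F: "smooth_on UNIV F" and K: "compact K" "\<And>x. x \<notin> K \<Longrightarrow> F x = 0"
  shows "integral\<^sup>L lborel (divergence F) = 0"
proof -
  have comp: "partial_deriv i F x $ j = partial_deriv i (\<lambda>y. F y $ j) x" for i j x
    using partial_deriv_nth[OF smooth_on_differentiable[OF F UNIV_I]] by simp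
  have sm: "smooth_on UNIV (\<lambda>y. F y $ i)" for i by (rule smooth_on_nth[OF open_UNIV F])
  have int: "integrable lborel (partial_deriv i (\<lambda>y. F y $ i))" for i
  proof (rule continuous_compact_support(1)[OF _ K(1)])
    show "continuous_on UNIV (partial_deriv i (\<lambda>y. F y $ i))"
      by (intro continuous_at_imp_continuous_on ballI smooth_on_isCont[OF smooth_on_partial_deriv[OF sm]]) auto
    show "partial_deriv i (\<lambda>y. F y $ i) x = 0" if "x \<notin> K" for x
      using K that by (intro partial_deriv_zero_off[of K]) (auto intro: compact_imp_closed)
  qed
  have "integral\<^sup>L lborel (divergence F) = (\<Sum>i\<in>UNIV. integral\<^sup>L lborel (partial_deriv i (\<lambda>y. F y $ i)))"
    unfolding divergence_def comp using int by (simp add: Bochner_Integration.integral_sum)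
  also have "\<dots> = 0"
    by (intro sum.neutral ballI integral_partial_deriv_zero[OF sm K(1)]) (simp add: K(2))
  finally show ?thesis .
qed

lemma test_functions_zero: "f \<in> test_functions V \<Longrightarrow> x \<notin> V \<Longrightarrow> f x = 0"
  by (elim test_functionsE) blast

section \<open>Approximation of indicators by test functions\<close>

text \<open>The offset -1 makes a factor vanish as soon as \<open>x\<close> is within
  \<open>1 / real (Suc m)\<close> of the corresponding face, so the support is a compact subset of
  the open box. As \<open>m\<close> grows, every factor tends to 1 inside the box.\<close>

definition box_bump :: "real^'n::finite \<Rightarrow> real^'n \<Rightarrow> nat \<Rightarrow> real^'n \<Rightarrow> real" where
  "box_bump a b m x = (\<Prod>i\<in>UNIV. bump_deriv 0 (real (Suc m) * (x $ i - a $ i) - 1) *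
     bump_deriv 0 (real (Suc m) * (b $ i - x $ i) - 1))"

lemma box_bump_nonneg: "box_bump a b m x \<ge> 0" and box_bump_le_1: "box_bump a b m x \<le> 1"
  unfolding box_bump_def
  by (auto intro!: prod_nonneg prod_le_1 mult_nonneg_nonneg mult_le_one bump_nonneg bump_le_1)

lemma box_bump_test:
  fixes a b :: "real^'n::finite"
  shows "box_bump a b m \<in> test_functions (box a b)"
proof (rule test_functionsI)
  have "smooth_on UNIV (box_bump a b m)" unfolding box_bump_def
  proof (intro smooth_on_prod smooth_on_mult open_UNIV)
    fix i
    show "smooth_on UNIV (\<lambda>x::real^'n. bump_deriv 0 (real (Suc m) * (x $ i - a $ i) - 1))"
      using smooth_on_coordinate[of bump_deriv 0 "real (Suc m)" i "- real (Suc m) * a $ i - 1", OF bump_deriv_derivative]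
      by (simp add: algebra_simps)
    show "smooth_on UNIV (\<lambda>x::real^'n. bump_deriv 0 (real (Suc m) * (b $ i - x $ i) - 1))"
      using smooth_on_coordinate[of bump_deriv 0 "- real (Suc m)" i "real (Suc m) * b $ i - 1", OF bump_deriv_derivative]
      by (simp add: algebra_simps)
  qed
  then show "smooth_on (box a b) (box_bump a b m)" using smooth_on_subset by blast
  define c where "c = (\<chi> i::'n. 1 / real (Suc m))"
  show "compact (cbox (a + c) (b - c))" by simp
  have cpos: "c $ i > 0" for i by (simp add: c_def)
  show "cbox (a + c) (b - c) \<subseteq> box a b"
    unfolding subset_eq mem_box_cart
  proof (intro ballI allI)
    fix x i assume "x \<in> cbox (a + c) (b - c)"
    then have "(a + c) $ i \<le> x $ i" "x $ i \<le> (b - c) $ i" by (auto simp: mem_box_cart)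
    then show "a $ i < x $ i \<and> x $ i < b $ i" using cpos[of i] by simp
  qed
  fix x assume "x \<notin> cbox (a + c) (b - c)"
  then obtain i where "x $ i < a $ i + c $ i \<or> b $ i - c $ i < x $ i"
    by (auto simp: mem_box_cart not_le)
  then have "real (Suc m) * (x $ i - a $ i) - 1 \<le> 0 \<or> real (Suc m) * (b $ i - x $ i) - 1 \<le> 0"
    by (auto simp: c_def field_simps)
  then show "box_bump a b m x = 0"
    unfolding box_bump_def using bump_eq_0[of "real (Suc m) * (x $ i - a $ i) - 1"]
      bump_eq_0[of "real (Suc m) * (b $ i - x $ i) - 1"]
    by (intro prod_zero) (auto intro!: exI[of _ i] simp del: of_nat_Suc)
qed (simp add: open_box)

lemma box_bump_tendsto:
  assumes "x \<in> box a b"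
  shows "(\<lambda>m. box_bump a b m x) \<longlonglongrightarrow> 1"
proof -
  have "(\<lambda>m. box_bump a b m x) \<longlonglongrightarrow> (\<Prod>i\<in>(UNIV::'a set). 1 * 1)"
    unfolding box_bump_def
  proof (intro tendsto_prod tendsto_mult)
    fix i
    have "x $ i - a $ i > 0" "b $ i - x $ i > 0" using assms by (auto simp: mem_box_cart)
    then show "(\<lambda>m. bump_deriv 0 (real (Suc m) * (x $ i - a $ i) - 1)) \<longlonglongrightarrow> 1"
      "(\<lambda>m. bump_deriv 0 (real (Suc m) * (b $ i - x $ i) - 1)) \<longlonglongrightarrow> 1"
      using LIMSEQ_Suc[OF bump_tendsto_1] by blast+
  qed
  then show ?thesis by simp
qed

text \<open>An open set is a countable union of boxes, and one minus the product of the 1 - f_k is a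
  smooth substitute for a union: for f_k with values in [0, 1] it stays in [0, 1] and is at least
  each f_k. Both the number of boxes and the sharpness of the bumps grow with \<open>m\<close>;
  finitely many boxes at a time keep the support compact.\<close>

lemma open_approx_test_functions:
  fixes V :: "(real^'n::finite) set"
  assumes "open V"
  obtains \<psi> where "\<And>m::nat. \<psi> m \<in> test_functions V" "\<And>m x. 0 \<le> \<psi> m x" "\<And>m x. \<psi> m x \<le> 1"
    "\<And>x. (\<lambda>m. \<psi> m x) \<longlonglongrightarrow> indicator V x"
proof -
  obtain D where D: "countable D" "\<And>X. X \<in> D \<Longrightarrow> \<exists>a b. X = box a b" "\<Union>D = V"
    using open_countable_Union_open_box[OF assms] by metis
  \<comment> \<open>The empty set is added so that the enumeration is onto even if \<open>D\<close>
    is empty; it is itself a degenerate box.\<close>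
  define e where "e = from_nat_into (insert {} D)"
  have re: "range e = insert {} D" unfolding e_def by (rule range_from_nat_into) (use D in auto)
  have "\<exists>a b. e k = box a b" for k
  proof -
    have "e k \<in> insert {} D" using re by blast
    moreover have "({}::(real^'n) set) = box 0 0" by simp
    ultimately show ?thesis using D(2) by blast
  qed
  then obtain a b where ab: "\<And>k. e k = box (a k) (b k)" by metis
  have Un: "(\<Union>k. box (a k) (b k)) = V" using re D(3) unfolding ab[symmetric] by auto
  define \<psi> where "\<psi> m x = 1 - (\<Prod>k<m. 1 - box_bump (a k) (b k) m x)" for m x
  have prod: "0 \<le> (\<Prod>k<m. 1 - box_bump (a k) (b k) m x)" "(\<Prod>k<m. 1 - box_bump (a k) (b k) m x) \<le> 1" for m x
    by (auto intro!: prod_nonneg prod_le_1 simp: box_bump_le_1 box_bump_nonneg)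
  have \<psi>01: "0 \<le> \<psi> m x" "\<psi> m x \<le> 1" for m x using prod[of m x] by (auto simp: \<psi>_def)
  have test: "\<psi> m \<in> test_functions V" for m
  proof -
    have "\<exists>K. compact K \<and> K \<subseteq> box (a k) (b k) \<and> (\<forall>x. x \<notin> K \<longrightarrow> box_bump (a k) (b k) m x = 0)" for k
      using test_functionsE[OF box_bump_test[of "a k" "b k" m]] by metis
    then obtain K where K: "\<And>k. compact (K k)" "\<And>k. K k \<subseteq> box (a k) (b k)"
      "\<And>k x. x \<notin> K k \<Longrightarrow> box_bump (a k) (b k) m x = 0" by metis
    show ?thesis
    proof (rule test_functionsI[OF assms])
      show "smooth_on V (\<psi> m)" unfolding \<psi>_def
        by (intro smooth_on_diff smooth_on_const smooth_on_prod assms test_functions_smooth[OF box_bump_test])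
      show "compact (\<Union>k<m. K k)" using K by (intro compact_UN) auto
      show "(\<Union>k<m. K k) \<subseteq> V" using K(2) Un by blast
      show "\<psi> m x = 0" if "x \<notin> (\<Union>k<m. K k)" for x
        using that K(3) by (simp add: \<psi>_def)
    qed
  qed
  have "(\<lambda>m. \<psi> m x) \<longlonglongrightarrow> indicator V x" for x
  proof (cases "x \<in> V")
    case True
    then obtain k where k: "x \<in> box (a k) (b k)" using Un by blast
    have "\<forall>\<^sub>F m in sequentially. box_bump (a k) (b k) m x \<le> \<psi> m x"
    proof (rule eventually_sequentiallyI[of "Suc k"])
      fix m assume "m \<ge> Suc k"
      then have k': "k \<in> {..<m}" by auto
      have "(\<Prod>j<m. 1 - box_bump (a j) (b j) m x) =
          (1 - box_bump (a k) (b k) m x) * (\<Prod>j\<in>{..<m} - {k}. 1 - box_bump (a j) (b j) m x)"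
        using k' by (simp add: prod.remove)
      also have "\<dots> \<le> (1 - box_bump (a k) (b k) m x) * 1"
        by (intro mult_left_mono prod_le_1) (auto simp: box_bump_le_1 box_bump_nonneg)
      finally show "box_bump (a k) (b k) m x \<le> \<psi> m x" by (simp add: \<psi>_def)
    qed
    then have "(\<lambda>m. \<psi> m x) \<longlonglongrightarrow> 1"
      by (rule tendsto_sandwich[OF _ _ box_bump_tendsto[OF k] tendsto_const]) (simp add: \<psi>01)
    then show ?thesis using True by simp
  next
    case False
    then have "\<psi> m x = 0" for m using test_functions_zero[OF test] by blast
    then show ?thesis using False by simp
  qed
  then show ?thesis using that[of \<psi>] test \<psi>01 by blast
qed

section \<open>The fundamental lemma and the density of test functions\<close>

text \<open>Open sets are stable under intersection and generate the Borel sets, so by Dynkin's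
  theorem complements and disjoint countable unions suffice.\<close>

lemma borel_induct_open [consumes 1, case_names opn compl union]:
  assumes "A \<in> sets (borel :: 'a::topological_space measure)"
    and "\<And>W. open W \<Longrightarrow> Q W"
    and "\<And>A. A \<in> sets borel \<Longrightarrow> Q A \<Longrightarrow> Q (- A)"
    and "\<And>A :: nat \<Rightarrow> 'a set. disjoint_family A \<Longrightarrow> range A \<subseteq> sets borel \<Longrightarrow> (\<And>i. Q (A i)) \<Longrightarrow> Q (\<Union>i. A i)"
  shows "Q A"
proof -
  have eq: "sets (borel :: 'a measure) = sigma_sets UNIV {S. open S}"
    unfolding borel_def by (simp add: sets_measure_of)
  show ?thesis
  proof (rule sigma_sets_induct_disjoint[of "{S. open S}" UNIV A Q])
    show "Int_stable {S :: 'a set. open S}" by (auto simp: Int_stable_def)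
    show "A \<in> sigma_sets UNIV {S. open S}" using assms(1) eq by simp
  qed (use assms(2-4) in \<open>auto simp: eq[symmetric] Compl_eq_Diff_UNIV[symmetric]\<close>)
qed

text \<open>The Borel sets over which \<open>f\<close> integrates to 0 form a Dynkin system, where
  complements use that \<open>UNIV\<close> is open. Hence \<open>f\<close> has integral 0 over every
  Borel set.\<close>

lemma AE_zero_of_open_integrals:
  fixes f :: "real^'n::finite \<Rightarrow> real"
  assumes f: "integrable lborel f" and z: "\<And>W. open W \<Longrightarrow> (LINT x|lborel. indicator W x *\<^sub>R f x) = 0"
  shows "AE x in lborel. f x = 0"
proof (rule sigma_finite_measure.density_zero[OF sigma_finite_lborel f])
  have int: "integrable lborel (\<lambda>x. indicator A x *\<^sub>R f x)" if "A \<in> sets borel" for A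
    using that f by (intro integrable_mult_indicator) auto
  have "(LINT x|lborel. indicator A x *\<^sub>R f x) = 0" if "A \<in> sets borel" for A
    using that
  proof (induction rule: borel_induct_open)
    case (compl A)
    have "integral\<^sup>L lborel f = 0" using z[OF open_UNIV] by simp
    moreover have "(\<lambda>x. indicator (- A) x *\<^sub>R f x) = (\<lambda>x. f x - indicator A x *\<^sub>R f x)"
      by (auto simp: indicator_def)
    ultimately show ?case using f int[OF compl(1)] compl(2) by simp
  next
    case (union A)
    have "integrable lborel (\<lambda>x. indicator (\<Union>i. A i) x *\<^sub>R f x)"
      by (rule int) (use union in auto)
    then have "set_lebesgue_integral lborel (\<Union>i. A i) f = (\<Sum>i. set_lebesgue_integral lborel (A i) f)"
      using f union by (intro lebesgue_integral_countable_add)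
        (auto simp: disjoint_family_on_def set_integrable_def image_subset_iff)
    then show ?case using union by (simp add: set_lebesgue_integral_def)
  qed (rule z)
  then show "set_lebesgue_integral lborel A f = 0" if "A \<in> sets lborel" for A
    using that by (simp add: set_lebesgue_integral_def)
qed

text \<open>Countably many closed boxes cover \<open>U\<close>, and \<open>g\<close> is integrable
  on each. Inside a box the indicator of an open set is a bounded limit of test functions, which
  turns the hypothesis into vanishing integrals over open sets.\<close>

lemma fundamental_lemma:
  fixes g :: "real^'n::finite \<Rightarrow> real"
  assumes U: "open U" and g: "locally_integrable U g"
    and z: "\<And>\<phi>. \<phi> \<in> test_functions U \<Longrightarrow> (LINT x|lebesgue_on U. g x * \<phi> x) = 0"
  shows "AE x in lebesgue_on U. g x = 0"
proof -
  have Um: "U \<in> sets lebesgue" using U by (simp add: borel_open)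
  have local: "AE x in lebesgue. x \<in> cbox a b \<longrightarrow> g x = 0" if sub: "cbox a b \<subseteq> U" for a b
  proof -
    define h where "h x = indicator (box a b) x * g x" for x
    have "integrable (lebesgue_on (cbox a b)) g" using g sub unfolding locally_integrable_def by auto
    then have "integrable lebesgue (\<lambda>x. indicator (cbox a b) x *\<^sub>R g x)"
      by (simp add: integrable_restrict_space)
    then have "integrable lebesgue (\<lambda>x. indicator (box a b) x *\<^sub>R (indicator (cbox a b) x *\<^sub>R g x))"
      by (rule integrable_mult_indicator[rotated]) simp
    also have "(\<lambda>x. indicator (box a b) x *\<^sub>R (indicator (cbox a b) x *\<^sub>R g x)) = h"
      using box_subset_cbox[of a b] by (auto simp: h_def indicator_def fun_eq_iff)
    finally have hL: "integrable lebesgue h" .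
    \<comment> \<open>\<open>h\<close> is Lebesgue measurable, while the induction over Borel sets
      is made for Borel functions; a Borel modification bridges the gap.\<close>
    obtain f where fm: "f \<in> borel_measurable lborel" and fh: "AE x in lborel. h x = f x"
      using completion_ex_borel_measurable_real[OF borel_measurable_integrable[OF hL]] by blast
    have fh': "AE x in lebesgue. h x = f x" using fh by (rule AE_completion)
    have fm': "f \<in> borel_measurable lebesgue" using fm by (rule measurable_completion)
    have "integrable lebesgue f" using integrable_cong_AE[OF _ fm' fh'] hL by (simp add: borel_measurable_integrable)
    then have f: "integrable lborel f" using integrable_completion[OF fm] by simp
    have "AE x in lborel. f x = 0"
    proof (rule AE_zero_of_open_integrals[OF f])
      fix W :: "(real^'n) set" assume "open W"
      then have W: "open (W \<inter> box a b)" by (simp add: open_box open_Int)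
      obtain \<psi> where \<psi>: "\<And>m::nat. \<psi> m \<in> test_functions (W \<inter> box a b)" "\<And>m x. 0 \<le> \<psi> m x" "\<And>m x. \<psi> m x \<le> 1"
        "\<And>x. (\<lambda>m. \<psi> m x) \<longlonglongrightarrow> indicator (W \<inter> box a b) x"
        using open_approx_test_functions[OF W] by metis
      have \<psi>m: "\<psi> m \<in> borel_measurable lebesgue" for m
        using borel_measurable_integrable[OF test_functions_integrable(2)[OF \<psi>(1)]] .
      have "(\<lambda>m. (LINT x|lebesgue. h x * \<psi> m x)) \<longlonglongrightarrow>
          (LINT x|lebesgue. h x * indicator (W \<inter> box a b) x)"
      proof (rule integral_dominated_convergence[where w = "\<lambda>x. \<bar>h x\<bar>"])
        show "(\<lambda>x. h x * indicator (W \<inter> box a b) x) \<in> borel_measurable lebesgue"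
          using W hL by (intro borel_measurable_times borel_measurable_integrable[OF hL] borel_measurable_indicator) auto
        show "(\<lambda>x. h x * \<psi> m x) \<in> borel_measurable lebesgue" for m
          using \<psi>m hL by (intro borel_measurable_times borel_measurable_integrable[OF hL]) auto
        show "integrable lebesgue (\<lambda>x. \<bar>h x\<bar>)" using hL by simp
        show "AE x in lebesgue. (\<lambda>m. h x * \<psi> m x) \<longlonglongrightarrow> h x * indicator (W \<inter> box a b) x"
          by (intro AE_I2 tendsto_intros \<psi>)
        show "AE x in lebesgue. norm (h x * \<psi> m x) \<le> \<bar>h x\<bar>" for m
          using \<psi>(2,3) by (intro AE_I2) (simp add: abs_mult mult_left_le)
      qed
      moreover have "(LINT x|lebesgue. h x * \<psi> m x) = 0" for m
      proof -
        have t: "\<psi> m \<in> test_functions U" using \<psi>(1) test_functions_mono[of "W \<inter> box a b" U] sub box_subset_cbox by blast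
        have "(\<lambda>x. if x \<in> U then g x * \<psi> m x else 0) = (\<lambda>x. h x * \<psi> m x)"
        proof
          fix x
          show "(if x \<in> U then g x * \<psi> m x else 0) = h x * \<psi> m x"
            using test_functions_zero[OF \<psi>(1)[of m], of x] test_functions_zero[OF t, of x]
            by (auto simp: h_def indicator_def)
        qed
        then show ?thesis using z[OF t] integral_lebesgue_on[OF Um] by simp
      qed
      ultimately have "(LINT x|lebesgue. h x * indicator (W \<inter> box a b) x) = 0"
        by (simp add: LIMSEQ_const_iff)
      also have "(\<lambda>x. h x * indicator (W \<inter> box a b) x) = (\<lambda>x. indicator W x *\<^sub>R h x)"
        by (auto simp: h_def indicator_def)
      finally have "(LINT x|lebesgue. indicator W x *\<^sub>R h x) = 0" .
      moreover have "(LINT x|lebesgue. indicator W x *\<^sub>R h x) = (LINT x|lebesgue. indicator W x *\<^sub>R f x)"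
        using fh' \<open>open W\<close> hL fm' by (intro integral_cong_AE borel_measurable_scaleR borel_measurable_indicator) auto
      moreover have "\<dots> = (LINT x|lborel. indicator W x *\<^sub>R f x)"
        using fm \<open>open W\<close> by (intro integral_completion) auto
      ultimately show "(LINT x|lborel. indicator W x *\<^sub>R f x) = 0" by simp
    qed
    then have "AE x in lebesgue. f x = 0" by (rule AE_completion)
    \<comment> \<open>\<open>h\<close> is cut off to the open box, in which the approximating test
      functions live; the boundary of the closed box is a null set.\<close>
    moreover have "AE x in lebesgue. x \<notin> cbox a b - box a b"
      using negligible_frontier_interval[of a b] by (intro AE_not_in) (simp add: negligible_iff_null_sets)
    ultimately show ?thesis using fh'
      by eventually_elim (auto simp: h_def indicator_def split: if_splits)
  qed
  obtain D where D: "countable D" "D \<subseteq> Pow U" "\<And>X. X \<in> D \<Longrightarrow> \<exists>a b. X = cbox a b" "\<Union>D = U"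
    using open_countable_Union_open_cbox[OF U] by metis
  have "AE x in lebesgue. \<forall>X\<in>D. x \<in> X \<longrightarrow> g x = 0"
    using D local by (subst AE_ball_countable) (auto simp: subset_eq, metis PowD subsetD)
  then have "AE x in lebesgue. x \<in> U \<longrightarrow> g x = 0" by eventually_elim (use D(4) in blast)
  then show ?thesis by (simp add: AE_lebesgue_on[OF Um])
qed

text \<open>\<open>D\<close> collects the functions whose class is a limit of classes of test
  functions. It is closed under linear combinations and dominated pointwise limits, hence contains
  the indicators of open sets, those of Borel sets, simple functions, and every square-integrable
  Borel function.\<close>

lemma L2_class_test_dense:
  fixes f :: "real^'n::finite \<Rightarrow> real"
  assumes \<Omega>: "open \<Omega>" "\<Omega> \<in> lmeasurable" and f: "f \<in> Lp 2 \<Omega>"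
  shows "L2_class \<Omega> f \<in> closure (L2_class \<Omega> ` test_functions \<Omega>)"
proof -
  have S: "\<Omega> \<in> sets lebesgue" using \<Omega>(2) by (rule fmeasurableD)
  define T where "T = L2_class \<Omega> ` test_functions \<Omega>"
  define D where "D = {h :: real^'n \<Rightarrow> real. h \<in> Lp 2 \<Omega> \<and> L2_class \<Omega> h \<in> closure T}"
  have test_D: "h \<in> D" if hT: "h \<in> test_functions \<Omega>" for h
  proof -
    obtain B where "\<And>x. \<bar>h x\<bar> \<le> B" using test_functions_bounded[OF hT] by metis
    then have "h \<in> Lp 2 \<Omega>"
      by (intro Lp2_bounded[OF \<Omega>(2), of _ B] continuous_measurable_lebesgue_on test_functions_continuous[OF hT]) auto
    then show ?thesis using hT closure_subset[of T] by (auto simp: D_def T_def)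
  qed
  \<comment> \<open>The finite measure of \<Omega> enters here: constants are square-integrable and
    serve as majorants for indicators.\<close>
  have one: "(\<lambda>x. c) \<in> Lp 2 \<Omega>" for c by (rule Lp2_bounded[OF \<Omega>(2), of _ "\<bar>c\<bar>"]) auto
  have lincomb: "(\<lambda>x. a * g x + b * h x) \<in> D" if gh: "g \<in> D" "h \<in> D" for a b g h
  proof -
    have L: "g \<in> Lp 2 \<Omega>" "h \<in> Lp 2 \<Omega>" using gh by (auto simp: D_def)
    obtain G where G: "\<And>n. G n \<in> T" "G \<longlonglongrightarrow> L2_class \<Omega> g" using gh(1) by (auto simp: D_def closure_sequential)
    obtain H where H: "\<And>n. H n \<in> T" "H \<longlonglongrightarrow> L2_class \<Omega> h" using gh(2) by (auto simp: D_def closure_sequential)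
    have "a *\<^sub>R G n + b *\<^sub>R H n \<in> T" for n
    proof -
      obtain \<phi> where \<phi>: "\<phi> \<in> test_functions \<Omega>" "G n = L2_class \<Omega> \<phi>" using G(1)[of n] by (auto simp: T_def)
      obtain \<psi> where \<psi>: "\<psi> \<in> test_functions \<Omega>" "H n = L2_class \<Omega> \<psi>" using H(1)[of n] by (auto simp: T_def)
      obtain K where K: "compact K" "K \<subseteq> \<Omega>" "\<And>x. x \<notin> K \<Longrightarrow> \<phi> x = 0" using test_functionsE[OF \<phi>(1)] by metis
      obtain K' where K': "compact K'" "K' \<subseteq> \<Omega>" "\<And>x. x \<notin> K' \<Longrightarrow> \<psi> x = 0" using test_functionsE[OF \<psi>(1)] by metis
      have "(\<lambda>x. a * \<phi> x + b * \<psi> x) \<in> test_functions \<Omega>"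
      proof (rule test_functionsI[OF \<Omega>(1)])
        show "smooth_on \<Omega> (\<lambda>x. a * \<phi> x + b * \<psi> x)"
          by (intro smooth_on_add smooth_on_mult smooth_on_const \<Omega>(1) test_functions_smooth[OF \<phi>(1)] test_functions_smooth[OF \<psi>(1)])
        show "compact (K \<union> K')" "K \<union> K' \<subseteq> \<Omega>" using K K' by auto
        show "a * \<phi> x + b * \<psi> x = 0" if "x \<notin> K \<union> K'" for x using that K(3) K'(3) by simp
      qed
      then have "L2_class \<Omega> (\<lambda>x. a * \<phi> x + b * \<psi> x) \<in> T" unfolding T_def by (rule imageI)
      then show ?thesis
        using test_D[OF \<phi>(1)] test_D[OF \<psi>(1)] \<phi>(2) \<psi>(2) by (simp add: D_def L2_class_lincomb[OF S])
    qed
    moreover have "(\<lambda>n. a *\<^sub>R G n + b *\<^sub>R H n) \<longlonglongrightarrow> a *\<^sub>R L2_class \<Omega> g + b *\<^sub>R L2_class \<Omega> h"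
      by (intro tendsto_intros G H)
    ultimately have "a *\<^sub>R L2_class \<Omega> g + b *\<^sub>R L2_class \<Omega> h \<in> closure T"
      unfolding closure_sequential by (intro exI[of _ "\<lambda>n. a *\<^sub>R G n + b *\<^sub>R H n"]) auto
    then show ?thesis using L by (simp add: D_def L2_class_lincomb[OF S] Lp2_lincomb[OF S])
  qed
  have lim: "g \<in> D" if h: "\<And>m::nat. h m \<in> D" and gm: "g \<in> borel_measurable (lebesgue_on \<Omega>)"
    and w: "w \<in> Lp 2 \<Omega>" and bd: "\<And>m x. \<bar>h m x\<bar> \<le> w x" and l: "\<And>x. x \<in> \<Omega> \<Longrightarrow> (\<lambda>m. h m x) \<longlonglongrightarrow> g x" for h g w
  proof -
    have hm: "h m \<in> borel_measurable (lebesgue_on \<Omega>)" for m using h[of m] by (auto simp: D_def Lp2_iff)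
    have al: "AE x in lebesgue_on \<Omega>. (\<lambda>m. h m x) \<longlonglongrightarrow> g x" using l by (intro AE_I2) simp
    have ab: "AE x in lebesgue_on \<Omega>. \<bar>h m x\<bar> \<le> w x" for m using bd by (intro AE_I2) simp
    note L = L2_class_tendsto[OF S hm gm w ab al]
    have "L2_class \<Omega> g \<in> closure T"
      using closed_sequentially[OF closed_closure _ L(3)] h by (simp add: D_def)
    then show ?thesis using L(2) by (simp add: D_def)
  qed
  have bm: "h \<in> borel_measurable (lebesgue_on \<Omega>)" if "h \<in> borel_measurable borel" for h :: "real^'n \<Rightarrow> real"
    using that by (intro measurable_restrict_space1 measurable_completion) simp
  have ind: "indicator A \<in> D" if "A \<in> sets borel" for A
    using that
  proof (induction rule: borel_induct_open)
    case (opn W)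
    obtain \<psi> where \<psi>: "\<And>m::nat. \<psi> m \<in> test_functions (W \<inter> \<Omega>)" "\<And>m x. 0 \<le> \<psi> m x" "\<And>m x. \<psi> m x \<le> 1"
        "\<And>x. (\<lambda>m. \<psi> m x) \<longlonglongrightarrow> indicator (W \<inter> \<Omega>) x"
      using open_approx_test_functions[of "W \<inter> \<Omega>"] \<Omega>(1) opn by (metis open_Int)
    show ?case
    proof (rule lim[of \<psi> _ "\<lambda>x. 1"])
      show "\<psi> m \<in> D" for m using \<psi>(1) test_functions_mono[of "W \<inter> \<Omega>" \<Omega>] test_D by blast
      show "(indicator W :: real^'n \<Rightarrow> real) \<in> borel_measurable (lebesgue_on \<Omega>)" by (rule bm, rule borel_measurable_indicator) (use opn in simp)
      show "\<bar>\<psi> m x\<bar> \<le> 1" for m x using \<psi>(2,3) by simp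
      show "(\<lambda>m. \<psi> m x) \<longlonglongrightarrow> indicator W x" if "x \<in> \<Omega>" for x
        using \<psi>(4)[of x] that by (simp add: indicator_def)
    qed (rule one)
  next
    case (compl A)
    have "indicator UNIV \<in> D"
    proof -
      obtain \<psi> where \<psi>: "\<And>m::nat. \<psi> m \<in> test_functions \<Omega>" "\<And>m x. 0 \<le> \<psi> m x" "\<And>m x. \<psi> m x \<le> 1"
        "\<And>x. (\<lambda>m. \<psi> m x) \<longlonglongrightarrow> indicator \<Omega> x"
        using open_approx_test_functions[OF \<Omega>(1)] by metis
      show ?thesis
      proof (rule lim[of \<psi> _ "\<lambda>x. 1"])
        show "(\<lambda>m. \<psi> m x) \<longlonglongrightarrow> indicator UNIV x" if "x \<in> \<Omega>" for x
          using \<psi>(4)[of x] that by (simp add: indicator_def)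
        show "\<bar>\<psi> m x\<bar> \<le> 1" for m x using \<psi>(2,3) by simp
      qed (use test_D \<psi> one in auto)
    qed
    from lincomb[OF this compl(2), of 1 "-1"] have "(\<lambda>x. 1 - indicator A x) \<in> D" by simp
    also have "(\<lambda>x. 1 - indicator A x) = (indicator (- A) :: real^'n \<Rightarrow> real)"
      by (auto simp: indicator_def)
    finally show ?case .
  next
    case (union A)
    define h :: "nat \<Rightarrow> real^'n \<Rightarrow> real" where "h m = indicator (\<Union>i<m. A i)" for m
    have "h m \<in> D" for m
    proof (induction m)
      case 0
      have "(\<lambda>x. 0 * indicator (A 0) x + 0 * indicator (A 0) x) \<in> D" by (rule lincomb) (rule union)+
      moreover have "h 0 = (\<lambda>x. 0)" by (auto simp: h_def)
      ultimately show ?case by simp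
    next
      case (Suc m)
      have "h (Suc m) = (\<lambda>x. 1 * h m x + 1 * indicator (A m) x)"
      proof
        fix x
        have "A i \<inter> A m = {}" if "i < m" for i using union(1) that by (auto simp: disjoint_family_on_def)
        then show "h (Suc m) x = 1 * h m x + 1 * indicator (A m) x"
          by (auto simp: h_def indicator_def less_Suc_eq)
      qed
      then show ?case using lincomb[OF Suc union(3)[of m], of 1 1] by simp
    qed
    then show ?case
    proof (rule lim[of h _ "\<lambda>x. 1"])
      show "(indicator (\<Union>i. A i) :: real^'n \<Rightarrow> real) \<in> borel_measurable (lebesgue_on \<Omega>)"
        by (rule bm, rule borel_measurable_indicator, rule sets.countable_UN) (rule union)
      show "\<bar>h m x\<bar> \<le> 1" for m x by (simp add: h_def indicator_def)
      show "(\<lambda>m. h m x) \<longlonglongrightarrow> indicator (\<Union>i. A i) x" for x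
        unfolding h_def by (rule LIMSEQ_indicator_UN)
    qed (rule one)
  qed
  have simple: "h \<in> D" if "simple_function borel h" for h
  proof -
    have "(\<lambda>x. \<Sum>y\<in>Y. indicator (h -` {y}) x * y) \<in> D" if "finite Y" for Y
      using that
    proof (induction Y)
      case empty
      have "(\<lambda>x. 0 * indicator {} x + 0 * indicator {} x) \<in> D" by (intro lincomb ind) auto
      then show ?case by simp
    next
      case (insert y Y)
      have "h -` {y} \<in> sets borel" using simple_functionD(2)[OF \<open>simple_function borel h\<close>, of "{y}"] by simp
      from lincomb[OF ind[OF this] insert(3), of y 1] show ?case
        by (simp only: sum.insert[OF insert(1,2)] mult_1 mult.commute)
    qed
    then have "(\<lambda>x. \<Sum>y\<in>range h. indicator (h -` {y}) x * y) \<in> D"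
      using simple_functionD(1)[OF that] by simp
    moreover have "h = (\<lambda>x. \<Sum>y\<in>range h. indicator (h -` {y}) x * y)"
      by (rule ext, rule trans[OF simple_function_indicator_representation_banach[OF that]]) simp_all
    ultimately show ?thesis by (rule ssubst[rotated])
  qed
  \<comment> \<open>Approximation by simple functions is applied to a Borel function on the whole
    space, so \<open>f\<close> is extended by zero and then modified on a null set.\<close>
  define f0 where "f0 x = (if x \<in> \<Omega> then f x else 0)" for x
  have "f0 \<in> borel_measurable lebesgue"
    using f unfolding Lp2_restrict_iff[OF S] square_integrable_def f0_def by simp
  then obtain f1 where f1: "f1 \<in> borel_measurable lborel" "AE x in lborel. f0 x = f1 x"
    using completion_ex_borel_measurable_real by blast
  have "AE x in lebesgue. f0 x = f1 x" using f1(2) by (rule AE_completion)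
  then have ff1: "AE x in lebesgue_on \<Omega>. f x = f1 x"
    unfolding AE_lebesgue_on[OF S] by eventually_elim (auto simp: f0_def)
  have f1m: "f1 \<in> borel_measurable (lebesgue_on \<Omega>)" using f1 by (intro bm) simp
  have f1L: "f1 \<in> Lp 2 \<Omega>"
  proof -
    have "AE x in lebesgue_on \<Omega>. (f x)\<^sup>2 = (f1 x)\<^sup>2" using ff1 by eventually_elim simp
    then have "integrable (lebesgue_on \<Omega>) (\<lambda>x. (f1 x)\<^sup>2)"
      using f f1m by (subst integrable_cong_AE[of _ _ "\<lambda>x. (f x)\<^sup>2"]) (auto simp: Lp2_iff)
    then show ?thesis using f1m by (simp add: Lp2_iff)
  qed
  obtain s where s: "\<And>i. simple_function borel (s i)" "\<And>x. (\<lambda>i. s i x) \<longlonglongrightarrow> f1 x"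
    "\<And>i x. dist (s i x) 0 \<le> 2 * dist (f1 x) 0"
    using borel_measurable_implies_sequence_metric[of f1 borel 0] f1(1) by auto
  have "f1 \<in> D"
  proof (rule lim[of s _ "\<lambda>x. 2 * \<bar>f1 x\<bar>"])
    have "(\<lambda>x. \<bar>f1 x\<bar>) \<in> Lp 2 \<Omega>" using f1L unfolding Lp2_iff by (auto intro: borel_measurable_abs)
    then show "(\<lambda>x. 2 * \<bar>f1 x\<bar>) \<in> Lp 2 \<Omega>" by (rule Lp2_scale[OF S])
    show "\<bar>s m x\<bar> \<le> 2 * \<bar>f1 x\<bar>" for m x using s(3)[of m x] by simp
  qed (use s simple f1m in auto)
  moreover have "L2_class \<Omega> f = L2_class \<Omega> f1" using L2_class_eq_iff[OF S f f1L] ff1 by simp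
  ultimately show ?thesis by (simp add: D_def T_def)
qed

section \<open>Weak derivatives\<close>

lemma test_functions_mult_smooth:
  fixes f g :: "real^'n::finite \<Rightarrow> real"
  assumes "open V" "f \<in> test_functions V" "smooth_on V g"
  shows "(\<lambda>x. f x * g x) \<in> test_functions V"
proof -
  obtain K where K: "compact K" "K \<subseteq> V" "\<And>x. x \<notin> K \<Longrightarrow> f x = 0" using test_functionsE[OF assms(2)] by metis
  show ?thesis
    by (rule test_functionsI[OF assms(1) _ K(1,2)])
      (use K assms in \<open>auto intro!: smooth_on_mult test_functions_smooth[of f V]\<close>)
qed

lemma test_functions_sum:
  fixes f :: "'i \<Rightarrow> real^'n::finite \<Rightarrow> real"
  assumes "open V" "finite I" "\<And>i. i \<in> I \<Longrightarrow> f i \<in> test_functions V"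
  shows "(\<lambda>x. \<Sum>i\<in>I. f i x) \<in> test_functions V"
proof -
  have "\<exists>K. \<forall>i\<in>I. compact (K i) \<and> K i \<subseteq> V \<and> (\<forall>x. x \<notin> K i \<longrightarrow> f i x = 0)"
    using test_functionsE[OF assms(3)] by (intro bchoice ballI) metis
  then obtain K where K: "\<And>i. i \<in> I \<Longrightarrow> compact (K i)" "\<And>i. i \<in> I \<Longrightarrow> K i \<subseteq> V"
    "\<And>i x. i \<in> I \<Longrightarrow> x \<notin> K i \<Longrightarrow> f i x = 0" by blast
  show ?thesis
  proof (rule test_functionsI[OF assms(1)])
    show "smooth_on V (\<lambda>x. \<Sum>i\<in>I. f i x)"
      by (intro smooth_on_sum assms(1) test_functions_smooth[OF assms(3)])
    show "compact (\<Union>i\<in>I. K i)" using K(1) assms(2) by (intro compact_UN) auto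
    show "(\<Union>i\<in>I. K i) \<subseteq> V" using K(2) by blast
    show "(\<Sum>i\<in>I. f i x) = 0" if "x \<notin> (\<Union>i\<in>I. K i)" for x
      using that K(3) by (intro sum.neutral) auto
  qed
qed

section \<open>Integration by parts along a vector field\<close>

definition directional_deriv :: "(real^'n::finite \<Rightarrow> real^'n) \<Rightarrow> (real^'n \<Rightarrow> real) \<Rightarrow> real^'n \<Rightarrow> real" where
  "directional_deriv Y f x = (\<Sum>i\<in>UNIV. partial_deriv i f x * Y x $ i)"

lemma test_functions_partial_deriv:
  assumes "open W" "f \<in> test_functions W"
  shows "partial_deriv i f \<in> test_functions W"
proof -
  obtain K where K: "compact K" "K \<subseteq> W" "\<And>x. x \<notin> K \<Longrightarrow> f x = 0" using test_functionsE[OF assms(2)] by metis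
  show ?thesis
    by (rule test_functionsI[OF assms(1) smooth_on_partial_deriv[OF test_functions_smooth[OF assms(2)]] K(1,2)])
      (use partial_deriv_zero_off[OF compact_imp_closed[OF K(1)]] K(3) in blast)
qed

lemma test_functions_directional_deriv:
  assumes "open W" "smooth_on W Y" "f \<in> test_functions W"
  shows "directional_deriv Y f \<in> test_functions W"
proof -
  have "(\<lambda>x. \<Sum>i\<in>UNIV. partial_deriv i f x * Y x $ i) \<in> test_functions W"
    using assms by (intro test_functions_sum test_functions_mult_smooth test_functions_partial_deriv smooth_on_nth) auto
  then show ?thesis by (simp add: directional_deriv_def[abs_def])
qed

text \<open>Keeps the right-hand side of the definition of weak derivatives within test functions,
  and thereby integrable against any locally integrable function.\<close>

lemma test_functions_transpose_op:
  assumes "open W" "\<And>j. smooth_on W (X j)" "f \<in> test_functions W"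
  shows "transpose_op X J f \<in> test_functions W"
  using assms(3)
proof (induction J arbitrary: f)
  case (Cons j J)
  obtain K where K: "compact K" "K \<subseteq> W" "\<And>x. x \<notin> K \<Longrightarrow> f x = 0" using test_functionsE[OF Cons.prems] by metis
  have sm: "smooth_on W (\<lambda>y. f y *\<^sub>R X j y)"
    by (intro smooth_on_scaleR assms test_functions_smooth[OF Cons.prems])
  have "(\<lambda>x. - divergence (\<lambda>y. f y *\<^sub>R X j y) x) \<in> test_functions W"
  proof (rule test_functionsI[OF assms(1) _ K(1,2)])
    show "smooth_on W (\<lambda>x. - divergence (\<lambda>y. f y *\<^sub>R X j y) x)" unfolding divergence_def
      by (intro smooth_on_uminus smooth_on_sum smooth_on_nth smooth_on_partial_deriv sm assms(1))
    fix x assume x: "x \<notin> K"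
    have "partial_deriv i (\<lambda>y. f y *\<^sub>R X j y) x = 0" for i
      by (rule partial_deriv_zero_off[OF compact_imp_closed[OF K(1)] _ x]) (simp add: K(3))
    then show "- divergence (\<lambda>y. f y *\<^sub>R X j y) x = 0" by (simp add: divergence_def)
  qed
  from Cons.IH[OF this] show ?case by simp
qed simp

lemma integral_lebesgue_on_support:
  fixes f :: "real^'n::finite \<Rightarrow> real"
  assumes "S \<in> sets lebesgue" "\<And>x. x \<notin> S \<Longrightarrow> f x = 0"
  shows "integral\<^sup>L (lebesgue_on S) f = integral\<^sup>L lebesgue f"
  unfolding integral_lebesgue_on[OF assms(1)]
  by (rule Bochner_Integration.integral_cong) (use assms(2) in auto)

text \<open>The field \<open>F\<close>, which is \<phi> \<psi> \<open>Y\<close>, has divergence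
  \<open>f1 - f2\<close>, and a divergence with compact support integrates to 0.\<close>

lemma integration_by_parts:
  fixes \<phi> \<psi> :: "real^'n::finite \<Rightarrow> real"
  assumes U: "open U" "smooth_on U Y" and \<phi>: "\<phi> \<in> test_functions U" and \<psi>: "\<psi> \<in> test_functions U"
  shows "(LINT x|lebesgue_on U. directional_deriv Y \<phi> x * \<psi> x) =
    (LINT x|lebesgue_on U. \<phi> x * - divergence (\<lambda>y. \<psi> y *\<^sub>R Y y) x)"
proof -
  have Um: "U \<in> sets lebesgue" using U(1) by (simp add: borel_open)
  define G where "G y = \<psi> y *\<^sub>R Y y" for y
  define F where "F y = \<phi> y *\<^sub>R G y" for y
  obtain K where K: "compact K" "K \<subseteq> U" "\<And>x. x \<notin> K \<Longrightarrow> \<phi> x = 0" using test_functionsE[OF \<phi>] by metis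
  have smG: "smooth_on U G" unfolding G_def by (intro smooth_on_scaleR U test_functions_smooth[OF \<psi>])
  have smF: "smooth_on U F" unfolding F_def by (intro smooth_on_scaleR U smG test_functions_smooth[OF \<phi>])
  have F0: "F x = 0" if "x \<notin> K" for x using K(3)[OF that] by (simp add: F_def)
  \<comment> \<open>\<open>Y\<close> may be irregular off \<open>U\<close>, but the factor \<phi>
    vanishes off \<open>K\<close>, a compact subset of \<open>U\<close>; so \<open>F\<close> is
    smooth everywhere.\<close>
  have F: "smooth_on UNIV F" by (rule smooth_on_UNIV_of_support[OF U(1) smF compact_imp_closed[OF K(1)] K(2) F0])
  define f1 where "f1 x = directional_deriv Y \<phi> x * \<psi> x" for x
  define f2 where "f2 x = \<phi> x * - divergence G x" for x
  have t1: "f1 \<in> test_functions U" unfolding f1_def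
    by (intro test_functions_mult_smooth test_functions_directional_deriv U \<phi> test_functions_smooth[OF \<psi>])
  have t2: "f2 \<in> test_functions U" unfolding f2_def divergence_def
    by (intro test_functions_mult_smooth U \<phi> smooth_on_uminus smooth_on_sum smooth_on_nth smooth_on_partial_deriv smG)
  have "divergence F x = f1 x - f2 x" for x
  proof (cases "x \<in> U")
    case True
    have "(F has_derivative (\<lambda>v. \<phi> x *\<^sub>R frechet_derivative G (at x) v + frechet_derivative \<phi> (at x) v *\<^sub>R G x)) (at x)"
      unfolding F_def
      by (intro bounded_bilinear.FDERIV[OF bounded_bilinear_scaleR] frechet_derivative_works[THEN iffD1]
          smooth_on_differentiable[OF smG True] smooth_on_differentiable[OF test_functions_smooth[OF \<phi>, of U] True])
    from partial_deriv_eq[OF this]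
    have "partial_deriv i F x = \<phi> x *\<^sub>R partial_deriv i G x + partial_deriv i \<phi> x *\<^sub>R G x" for i
      by (simp add: partial_deriv_def)
    then have "divergence F x = (\<Sum>i\<in>UNIV. \<phi> x * partial_deriv i G x $ i + (partial_deriv i \<phi> x * Y x $ i) * \<psi> x)"
      by (simp add: divergence_def G_def algebra_simps)
    then show ?thesis
      by (simp add: f1_def f2_def directional_deriv_def divergence_def sum.distrib sum_distrib_left sum_distrib_right)
  next
    case False
    then have "x \<notin> K" using K(2) by blast
    then have "partial_deriv i F x = 0" for i
      by (intro partial_deriv_zero_off[OF compact_imp_closed[OF K(1)]]) (auto simp: F0)
    then show ?thesis using test_functions_zero[OF t1 False] test_functions_zero[OF t2 False] by (simp add: divergence_def)
  qed
  then have "divergence F = (\<lambda>x. f1 x - f2 x)" by (rule ext)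
  then have "0 = (LINT x|lborel. f1 x - f2 x)" using integral_divergence_zero[OF F K(1) F0] by simp
  also have "\<dots> = integral\<^sup>L lborel f1 - integral\<^sup>L lborel f2"
    using test_functions_integrable(1)[OF t1] test_functions_integrable(1)[OF t2] by simp
  also have "\<dots> = integral\<^sup>L lebesgue f1 - integral\<^sup>L lebesgue f2"
    using test_functions_integrable(1)[OF t1] test_functions_integrable(1)[OF t2]
    by (simp add: integral_completion borel_measurable_integrable)
  also have "\<dots> = integral\<^sup>L (lebesgue_on U) f1 - integral\<^sup>L (lebesgue_on U) f2"
    using test_functions_zero[OF t1] test_functions_zero[OF t2] by (simp add: integral_lebesgue_on_support[OF Um])
  finally show ?thesis by (simp add: f1_def[abs_def] f2_def[abs_def] G_def[abs_def])
qed

lemma locally_integrable_of_integrable: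
  assumes "integrable lebesgue f"
  shows "locally_integrable S f"
  unfolding locally_integrable_def
proof (intro allI impI)
  fix K assume "compact K \<and> K \<subseteq> S"
  then have K: "K \<in> sets lebesgue" by (auto simp: lmeasurable_compact fmeasurableD)
  have "integrable lebesgue (\<lambda>x. indicator K x *\<^sub>R f x)" using K assms by (rule integrable_mult_indicator)
  then show "integrable (lebesgue_on K) f" using K by (simp add: integrable_restrict_space)
qed

lemma locally_integrable_mult_test:
  assumes U: "open U" and g: "locally_integrable U g" and \<phi>: "\<phi> \<in> test_functions U"
  shows "integrable (lebesgue_on U) (\<lambda>x. g x * \<phi> x)"
proof -
  obtain K where K: "compact K" "K \<subseteq> U" "\<And>x. x \<notin> K \<Longrightarrow> \<phi> x = 0" using test_functionsE[OF \<phi>] by metis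
  obtain B where B: "\<And>x. \<bar>\<phi> x\<bar> \<le> B" using test_functions_bounded[OF \<phi>] by metis
  have Km: "K \<in> sets lebesgue" using K by (simp add: lmeasurable_compact fmeasurableD)
  have Um: "U \<in> sets lebesgue" using U by (simp add: borel_open)
  have "integrable (lebesgue_on K) g" using g K by (simp add: locally_integrable_def)
  then have gK: "integrable lebesgue (\<lambda>x. indicator K x * g x)" using Km by (simp add: integrable_restrict_space)
  have "integrable lebesgue (\<lambda>x. indicator K x * g x * \<phi> x)"
  proof (rule Bochner_Integration.integrable_bound)
    show "integrable lebesgue (\<lambda>x. B * (indicator K x * g x))" using gK by simp
    show "(\<lambda>x. indicator K x * g x * \<phi> x) \<in> borel_measurable lebesgue"
      by (intro borel_measurable_times[OF borel_measurable_integrable[OF gK]]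
          borel_measurable_integrable[OF test_functions_integrable(2)[OF \<phi>]])
    show "AE x in lebesgue. norm (indicator K x * g x * \<phi> x) \<le> norm (B * (indicator K x * g x))"
    proof (rule AE_I2)
      fix x
      have "\<bar>\<phi> x\<bar> \<le> \<bar>B\<bar>" using B[of x] by linarith
      from mult_right_mono[OF this, of "\<bar>indicator K x * g x\<bar>"]
      show "norm (indicator K x * g x * \<phi> x) \<le> norm (B * (indicator K x * g x))"
        by (simp add: abs_mult mult_ac)
    qed
  qed
  also have "(\<lambda>x. indicator K x * g x * \<phi> x) = (\<lambda>x. indicator U x *\<^sub>R (g x * \<phi> x))"
    using K(2,3) by (auto simp: fun_eq_iff indicator_def)
  finally show ?thesis using Um by (simp add: integrable_restrict_space)
qed

section \<open>Existence and uniqueness of weak derivatives\<close>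

lemma has_weak_deriv_test:
  assumes U: "open U" "\<And>j. smooth_on U (X j)" and \<phi>: "\<phi> \<in> test_functions U"
  shows "has_weak_deriv U X [j] \<phi> (directional_deriv (X j) \<phi>)"
  unfolding has_weak_deriv_def
proof (intro conjI ballI)
  show "locally_integrable U \<phi>" by (intro locally_integrable_of_integrable test_functions_integrable(2)[OF \<phi>])
  show "locally_integrable U (directional_deriv (X j) \<phi>)"
    by (intro locally_integrable_of_integrable test_functions_integrable(2)[OF test_functions_directional_deriv[OF U \<phi>]])
  fix \<psi> :: "real^'a \<Rightarrow> real" assume "\<psi> \<in> test_functions U"
  from integration_by_parts[OF U \<phi> this]
  show "(LINT x|lebesgue_on U. directional_deriv (X j) \<phi> x * \<psi> x) =
    (LINT x|lebesgue_on U. \<phi> x * transpose_op X [j] \<psi> x)" by simp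
qed

text \<open>The difference of two weak derivatives annihilates all test functions. As
  \<open>weak_deriv\<close> is an arbitrary choice, this is what ties it to a known derivative,
  almost everywhere.\<close>

lemma has_weak_deriv_unique:
  assumes U: "open U" and gh: "has_weak_deriv U X J u g" "has_weak_deriv U X J u h"
  shows "AE x in lebesgue_on U. g x = h x"
proof -
  have loc: "locally_integrable U g" "locally_integrable U h" using gh by (auto simp: has_weak_deriv_def)
  have "AE x in lebesgue_on U. g x - h x = 0"
  proof (rule fundamental_lemma[OF U])
    show "locally_integrable U (\<lambda>x. g x - h x)" using loc by (auto simp: locally_integrable_def)
    fix \<phi> :: "real^'a \<Rightarrow> real" assume \<phi>: "\<phi> \<in> test_functions U"
    have "(LINT x|lebesgue_on U. g x * \<phi> x) = (LINT x|lebesgue_on U. h x * \<phi> x)"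
      using gh \<phi> by (simp add: has_weak_deriv_def)
    then show "(LINT x|lebesgue_on U. (g x - h x) * \<phi> x) = 0"
      using locally_integrable_mult_test[OF U loc(1) \<phi>] locally_integrable_mult_test[OF U loc(2) \<phi>]
      by (simp add: left_diff_distrib)
  qed
  then show ?thesis by eventually_elim simp
qed

lemma has_weak_deriv_diff:
  assumes U: "open U" "\<And>j. smooth_on U (X j)"
    and ug: "has_weak_deriv U X J u g" and vh: "has_weak_deriv U X J v h"
  shows "has_weak_deriv U X J (\<lambda>x. u x - v x) (\<lambda>x. g x - h x)"
proof -
  have loc: "locally_integrable U u" "locally_integrable U v" "locally_integrable U g" "locally_integrable U h"
    using ug vh by (auto simp: has_weak_deriv_def)
  show ?thesis unfolding has_weak_deriv_def
  proof (intro conjI ballI)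
    show "locally_integrable U (\<lambda>x. u x - v x)" "locally_integrable U (\<lambda>x. g x - h x)"
      using loc by (auto simp: locally_integrable_def)
    fix \<phi> :: "real^'a \<Rightarrow> real" assume \<phi>: "\<phi> \<in> test_functions U"
    have T: "transpose_op X J \<phi> \<in> test_functions U" by (rule test_functions_transpose_op[OF U \<phi>])
    have "(LINT x|lebesgue_on U. g x * \<phi> x) - (LINT x|lebesgue_on U. h x * \<phi> x) =
      (LINT x|lebesgue_on U. u x * transpose_op X J \<phi> x) -
      (LINT x|lebesgue_on U. v x * transpose_op X J \<phi> x)"
      using ug vh \<phi> by (simp add: has_weak_deriv_def)
    then show "(LINT x|lebesgue_on U. (g x - h x) * \<phi> x) =
      (LINT x|lebesgue_on U. (u x - v x) * transpose_op X J \<phi> x)"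
      using locally_integrable_mult_test[OF U(1) loc(1) T] locally_integrable_mult_test[OF U(1) loc(2) T]
        locally_integrable_mult_test[OF U(1) loc(3) \<phi>] locally_integrable_mult_test[OF U(1) loc(4) \<phi>]
      by (simp add: left_diff_distrib)
  qed
qed

lemma has_weak_deriv_Nil: "locally_integrable U u \<Longrightarrow> has_weak_deriv U X [] u u"
  by (simp add: has_weak_deriv_def)

lemma has_weak_deriv_weak_deriv: "has_weak_deriv U X J u g \<Longrightarrow> has_weak_deriv U X J u (weak_deriv U X J u)"
  unfolding weak_deriv_def by (rule someI[where P = "has_weak_deriv U X J u"])

lemma weak_deriv_AE:
  "open U \<Longrightarrow> has_weak_deriv U X J u g \<Longrightarrow> AE x in lebesgue_on U. weak_deriv U X J u x = g x"
  using has_weak_deriv_unique has_weak_deriv_weak_deriv by blast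

section \<open>The Sobolev space and its form\<close>

lemma AE_lebesgue_on_subset:
  assumes "S \<in> sets lebesgue" "T \<in> sets lebesgue" "T \<subseteq> S" "AE x in lebesgue_on S. Q x"
  shows "AE x in lebesgue_on T. Q x"
  using assms(4) unfolding AE_lebesgue_on[OF assms(1)] AE_lebesgue_on[OF assms(2)]
  by eventually_elim (use assms(3) in blast)

lemma Lp2_cong_AE:
  assumes S: "S \<in> sets lebesgue" and f: "f \<in> Lp 2 S" and eq: "AE x in lebesgue_on S. f x = g x"
  shows "g \<in> Lp 2 S"
proof -
  define f0 where "f0 x = (if x \<in> S then f x else 0)" for x
  define g0 where "g0 x = (if x \<in> S then g x else 0)" for x
  have f0: "f0 \<in> borel_measurable lebesgue" "integrable lebesgue (\<lambda>x. (f0 x)\<^sup>2)"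
    using f unfolding Lp2_restrict_iff[OF S] square_integrable_def f0_def by auto
  have ae: "AE x in lebesgue. f0 x = g0 x"
    using eq unfolding AE_lebesgue_on[OF S] by eventually_elim (auto simp: f0_def g0_def)
  have g0: "g0 \<in> borel_measurable lebesgue" by (rule borel_measurable_AE[OF f0(1) ae])
  have "AE x in lebesgue. (f0 x)\<^sup>2 = (g0 x)\<^sup>2" using ae by eventually_elim simp
  then have "integrable lebesgue (\<lambda>x. (g0 x)\<^sup>2)"
    using f0 g0 by (subst integrable_cong_AE[of _ _ "\<lambda>x. (f0 x)\<^sup>2"]) auto
  then show ?thesis using g0 unfolding Lp2_restrict_iff[OF S] square_integrable_def g0_def by auto
qed

lemma Lp2_subset:
  assumes S: "S \<in> sets lebesgue" and T: "T \<in> sets lebesgue" "T \<subseteq> S" and f: "f \<in> Lp 2 S"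
  shows "f \<in> Lp 2 T" "norm (L2_class T f) \<le> norm (L2_class S f)"
proof -
  define f0 where "f0 x = (if x \<in> S then f x else 0)" for x
  have f0: "f0 \<in> borel_measurable lebesgue" "integrable lebesgue (\<lambda>x. (f0 x)\<^sup>2)"
    using f unfolding Lp2_restrict_iff[OF S] square_integrable_def f0_def by auto
  have eq: "(\<lambda>x. if x \<in> T then f x else 0) = (\<lambda>x. indicator T x * f0 x)"
    using T(2) by (auto simp: f0_def indicator_def fun_eq_iff)
  have "(\<lambda>x. (indicator T x * f0 x)\<^sup>2) = (\<lambda>x. indicator T x *\<^sub>R (f0 x)\<^sup>2)"
    by (auto simp: indicator_def fun_eq_iff)
  then have int: "integrable lebesgue (\<lambda>x. (indicator T x * f0 x)\<^sup>2)"
    using integrable_mult_indicator[OF T(1) f0(2)] by simp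
  then show fT: "f \<in> Lp 2 T"
    unfolding Lp2_restrict_iff[OF T(1)] square_integrable_def eq using T(1) f0(1)
    by (auto intro!: borel_measurable_times borel_measurable_indicator)
  have "(norm (L2_class T f))\<^sup>2 = (LINT x|lebesgue. (indicator T x * f0 x)\<^sup>2)"
    unfolding norm_L2_class_square[OF T(1) fT] integral_lebesgue_on[OF T(1)]
    by (rule Bochner_Integration.integral_cong) (use T(2) in \<open>auto simp: f0_def indicator_def\<close>)
  also have "\<dots> \<le> (LINT x|lebesgue. (f0 x)\<^sup>2)"
    by (rule integral_mono[OF int f0(2)]) (auto simp: indicator_def)
  also have "\<dots> = (norm (L2_class S f))\<^sup>2"
    unfolding norm_L2_class_square[OF S f] integral_lebesgue_on[OF S]
    by (rule Bochner_Integration.integral_cong) (auto simp: f0_def)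
  finally show "norm (L2_class T f) \<le> norm (L2_class S f)" by (rule power2_le_imp_le) simp
qed

lemma test_functions_Lp2:
  assumes "open V" "\<phi> \<in> test_functions V" and S: "S \<in> sets lebesgue"
  shows "\<phi> \<in> Lp 2 S"
proof -
  have "(\<lambda>x. \<phi> x * \<phi> x) \<in> test_functions V"
    by (rule test_functions_mult_smooth[OF assms(1,2) test_functions_smooth[OF assms(2)]])
  then have "integrable lebesgue (\<lambda>x. (\<phi> x)\<^sup>2)" using test_functions_integrable(2) by (simp add: power2_eq_square)
  then have "\<phi> \<in> Lp 2 UNIV"
    using borel_measurable_integrable[OF test_functions_integrable(2)[OF assms(2)]]
    by (subst Lp2_restrict_iff) (auto simp: square_integrable_def)
  then show ?thesis by (intro Lp2_subset(1)[of UNIV S \<phi>] S) auto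
qed

lemma sobolev_weak_deriv:
  assumes U: "open U" and u: "u \<in> sobolev U X k 2" and J: "length J \<le> k"
  shows "has_weak_deriv U X J u (weak_deriv U X J u)" "weak_deriv U X J u \<in> Lp 2 U"
proof -
  have Um: "U \<in> sets lebesgue" using U by (simp add: borel_open)
  obtain g where g: "g \<in> Lp 2 U" "has_weak_deriv U X J u g" using u J by (auto simp: sobolev_def)
  show "has_weak_deriv U X J u (weak_deriv U X J u)" by (rule has_weak_deriv_weak_deriv[OF g(2)])
  have "AE x in lebesgue_on U. g x = weak_deriv U X J u x"
    using weak_deriv_AE[OF U g(2)] by eventually_elim simp
  then show "weak_deriv U X J u \<in> Lp 2 U" by (rule Lp2_cong_AE[OF Um g(1)])
qed

lemma length_le_1_cases: "length J \<le> 1 \<Longrightarrow> J = [] \<or> (\<exists>j. J = [j])"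
  by (cases J) auto

lemma test_functions_sobolev:
  fixes X :: "'m::finite \<Rightarrow> real^'n::finite \<Rightarrow> real^'n"
  assumes U: "open U" "\<And>j. smooth_on U (X j)" and \<phi>: "\<phi> \<in> test_functions U"
  shows "\<phi> \<in> sobolev U X 1 2"
proof -
  have Um: "U \<in> sets lebesgue" using U(1) by (simp add: borel_open)
  note \<phi>L = test_functions_Lp2[OF U(1) \<phi> Um]
  have "has_weak_deriv U X [] \<phi> \<phi>"
    by (intro has_weak_deriv_Nil locally_integrable_of_integrable test_functions_integrable(2)[OF \<phi>])
  moreover have "has_weak_deriv U X [j] \<phi> (directional_deriv (X j) \<phi>)"
    "directional_deriv (X j) \<phi> \<in> Lp 2 U" for j
    by (rule has_weak_deriv_test[OF U \<phi>])
      (rule test_functions_Lp2[OF U(1) test_functions_directional_deriv[OF U \<phi>] Um])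
  ultimately show ?thesis unfolding sobolev_def using \<phi>L length_le_1_cases by blast
qed

lemma Lp_norm_nonneg: "Lp_norm p S f \<ge> 0"
  by (simp add: Lp_norm_def)

lemma Lp_norm_2_le_sobolev_norm:
  fixes X :: "'m::finite \<Rightarrow> real^'n::finite \<Rightarrow> real^'n"
  assumes "length J \<le> k"
  shows "Lp_norm 2 U (weak_deriv U X J u) \<le> sobolev_norm U X k 2 u"
proof -
  have fin: "finite {J::'m list. length J \<le> k}"
    using finite_lists_length_le[of "UNIV::'m set" k] by simp
  have "(Lp_norm 2 U (weak_deriv U X J u))\<^sup>2 = Lp_norm 2 U (weak_deriv U X J u) powr 2"
    by (simp add: Lp_norm_nonneg)
  also have "\<dots> \<le> (\<Sum>J | length J \<le> k. Lp_norm 2 U (weak_deriv U X J u) powr 2)"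
    using assms by (intro member_le_sum fin) auto
  finally have "sqrt ((Lp_norm 2 U (weak_deriv U X J u))\<^sup>2) \<le>
      sqrt (\<Sum>J | length J \<le> k. Lp_norm 2 U (weak_deriv U X J u) powr 2)"
    by (rule real_sqrt_le_mono)
  then show ?thesis unfolding sobolev_norm_def by (simp add: powr_half_sqrt sum_nonneg Lp_norm_nonneg)
qed

lemma Lp_norm_cong_AE:
  fixes f g :: "real^'n::finite \<Rightarrow> real"
  assumes S: "S \<in> sets lebesgue" and f: "f \<in> Lp 2 S" and eq: "AE x in lebesgue_on S. f x = g x"
  shows "Lp_norm 2 S f = Lp_norm 2 S g"
  using L2_class_eq_iff[OF S f Lp2_cong_AE[OF S f eq]] eq norm_L2_class[OF S f]
    norm_L2_class[OF S Lp2_cong_AE[OF S f eq]] by simp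

locale sobolev_setting =
  fixes U \<Omega> :: "(real^'n::finite) set" and X :: "'m::finite \<Rightarrow> real^'n \<Rightarrow> real^'n"
  assumes U: "open U" and X: "\<And>j. smooth_on U (X j)"
    and \<Omega>: "open \<Omega>" "\<Omega> \<in> lmeasurable" "\<Omega> \<subseteq> U"
begin

abbreviation "\<mu> \<equiv> lebesgue_on \<Omega>"

abbreviation "cl \<equiv> L2_class \<Omega>"

lemma U_sets: "U \<in> sets lebesgue"
  using U by (simp add: borel_open)

lemma \<Omega>_sets: "\<Omega> \<in> sets lebesgue"
  using \<Omega>(2) by (rule fmeasurableD)

lemma X_\<Omega>: "smooth_on \<Omega> (X j)"
  using X \<Omega>(3) smooth_on_subset by blast

lemma test_\<Omega>_U: "\<phi> \<in> test_functions \<Omega> \<Longrightarrow> \<phi> \<in> test_functions U"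
  using test_functions_mono[OF \<Omega>(3)] by blast

lemma directional_test: "\<phi> \<in> test_functions \<Omega> \<Longrightarrow> directional_deriv (X j) \<phi> \<in> test_functions \<Omega>"
  by (rule test_functions_directional_deriv[OF \<Omega>(1) X_\<Omega>])

lemma weak_deriv_Nil_AE:
  assumes "u \<in> sobolev U X k 2"
  shows "AE x in lebesgue_on U. weak_deriv U X [] u x = u x"
proof -
  have "has_weak_deriv U X [] u (weak_deriv U X [] u)" using sobolev_weak_deriv(1)[OF U assms, of "[]"] by simp
  then have "locally_integrable U u" by (simp add: has_weak_deriv_def)
  from weak_deriv_AE[OF U has_weak_deriv_Nil[OF this]] show ?thesis .
qed

lemma H1_0_Lp2:
  assumes "u \<in> H1_0 U X \<Omega>"
  shows "u \<in> Lp 2 \<Omega>" "weak_deriv U X [j] u \<in> Lp 2 \<Omega>"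
proof -
  have u: "u \<in> sobolev U X 1 2" using assms by (simp add: sobolev0_def)
  then have "u \<in> Lp 2 U" by (simp add: sobolev_def)
  then show "u \<in> Lp 2 \<Omega>" by (rule Lp2_subset(1)[OF U_sets \<Omega>_sets \<Omega>(3)])
  show "weak_deriv U X [j] u \<in> Lp 2 \<Omega>"
    by (rule Lp2_subset(1)[OF U_sets \<Omega>_sets \<Omega>(3) sobolev_weak_deriv(2)[OF U u]]) simp
qed

lemma weak_deriv_test_AE:
  assumes "\<phi> \<in> test_functions \<Omega>"
  shows "AE x in \<mu>. weak_deriv U X [j] \<phi> x = directional_deriv (X j) \<phi> x"
  by (rule AE_lebesgue_on_subset[OF U_sets \<Omega>_sets \<Omega>(3)
        weak_deriv_AE[OF U has_weak_deriv_test[OF U X test_\<Omega>_U[OF assms]]]])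

text \<open>The Sobolev norm is taken on \<open>U\<close>, whereas the semigroup lives on \<Omega>.
  Restriction does not increase the norm, so approximation on \<open>U\<close> gives convergence of
  classes on \<Omega>.\<close>

lemma sobolev_approx:
  assumes u: "u \<in> sobolev U X 1 2" and \<phi>: "\<phi> \<in> test_functions U" and J: "length J \<le> 1"
    and d: "has_weak_deriv U X J \<phi> d" "d \<in> Lp 2 U"
  shows "norm (cl (weak_deriv U X J u) - cl d) \<le> sobolev_norm U X 1 2 (\<lambda>x. u x - \<phi> x)"
proof -
  note w = sobolev_weak_deriv[OF U u J]
  have wL: "(\<lambda>x. weak_deriv U X J u x - d x) \<in> Lp 2 U" by (rule Lp2_diff[OF U_sets w(2) d(2)])
  have "AE x in lebesgue_on U. weak_deriv U X J (\<lambda>x. u x - \<phi> x) x = weak_deriv U X J u x - d x"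
    by (rule weak_deriv_AE[OF U has_weak_deriv_diff[OF U X w(1) d(1)]])
  then have ae: "AE x in lebesgue_on U. weak_deriv U X J u x - d x = weak_deriv U X J (\<lambda>x. u x - \<phi> x) x"
    by eventually_elim simp
  have "norm (cl (weak_deriv U X J u) - cl d) =
      norm (cl (\<lambda>x. weak_deriv U X J u x - d x))"
    using L2_class_diff[OF \<Omega>_sets Lp2_subset(1)[OF U_sets \<Omega>_sets \<Omega>(3) w(2)]
        Lp2_subset(1)[OF U_sets \<Omega>_sets \<Omega>(3) d(2)]] by simp
  also have "\<dots> \<le> norm (L2_class U (\<lambda>x. weak_deriv U X J u x - d x))"
    by (rule Lp2_subset(2)[OF U_sets \<Omega>_sets \<Omega>(3) wL])
  also have "\<dots> = Lp_norm 2 U (\<lambda>x. weak_deriv U X J u x - d x)" by (rule norm_L2_class[OF U_sets wL])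
  also have "\<dots> = Lp_norm 2 U (weak_deriv U X J (\<lambda>x. u x - \<phi> x))" by (rule Lp_norm_cong_AE[OF U_sets wL ae])
  also have "\<dots> \<le> sobolev_norm U X 1 2 (\<lambda>x. u x - \<phi> x)" by (rule Lp_norm_2_le_sobolev_norm[OF J])
  finally show ?thesis .
qed

text \<open>One sequence serves the function and all its first derivatives, as needed to pass to the
  limit in an inequality that involves both.\<close>

lemma H1_0_approx:
  assumes u: "u \<in> H1_0 U X \<Omega>"
  obtains \<phi> where "\<And>n::nat. \<phi> n \<in> test_functions \<Omega>"
    "(\<lambda>n. cl (\<phi> n)) \<longlonglongrightarrow> cl u"
    "\<And>j. (\<lambda>n. cl (directional_deriv (X j) (\<phi> n))) \<longlonglongrightarrow> cl (weak_deriv U X [j] u)"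
proof -
  have us: "u \<in> sobolev U X 1 2" using u by (simp add: sobolev0_def)
  have "\<exists>\<phi>\<in>test_functions \<Omega>. sobolev_norm U X 1 2 (\<lambda>x. u x - \<phi> x) < 1 / real (Suc n)" for n
    using u by (simp add: sobolev0_def)
  then obtain \<phi> where \<phi>: "\<And>n. \<phi> n \<in> test_functions \<Omega>"
    "\<And>n. sobolev_norm U X 1 2 (\<lambda>x. u x - \<phi> n x) < 1 / real (Suc n)" by metis
  have conv: "(\<lambda>n. cl (d n)) \<longlonglongrightarrow> cl (weak_deriv U X J u)"
    if J: "length J \<le> 1" and d: "\<And>n. has_weak_deriv U X J (\<phi> n) (d n)" "\<And>n. d n \<in> Lp 2 U" for J d
  proof -
    have "(\<lambda>n. cl (weak_deriv U X J u) - cl (d n)) \<longlonglongrightarrow> 0"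
    proof (rule Lim_null_comparison)
      show "\<forall>\<^sub>F n in sequentially. norm (cl (weak_deriv U X J u) - cl (d n)) \<le> 1 / real (Suc n)"
        using sobolev_approx[OF us test_\<Omega>_U[OF \<phi>(1)] J d] \<phi>(2) by (intro always_eventually allI) (meson less_imp_le order_trans)
      show "(\<lambda>n. 1 / real (Suc n)) \<longlonglongrightarrow> 0" by (rule LIMSEQ_Suc[OF lim_1_over_n])
    qed
    from tendsto_diff[OF tendsto_const[of "cl (weak_deriv U X J u)"] this] show ?thesis by simp
  qed
  have "has_weak_deriv U X [] (\<phi> n) (\<phi> n)" for n
    by (intro has_weak_deriv_Nil locally_integrable_of_integrable test_functions_integrable(2)[OF \<phi>(1)])
  then have "(\<lambda>n. cl (\<phi> n)) \<longlonglongrightarrow> cl (weak_deriv U X [] u)"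
    by (intro conv test_functions_Lp2[OF U test_\<Omega>_U[OF \<phi>(1)] U_sets]) simp_all
  moreover have "cl (weak_deriv U X [] u) = cl u"
    using L2_class_eq_iff[OF \<Omega>_sets Lp2_subset(1)[OF U_sets \<Omega>_sets \<Omega>(3) sobolev_weak_deriv(2)[OF U us, of "[]"]] H1_0_Lp2(1)[OF u]]
      AE_lebesgue_on_subset[OF U_sets \<Omega>_sets \<Omega>(3) weak_deriv_Nil_AE[OF us]] by simp
  ultimately have "(\<lambda>n. cl (\<phi> n)) \<longlonglongrightarrow> cl u" by simp
  moreover have "(\<lambda>n. cl (directional_deriv (X j) (\<phi> n))) \<longlonglongrightarrow> cl (weak_deriv U X [j] u)" for j
    by (intro conv has_weak_deriv_test[OF U X] test_functions_Lp2[OF U _ U_sets] test_\<Omega>_U directional_test \<phi>(1)) simp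
  ultimately show ?thesis using that \<phi>(1) by blast
qed

lemma test_functions_H1_0:
  assumes "\<phi> \<in> test_functions \<Omega>"
  shows "\<phi> \<in> H1_0 U X \<Omega>"
proof -
  have 0: "sobolev_norm U X 1 2 (\<lambda>x. \<phi> x - \<phi> x) = 0"
  proof -
    \<comment> \<open>The approximant is the function itself, but the derivative of the difference
      is a chosen one and known to be 0 only almost everywhere.\<close>
    have "Lp_norm 2 U (weak_deriv U X J (\<lambda>x. 0)) = 0" for J
    proof -
      have "has_weak_deriv U X J (\<lambda>x. 0) (\<lambda>x. 0)" by (simp add: has_weak_deriv_def locally_integrable_def)
      from weak_deriv_AE[OF U this] have ae: "AE x in lebesgue_on U. 0 = weak_deriv U X J (\<lambda>x. 0) x"
        by eventually_elim simp
      have "(\<lambda>x. 0) \<in> Lp 2 U" by (simp add: Lp2_iff)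
      from Lp_norm_cong_AE[OF U_sets this ae] show ?thesis by (simp add: Lp_norm_def)
    qed
    then show ?thesis by (simp add: sobolev_norm_def)
  qed
  show ?thesis unfolding sobolev0_def
    using test_functions_sobolev[OF U X test_\<Omega>_U[OF assms]] assms 0
    by (auto intro!: bexI[of _ \<phi>])
qed

section \<open>The Dirichlet form and its operator on test functions\<close>

text \<open>Testing the weak derivative of \<open>v\<close> with the test function X_j \<phi> moves
  X_j away from \<open>v\<close>. The operator thus sends \<phi> to the sum over j of the transpose
  of X_j applied to X_j \<phi>, which places test functions in its domain.\<close>

lemma form_test:
  assumes \<phi>: "\<phi> \<in> test_functions \<Omega>" and v: "v \<in> H1_0 U X \<Omega>"
  shows "(LINT x|\<mu>. weak_grad U X \<phi> x \<bullet> weak_grad U X v x) =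
    (LINT x|\<mu>. ((\<Sum>j\<in>UNIV. transpose_op X [j] (directional_deriv (X j) \<phi>) x) * v x))"
proof -
  define d where "d j = directional_deriv (X j) \<phi>" for j
  define T where "T j = transpose_op X [j] (d j)" for j
  have d: "d j \<in> test_functions \<Omega>" for j unfolding d_def by (rule directional_test[OF \<phi>])
  have T: "T j \<in> test_functions \<Omega>" for j unfolding T_def by (rule test_functions_transpose_op[OF \<Omega>(1) X_\<Omega> d])
  have dL: "d j \<in> Lp 2 \<Omega>" and TL: "T j \<in> Lp 2 \<Omega>" for j
    using d T test_functions_Lp2[OF \<Omega>(1) _ \<Omega>_sets] by blast+
  have vs: "v \<in> sobolev U X 1 2" using v by (simp add: sobolev0_def)
  define w where "w j = weak_deriv U X [j] v" for j
  have wL: "w j \<in> Lp 2 \<Omega>" for j unfolding w_def by (rule H1_0_Lp2(2)[OF v])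
  have single: "(LINT x|\<mu>. d j x * w j x) = (LINT x|\<mu>. T j x * v x)" for j
  proof -
    have hw: "has_weak_deriv U X [j] v (w j)" unfolding w_def by (rule sobolev_weak_deriv(1)[OF U vs]) simp
    have z: "d j x = 0" "T j x = 0" if "x \<notin> \<Omega>" for x using test_functions_zero[OF d that] test_functions_zero[OF T that] by auto
    have zU: "d j x = 0" "T j x = 0" if "x \<notin> U" for x using z that \<Omega>(3) by blast+
    have "(LINT x|\<mu>. d j x * w j x) = (LINT x|lebesgue_on U. w j x * d j x)"
      by (simp add: integral_lebesgue_on_support[OF \<Omega>_sets] integral_lebesgue_on_support[OF U_sets] z zU mult.commute)
    also have "\<dots> = (LINT x|lebesgue_on U. v x * T j x)"
      using hw test_\<Omega>_U[OF d] unfolding has_weak_deriv_def T_def by blast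
    also have "\<dots> = (LINT x|\<mu>. T j x * v x)"
      by (simp add: integral_lebesgue_on_support[OF \<Omega>_sets] integral_lebesgue_on_support[OF U_sets] z zU mult.commute)
    finally show ?thesis .
  qed
  have wm: "w j \<in> borel_measurable \<mu>" and dm: "d j \<in> borel_measurable \<mu>"
    and wdm: "weak_deriv U X [j] \<phi> \<in> borel_measurable \<mu>" for j
    using wL dL H1_0_Lp2(2)[OF test_functions_H1_0[OF \<phi>]] by (auto simp: Lp2_iff)
  have "(LINT x|\<mu>. weak_grad U X \<phi> x \<bullet> weak_grad U X v x) =
      (LINT x|\<mu>. (\<Sum>j\<in>UNIV. weak_deriv U X [j] \<phi> x * w j x))"
    by (simp add: weak_grad_def inner_vec_def w_def)
  also have "\<dots> = (LINT x|\<mu>. (\<Sum>j\<in>UNIV. d j x * w j x))"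
  proof (rule integral_cong_AE)
    have "AE x in \<mu>. \<forall>j\<in>UNIV. weak_deriv U X [j] \<phi> x = d j x"
      using weak_deriv_test_AE[OF \<phi>] by (intro AE_finite_allI) (auto simp: d_def)
    then show "AE x in \<mu>. (\<Sum>j\<in>UNIV. weak_deriv U X [j] \<phi> x * w j x) = (\<Sum>j\<in>UNIV. d j x * w j x)"
      by eventually_elim simp
  qed (intro borel_measurable_sum borel_measurable_times wm dm wdm)+
  also have "\<dots> = (\<Sum>j\<in>UNIV. (LINT x|\<mu>. d j x * w j x))"
    by (intro Bochner_Integration.integral_sum Lp2_mult_integrable[OF \<Omega>_sets dL wL])
  also have "\<dots> = (\<Sum>j\<in>UNIV. (LINT x|\<mu>. T j x * v x))" by (simp add: single)
  also have "\<dots> = (LINT x|\<mu>. (\<Sum>j\<in>UNIV. T j x * v x))"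
    by (intro Bochner_Integration.integral_sum[symmetric] Lp2_mult_integrable[OF \<Omega>_sets TL H1_0_Lp2(1)[OF v]])
  finally show ?thesis by (simp add: sum_distrib_right T_def d_def)
qed

lemma form_operator_test:
  assumes \<phi>: "\<phi> \<in> test_functions \<Omega>"
  shows "form_operator U X \<Omega> \<phi> (\<lambda>x. \<Sum>j\<in>UNIV. transpose_op X [j] (directional_deriv (X j) \<phi>) x)"
proof -
  have "(\<lambda>x. \<Sum>j\<in>UNIV. transpose_op X [j] (directional_deriv (X j) \<phi>) x) \<in> test_functions \<Omega>"
    by (intro test_functions_sum test_functions_transpose_op \<Omega>(1) X_\<Omega> directional_test \<phi>) simp
  then show ?thesis unfolding form_operator_def
    using test_functions_Lp2[OF \<Omega>(1) _ \<Omega>_sets] test_functions_H1_0[OF \<phi>] \<phi> form_test[OF \<phi>]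
    by (intro conjI bexI[of _ \<phi>]) auto
qed

text \<open>Elements of the operator domain matter on \<Omega> only, while the form takes its
  arguments from \<open>H1_0\<close>. Each side is therefore evaluated at the representatives
  \<open>u\<close> and \<open>u'\<close>, where the symmetry of the form applies.\<close>

lemma form_symmetric:
  assumes "form_operator U X \<Omega> f g" "form_operator U X \<Omega> f' g'"
  shows "(LINT x|\<mu>. g x * f' x) = (LINT x|\<mu>. f x * g' x)"
proof -
  obtain u where u: "u \<in> H1_0 U X \<Omega>" "AE x in \<mu>. u x = f x"
    "\<And>v. v \<in> H1_0 U X \<Omega> \<Longrightarrow> (LINT x|\<mu>. weak_grad U X u x \<bullet> weak_grad U X v x) =
           (LINT x|\<mu>. g x * v x)" using assms(1) unfolding form_operator_def by blast
  obtain u' where u': "u' \<in> H1_0 U X \<Omega>" "AE x in \<mu>. u' x = f' x"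
    "\<And>v. v \<in> H1_0 U X \<Omega> \<Longrightarrow> (LINT x|\<mu>. weak_grad U X u' x \<bullet> weak_grad U X v x) =
           (LINT x|\<mu>. g' x * v x)" using assms(2) unfolding form_operator_def by blast
  have m: "h \<in> borel_measurable \<mu>" if "h \<in> {f, g, f', g', u, u'}" for h
    using that assms H1_0_Lp2(1)[OF u(1)] H1_0_Lp2(1)[OF u'(1)] by (auto simp: form_operator_def Lp2_iff)
  have "(LINT x|\<mu>. g x * f' x) = (LINT x|\<mu>. g x * u' x)"
    using u'(2) by (intro integral_cong_AE borel_measurable_times m) auto
  also have "\<dots> = (LINT x|\<mu>. weak_grad U X u x \<bullet> weak_grad U X u' x)" by (rule u(3)[OF u'(1), symmetric])
  also have "\<dots> = (LINT x|\<mu>. weak_grad U X u' x \<bullet> weak_grad U X u x)" by (simp add: inner_commute)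
  also have "\<dots> = (LINT x|\<mu>. g' x * u x)" by (rule u'(3)[OF u(1)])
  also have "\<dots> = (LINT x|\<mu>. f x * g' x)"
    using u(2) by (intro integral_cong_AE borel_measurable_times m) auto
  finally show ?thesis .
qed

lemma norm_weak_grad:
  assumes "u \<in> H1_0 U X \<Omega>"
  shows "(Lp_norm 2 \<Omega> (weak_grad U X u))\<^sup>2 = (\<Sum>j\<in>UNIV. (norm (cl (weak_deriv U X [j] u)))\<^sup>2)"
proof -
  have "(Lp_norm 2 \<Omega> (weak_grad U X u))\<^sup>2 = (LINT x|\<mu>. (norm (weak_grad U X u x))\<^sup>2)"
    by (simp add: Lp_norm_2)
  also have "\<dots> = (LINT x|\<mu>. (\<Sum>j\<in>UNIV. (weak_deriv U X [j] u x)\<^sup>2))"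
    unfolding power2_norm_eq_inner by (simp add: inner_vec_def weak_grad_def power2_eq_square)
  also have "\<dots> = (\<Sum>j\<in>UNIV. (LINT x|\<mu>. (weak_deriv U X [j] u x)\<^sup>2))"
    using H1_0_Lp2(2)[OF assms] by (intro Bochner_Integration.integral_sum) (auto simp: Lp2_iff)
  finally show ?thesis by (simp add: norm_L2_class_square[OF \<Omega>_sets H1_0_Lp2(2)[OF assms]])
qed

text \<open>The pairing of \<phi> with its image is the Dirichlet energy, written with classical
  derivatives so that it passes to the limit along \<open>H1_0_approx\<close>.\<close>

lemma form_test_self:
  assumes \<phi>: "\<phi> \<in> test_functions \<Omega>"
  shows "(LINT x|\<mu>. ((\<Sum>j\<in>UNIV. transpose_op X [j] (directional_deriv (X j) \<phi>) x) * \<phi> x)) =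
    (\<Sum>j\<in>UNIV. (norm (cl (directional_deriv (X j) \<phi>)))\<^sup>2)"
proof -
  have \<phi>H: "\<phi> \<in> H1_0 U X \<Omega>" by (rule test_functions_H1_0[OF \<phi>])
  have "cl (weak_deriv U X [j] \<phi>) = cl (directional_deriv (X j) \<phi>)" for j
    using L2_class_eq_iff[OF \<Omega>_sets H1_0_Lp2(2)[OF \<phi>H] test_functions_Lp2[OF \<Omega>(1) directional_test[OF \<phi>] \<Omega>_sets]]
      weak_deriv_test_AE[OF \<phi>] by simp
  then have "(\<Sum>j\<in>UNIV. (norm (cl (directional_deriv (X j) \<phi>)))\<^sup>2) = (Lp_norm 2 \<Omega> (weak_grad U X \<phi>))\<^sup>2"
    by (simp add: norm_weak_grad[OF \<phi>H])
  also have "\<dots> = (LINT x|\<mu>. weak_grad U X \<phi> x \<bullet> weak_grad U X \<phi> x)"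
    by (simp add: Lp_norm_2 power2_norm_eq_inner)
  finally show ?thesis using form_test[OF \<phi> \<phi>H] by simp
qed

end

section \<open>The heat semigroup\<close>

text \<open>Meaningful only for operators \<open>T\<close> that respect almost-everywhere equality on \<open>S\<close>.\<close>

definition L2_op :: "(real^'n::finite) set \<Rightarrow> ((real^'n \<Rightarrow> real) \<Rightarrow> real^'n \<Rightarrow> real) \<Rightarrow> 'n L2 \<Rightarrow> 'n L2" where
  "L2_op S T v = L2_class S (T (SOME f. f \<in> Lp 2 S \<and> L2_class S f = v))"

lemma L2_op_class:
  assumes S: "S \<in> sets lebesgue" and f: "f \<in> Lp 2 S" and T: "\<And>g. g \<in> Lp 2 S \<Longrightarrow> T g \<in> Lp 2 S"
    and cong: "\<And>g. g \<in> Lp 2 S \<Longrightarrow> AE x in lebesgue_on S. g x = f x \<Longrightarrow> L2_class S (T g) = L2_class S (T f)"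
  shows "L2_op S T (L2_class S f) = L2_class S (T f)"
proof -
  define g where "g = (SOME g. g \<in> Lp 2 S \<and> L2_class S g = L2_class S f)"
  have "g \<in> Lp 2 S \<and> L2_class S g = L2_class S f"
    unfolding g_def by (rule someI[of _ f]) (use f in simp)
  then have "g \<in> Lp 2 S" "AE x in lebesgue_on S. g x = f x" using L2_class_eq_iff[OF S _ f] by auto
  then show ?thesis unfolding L2_op_def g_def[symmetric] by (rule cong)
qed

lemma Lp2_bounded_mult:
  assumes S: "S \<in> sets lebesgue" and f: "f \<in> Lp 2 S" and h: "h \<in> borel_measurable (lebesgue_on S)"
    and bd: "\<And>x. \<bar>h x\<bar> \<le> c"
  shows "(\<lambda>x. h x * f x) \<in> Lp 2 S" "norm (L2_class S (\<lambda>x. h x * f x)) \<le> c * norm (L2_class S f)"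
proof -
  have c: "c \<ge> 0" using bd[of 0] by linarith
  have fm: "f \<in> borel_measurable (lebesgue_on S)" and fi: "integrable (lebesgue_on S) (\<lambda>x. (f x)\<^sup>2)"
    using f by (auto simp: Lp2_iff)
  have le: "(h x * f x)\<^sup>2 \<le> c\<^sup>2 * (f x)\<^sup>2" for x
    using square_le_square[OF bd[of x]] by (simp add: power_mult_distrib mult_right_mono)
  have int: "integrable (lebesgue_on S) (\<lambda>x. (h x * f x)\<^sup>2)"
  proof (rule Bochner_Integration.integrable_bound)
    show "integrable (lebesgue_on S) (\<lambda>x. c\<^sup>2 * (f x)\<^sup>2)" using fi by simp
    show "(\<lambda>x. (h x * f x)\<^sup>2) \<in> borel_measurable (lebesgue_on S)" using fm h by simp
    show "AE x in lebesgue_on S. norm ((h x * f x)\<^sup>2) \<le> norm (c\<^sup>2 * (f x)\<^sup>2)" using le by (intro AE_I2) simp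
  qed
  then show hf: "(\<lambda>x. h x * f x) \<in> Lp 2 S" using fm h by (simp add: Lp2_iff)
  have "(norm (L2_class S (\<lambda>x. h x * f x)))\<^sup>2 \<le> (LINT x|lebesgue_on S. c\<^sup>2 * (f x)\<^sup>2)"
    unfolding norm_L2_class_square[OF S hf] by (rule integral_mono[OF int]) (use fi le in auto)
  also have "\<dots> = (c * norm (L2_class S f))\<^sup>2"
    by (simp add: norm_L2_class_square[OF S f] power_mult_distrib)
  finally show "norm (L2_class S (\<lambda>x. h x * f x)) \<le> c * norm (L2_class S f)"
    by (rule power2_le_imp_le) (use c in simp)
qed

lemma L2_op_mult:
  assumes S: "S \<in> sets lebesgue" and f: "f \<in> Lp 2 S" and h: "h \<in> borel_measurable (lebesgue_on S)"
    and bd: "\<And>x. \<bar>h x\<bar> \<le> c"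
  shows "L2_op S (\<lambda>f x. h x * f x) (L2_class S f) = L2_class S (\<lambda>x. h x * f x)"
proof (rule L2_op_class[OF S f])
  show "(\<lambda>x. h x * g x) \<in> Lp 2 S" if "g \<in> Lp 2 S" for g by (rule Lp2_bounded_mult(1)[OF S that h bd])
  fix g assume g: "g \<in> Lp 2 S" "AE x in lebesgue_on S. g x = f x"
  have "AE x in lebesgue_on S. h x * g x = h x * f x" using g(2) by eventually_elim simp
  then show "L2_class S (\<lambda>x. h x * g x) = L2_class S (\<lambda>x. h x * f x)"
    using L2_class_eq_iff[OF S Lp2_bounded_mult(1)[OF S g(1) h bd] Lp2_bounded_mult(1)[OF S f h bd]] by simp
qed

lemma subspace_L2_class:
  assumes "S \<in> sets lebesgue"
  shows "subspace (L2_class S ` Lp 2 S)"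
proof (rule subspaceI)
  have z: "(\<lambda>x. 0) \<in> Lp 2 S" by (simp add: Lp2_iff)
  then have "L2_class S (\<lambda>x. 0) = 0" using L2_class_scale[OF assms z, of 0] by simp
  then show "0 \<in> L2_class S ` Lp 2 S" using z by (metis imageI)
next
  fix x y assume "x \<in> L2_class S ` Lp 2 S" "y \<in> L2_class S ` Lp 2 S"
  then obtain f g where fg: "f \<in> Lp 2 S" "g \<in> Lp 2 S" "x = L2_class S f" "y = L2_class S g" by auto
  then have "x + y = L2_class S (\<lambda>x. 1 * f x + 1 * g x)" using L2_class_lincomb[OF assms fg(1,2), of 1 1] by simp
  then show "x + y \<in> L2_class S ` Lp 2 S" using Lp2_lincomb[OF assms fg(1,2)] by blast
next
  fix c x assume "x \<in> L2_class S ` Lp 2 S"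
  then obtain f where f: "f \<in> Lp 2 S" "x = L2_class S f" by auto
  then have "c *\<^sub>R x = L2_class S (\<lambda>x. c * f x)" using L2_class_scale[OF assms f(1)] by simp
  then show "c *\<^sub>R x \<in> L2_class S ` Lp 2 S" using Lp2_scale[OF assms f(1)] by blast
qed

text \<open>A majorant, uniform in \<sigma>, for quantities that tend to a ln a. From below the
  quotient is at least ln a, hence at least 1 - 1/a. From above, for a > 1, it is at most
  \<open>ln a * a powr \<sigma>\<close>, hence at most a^2, and the factor \<open>a\<close> makes
  this a cube.\<close>

lemma powr_diff_quotient_bound:
  fixes a M \<sigma> :: real
  assumes "0 \<le> a" "a \<le> M" "0 < \<sigma>" "\<sigma> \<le> 1"
  shows "\<bar>(a powr \<sigma> - 1) / \<sigma> * a\<bar> \<le> 1 + M ^ 3"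
proof (cases "a = 0")
  case False
  then have a: "a > 0" using assms by simp
  define L where "L = (a powr \<sigma> - 1) / \<sigma>"
  have M3: "M ^ 3 \<ge> 0" using assms by simp
  have "1 + \<sigma> * ln a \<le> exp (\<sigma> * ln a)" by (rule exp_ge_add_one_self)
  then have lo: "ln a \<le> L" using a assms by (simp add: L_def powr_def field_simps)
  have "ln (1 / a) \<le> 1 / a - 1" using a by (intro ln_le_minus_one) simp
  then have "1 - 1 / a \<le> L" using lo a by (simp add: ln_div)
  then have "(1 - 1 / a) * a \<le> L * a" using a by (intro mult_right_mono) auto
  moreover have "(1 - 1 / a) * a = a - 1" using a by (simp add: left_diff_distrib)
  ultimately have lower: "- 1 \<le> L * a" using a by linarith
  have upper: "L * a \<le> 1 + M ^ 3"
  proof (cases "a \<le> 1")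
    case True
    have "a powr \<sigma> \<le> 1" using True a assms powr_mono2[of \<sigma> a 1] by simp
    then have "L \<le> 0" using assms by (simp add: L_def divide_nonpos_pos)
    then have "L * a \<le> 0" using a by (simp add: mult_nonpos_nonneg)
    then show ?thesis using M3 by linarith
  next
    case False
    then have a1: "a > 1" by simp
    have "1 - \<sigma> * ln a \<le> exp (- (\<sigma> * ln a))" using exp_ge_add_one_self[of "- (\<sigma> * ln a)"] by simp
    then have "(1 - \<sigma> * ln a) * a powr \<sigma> \<le> exp (- (\<sigma> * ln a)) * a powr \<sigma>" by (intro mult_right_mono) auto
    also have "\<dots> = 1" using a by (simp add: powr_def exp_minus)
    finally have "L \<le> ln a * a powr \<sigma>" using assms by (simp add: L_def field_simps)
    also have "\<dots> \<le> a * a"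
    proof (rule mult_mono)
      show "ln a \<le> a" using ln_le_minus_one[OF a] by simp
      show "a powr \<sigma> \<le> a" using powr_mono[of \<sigma> 1 a] assms a1 by simp
    qed (use a in auto)
    finally have "L * a \<le> a * a * a" using a by (intro mult_right_mono) auto
    also have "\<dots> = a ^ 3" by (simp add: power3_eq_cube)
    also have "\<dots> \<le> M ^ 3" using assms by (intro power_mono) auto
    finally show ?thesis by simp
  qed
  from lower have "- (1 + M ^ 3) \<le> L * a" using M3 by linarith
  with upper show ?thesis unfolding L_def by (simp add: abs_le_iff)
qed (use assms in simp)

lemma AE_le_of_Linf_norm:
  assumes "Linf_norm S f \<le> ennreal c" "c \<ge> 0"
  shows "AE x in lebesgue_on S. \<bar>f x\<bar> \<le> c"
  using esssup_AE[of "\<lambda>x. ennreal \<bar>f x\<bar>" "lebesgue_on S"]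
proof eventually_elim
  case (elim x)
  then have "ennreal \<bar>f x\<bar> \<le> ennreal c" using assms(1) unfolding Linf_norm_def by (rule order_trans)
  then show ?case using assms(2) by (simp add: ennreal_le_iff)
qed

lemma Linf_bounded:
  assumes "f \<in> Linf S"
  obtains M where "M \<ge> 0" "AE x in lebesgue_on S. \<bar>f x\<bar> \<le> M"
proof -
  have "Linf_norm S f < \<infinity>" using assms by (simp add: Linf_def)
  then have "Linf_norm S f \<le> ennreal (enn2real (Linf_norm S f))" by (simp add: ennreal_enn2real_if)
  from AE_le_of_Linf_norm[OF this enn2real_nonneg] show ?thesis
    by (rule that[OF enn2real_nonneg])
qed

lemma C0_semigroupD:
  assumes "C0_semigroup S P"
  shows "t \<ge> 0 \<Longrightarrow> f \<in> Lp 2 S \<Longrightarrow> P t f \<in> Lp 2 S"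
    and "t \<ge> 0 \<Longrightarrow> f \<in> Lp 2 S \<Longrightarrow> g \<in> Lp 2 S \<Longrightarrow>
      AE x in lebesgue_on S. P t (\<lambda>y. a * f y + b * g y) x = a * P t f x + b * P t g x"
    and "t \<ge> 0 \<Longrightarrow> \<exists>B. \<forall>f\<in>Lp 2 S. Lp_norm 2 S (P t f) \<le> B * Lp_norm 2 S f"
    and "f \<in> Lp 2 S \<Longrightarrow> AE x in lebesgue_on S. P 0 f x = f x"
    and "s \<ge> 0 \<Longrightarrow> t \<ge> 0 \<Longrightarrow> f \<in> Lp 2 S \<Longrightarrow> AE x in lebesgue_on S. P (s + t) f x = P s (P t f) x"
    and "f \<in> Lp 2 S \<Longrightarrow> ((\<lambda>t. Lp_norm 2 S (\<lambda>x. P t f x - f x)) \<longlongrightarrow> 0) (at_right 0)"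
  using assms by (simp_all add: C0_semigroup_def)

section \<open>The semigroup on classes and the assumptions of the abstract argument\<close>

context sobolev_setting
begin

abbreviation V where "V \<equiv> cl ` Lp 2 \<Omega>"

abbreviation gen_L2 where
  "gen_L2 P x y \<equiv> x \<in> V \<and> y \<in> V \<and>
    ((\<lambda>t. (1 / t) *\<^sub>R (L2_op \<Omega> (P t) x - x)) \<longlongrightarrow> y) (at_right 0)"

text \<open>Two representatives differ by a function \<open>h\<close> of norm 0, so the bound on
  \<open>P t\<close> gives \<open>P t h\<close> norm 0, and linearity transfers this to the two
  images.\<close>

lemma L2_op_semigroup:
  assumes P: "C0_semigroup \<Omega> P" and t: "t \<ge> 0" and f: "f \<in> Lp 2 \<Omega>"
  shows "L2_op \<Omega> (P t) (cl f) = cl (P t f)"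
proof (rule L2_op_class[OF \<Omega>_sets f])
  have PL: "P t g \<in> Lp 2 \<Omega>" if "g \<in> Lp 2 \<Omega>" for g by (rule C0_semigroupD(1)[OF P t that])
  then show "P t g \<in> Lp 2 \<Omega>" if "g \<in> Lp 2 \<Omega>" for g using that .
  fix g assume g: "g \<in> Lp 2 \<Omega>" "AE x in \<mu>. g x = f x"
  obtain B where B: "\<And>f. f \<in> Lp 2 \<Omega> \<Longrightarrow> Lp_norm 2 \<Omega> (P t f) \<le> B * Lp_norm 2 \<Omega> f"
    using C0_semigroupD(3)[OF P t] by blast
  define h where "h x = 1 * g x + (- 1) * f x" for x
  have hL: "h \<in> Lp 2 \<Omega>" unfolding h_def by (rule Lp2_lincomb[OF \<Omega>_sets g(1) f])
  have "cl h = 0" unfolding h_def L2_class_lincomb[OF \<Omega>_sets g(1) f]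
    using L2_class_eq_iff[OF \<Omega>_sets g(1) f] g(2) by simp
  then have "Lp_norm 2 \<Omega> h = 0" using norm_L2_class[OF \<Omega>_sets hL] by simp
  then have "norm (cl (P t h)) \<le> 0" using B[OF hL] norm_L2_class[OF \<Omega>_sets PL[OF hL]] by simp
  moreover have "AE x in \<mu>. P t h x = 1 * P t g x + (- 1) * P t f x"
    unfolding h_def by (rule C0_semigroupD(2)[OF P t g(1) f])
  then have "cl (P t h) = 1 *\<^sub>R cl (P t g) + (- 1) *\<^sub>R cl (P t f)"
    using L2_class_eq_iff[OF \<Omega>_sets PL[OF hL] Lp2_lincomb[OF \<Omega>_sets PL[OF g(1)] PL[OF f], where a = 1 and b = "-1"]]
      L2_class_lincomb[OF \<Omega>_sets PL[OF g(1)] PL[OF f], where a = 1 and b = "-1"] by simp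
  ultimately show "cl (P t g) = cl (P t f)" by simp
qed

lemma gen_L2_iff:
  assumes P: "C0_semigroup \<Omega> P" and f: "f \<in> Lp 2 \<Omega>" and g: "g \<in> Lp 2 \<Omega>"
  shows "gen_L2 P (cl f) (cl g) \<longleftrightarrow> generator \<Omega> P f g"
proof -
  have eq: "norm ((1 / t) *\<^sub>R (L2_op \<Omega> (P t) (cl f) - cl f) - cl g) =
      Lp_norm 2 \<Omega> (\<lambda>x. (P t f x - f x) / t - g x)" if "t > 0" for t
  proof -
    have PL: "P t f \<in> Lp 2 \<Omega>" using P that f by (simp add: C0_semigroup_def)
    have d: "(\<lambda>x. P t f x - f x) \<in> Lp 2 \<Omega>" by (rule Lp2_diff[OF \<Omega>_sets PL f])
    have q: "(\<lambda>x. (1 / t) * (P t f x - f x)) \<in> Lp 2 \<Omega>" by (rule Lp2_scale[OF \<Omega>_sets d])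
    have "(1 / t) *\<^sub>R (L2_op \<Omega> (P t) (cl f) - cl f) - cl g =
      cl (\<lambda>x. (1 / t) * (P t f x - f x) - g x)"
      using that L2_op_semigroup[OF P _ f, of t] L2_class_diff[OF \<Omega>_sets q g] L2_class_scale[OF \<Omega>_sets d, of "1 / t"]
        L2_class_diff[OF \<Omega>_sets PL f] by simp
    also have "norm \<dots> = Lp_norm 2 \<Omega> (\<lambda>x. (1 / t) * (P t f x - f x) - g x)"
      by (rule norm_L2_class[OF \<Omega>_sets Lp2_diff[OF \<Omega>_sets q g]])
    finally show ?thesis by simp
  qed
  have ev: "\<forall>\<^sub>F t in at_right 0. norm ((1 / t) *\<^sub>R (L2_op \<Omega> (P t) (cl f) - cl f) - cl g) =
      Lp_norm 2 \<Omega> (\<lambda>x. (P t f x - f x) / t - g x)"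
    using eq by (intro eventually_at_rightI[of 0 1]) auto
  have "((\<lambda>t. (1 / t) *\<^sub>R (L2_op \<Omega> (P t) (cl f) - cl f)) \<longlongrightarrow> cl g) (at_right 0) \<longleftrightarrow>
    ((\<lambda>t. norm ((1 / t) *\<^sub>R (L2_op \<Omega> (P t) (cl f) - cl f) - cl g)) \<longlongrightarrow> 0) (at_right 0)"
    by (simp add: tendsto_norm_zero_iff LIM_zero_iff)
  also have "\<dots> \<longleftrightarrow> ((\<lambda>t. Lp_norm 2 \<Omega> (\<lambda>x. (P t f x - f x) / t - g x)) \<longlongrightarrow> 0) (at_right 0)"
    by (rule tendsto_cong[OF ev])
  finally show ?thesis using f g by (simp add: generator_def)
qed

lemma ultracontractive_AE:
  assumes "ultracontractive \<Omega> P \<nu> C0" "C0 > 0" "t > 0" "f \<in> Lp 2 \<Omega>"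
  shows "AE x in \<mu>. \<bar>P t f x\<bar> \<le> C0 * t powr (- (\<nu> / 4)) * norm (cl f)"
  unfolding norm_L2_class[OF \<Omega>_sets assms(4)]
  using assms by (intro AE_le_of_Linf_norm) (auto simp: ultracontractive_def Lp_norm_nonneg)

text \<open>The semigroup laws pass from functions to classes; the substance lies in the uniform
  bound, in the symmetry of the generator and in the density of its domain.\<close>

lemma heat_semigroup_densely_symmetric:
  assumes heat: "heat_semigroup U X \<Omega> P" and C0: "C0 > 0" and \<nu>: "\<nu> \<ge> 0" and uc: "ultracontractive \<Omega> P \<nu> C0"
  shows "densely_symmetric_semigroup V (\<lambda>t. L2_op \<Omega> (P t)) (gen_L2 P)"
proof
  have P: "C0_semigroup \<Omega> P" using heat by (simp add: heat_semigroup_def)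
  have PL: "P t f \<in> Lp 2 \<Omega>" if "t \<ge> 0" "f \<in> Lp 2 \<Omega>" for t f using P that by (simp add: C0_semigroup_def)
  note op = L2_op_semigroup[OF P]
  show "subspace V" by (rule subspace_L2_class[OF \<Omega>_sets])
  show "L2_op \<Omega> (P t) x \<in> V" if "t \<ge> 0" "x \<in> V" for t x using that op PL by auto
  show "L2_op \<Omega> (P t) (a *\<^sub>R x + b *\<^sub>R y) = a *\<^sub>R L2_op \<Omega> (P t) x + b *\<^sub>R L2_op \<Omega> (P t) y"
    if t: "t \<ge> 0" and xy: "x \<in> V" "y \<in> V" for t x y a b
  proof -
    obtain f g where fg: "f \<in> Lp 2 \<Omega>" "g \<in> Lp 2 \<Omega>" "x = cl f" "y = cl g" using xy by auto
    have h: "(\<lambda>x. a * f x + b * g x) \<in> Lp 2 \<Omega>" by (rule Lp2_lincomb[OF \<Omega>_sets fg(1,2)])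
    have "AE z in \<mu>. P t (\<lambda>x. a * f x + b * g x) z = a * P t f z + b * P t g z"
      by (rule C0_semigroupD(2)[OF P t fg(1,2)])
    then show ?thesis
      using L2_class_eq_iff[OF \<Omega>_sets PL[OF t h] Lp2_lincomb[OF \<Omega>_sets PL[OF t fg(1)] PL[OF t fg(2)]]]
        L2_class_lincomb[OF \<Omega>_sets PL[OF t fg(1)] PL[OF t fg(2)]] L2_class_lincomb[OF \<Omega>_sets fg(1,2)]
        op[OF t h] op[OF t fg(1)] op[OF t fg(2)] fg(3,4) by simp
  qed
  show "\<exists>B\<ge>0. \<forall>x\<in>V. norm (L2_op \<Omega> (P t) x) \<le> B * norm x" if t: "t \<ge> 0" for t
  proof -
    obtain B where B: "\<And>f. f \<in> Lp 2 \<Omega> \<Longrightarrow> Lp_norm 2 \<Omega> (P t f) \<le> B * Lp_norm 2 \<Omega> f"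
      using C0_semigroupD(3)[OF P t] by blast
    have "norm (L2_op \<Omega> (P t) x) \<le> max B 0 * norm x" if "x \<in> V" for x
    proof -
      obtain f where f: "f \<in> Lp 2 \<Omega>" "x = cl f" using \<open>x \<in> V\<close> by auto
      have "norm (L2_op \<Omega> (P t) x) \<le> B * norm x"
        using B[OF f(1)] norm_L2_class[OF \<Omega>_sets f(1)] norm_L2_class[OF \<Omega>_sets PL[OF t f(1)]] op[OF t f(1)] f(2) by simp
      also have "\<dots> \<le> max B 0 * norm x" by (intro mult_right_mono) auto
      finally show ?thesis .
    qed
    then show ?thesis by (intro exI[of _ "max B 0"]) auto
  qed
  show "L2_op \<Omega> (P 0) x = x" if "x \<in> V" for x
  proof -
    obtain f where f: "f \<in> Lp 2 \<Omega>" "x = cl f" using \<open>x \<in> V\<close> by auto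
    have "AE z in \<mu>. P 0 f z = f z" by (rule C0_semigroupD(4)[OF P f(1)])
    then show ?thesis using op[of 0, OF _ f(1)] L2_class_eq_iff[OF \<Omega>_sets PL[of 0, OF _ f(1)] f(1)] f(2) by simp
  qed
  show "L2_op \<Omega> (P (s + t)) x = L2_op \<Omega> (P s) (L2_op \<Omega> (P t) x)" if st: "s \<ge> 0" "t \<ge> 0" and "x \<in> V" for s t x
  proof -
    obtain f where f: "f \<in> Lp 2 \<Omega>" "x = cl f" using \<open>x \<in> V\<close> by auto
    have "s + t \<ge> 0" using st by simp
    moreover have "AE z in \<mu>. P (s + t) f z = P s (P t f) z"
      by (rule C0_semigroupD(5)[OF P st f(1)])
    ultimately show ?thesis
      using op[OF _ f(1)] op[OF st(1) PL[OF st(2) f(1)]] st f(2)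
        L2_class_eq_iff[OF \<Omega>_sets PL[OF _ f(1)] PL[OF st(1) PL[OF st(2) f(1)]]] by simp
  qed
  show "((\<lambda>t. L2_op \<Omega> (P t) x) \<longlongrightarrow> x) (at_right 0)" if "x \<in> V" for x
  proof -
    obtain f where f: "f \<in> Lp 2 \<Omega>" "x = cl f" using \<open>x \<in> V\<close> by auto
    have "((\<lambda>t. Lp_norm 2 \<Omega> (\<lambda>x. P t f x - f x)) \<longlongrightarrow> 0) (at_right 0)"
      by (rule C0_semigroupD(6)[OF P f(1)])
    moreover have "norm (L2_op \<Omega> (P t) x - x) = Lp_norm 2 \<Omega> (\<lambda>x. P t f x - f x)" if "t > 0" for t
      using that op[of t, OF _ f(1)] L2_class_diff[OF \<Omega>_sets PL[of t, OF _ f(1)] f(1)] f(2)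
        norm_L2_class[OF \<Omega>_sets Lp2_diff[OF \<Omega>_sets PL[of t, OF _ f(1)] f(1)]] by simp
    then have "\<forall>\<^sub>F t in at_right 0. Lp_norm 2 \<Omega> (\<lambda>x. P t f x - f x) = norm (L2_op \<Omega> (P t) x - x)"
      by (intro eventually_at_rightI[of 0 1]) auto
    ultimately have "((\<lambda>t. norm (L2_op \<Omega> (P t) x - x)) \<longlongrightarrow> 0) (at_right 0)"
      by (rule Lim_transform_eventually)
    then show ?thesis by (simp add: tendsto_norm_zero_iff LIM_zero_iff)
  qed
  \<comment> \<open>The sup bound is integrated over \<Omega>, whose finite measure \<open>m\<close>
    contributes its square root. Since \<nu> is non-negative, the power of \<open>t\<close> is at
    most its value at \<open>r\<close>.\<close>
  show "\<exists>B\<ge>0. \<forall>t\<ge>r. \<forall>x\<in>V. norm (L2_op \<Omega> (P t) x) \<le> B * norm x" if r: "r > 0" for r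
  proof -
    define c where "c = C0 * r powr (- (\<nu> / 4))"
    define m where "m = measure \<mu> (space \<mu>)"
    have c: "c \<ge> 0" using C0 by (simp add: c_def)
    have "norm (L2_op \<Omega> (P t) x) \<le> c * sqrt m * norm x" if t: "t \<ge> r" and x: "x \<in> V" for t x
    proof -
      obtain f where f: "f \<in> Lp 2 \<Omega>" "x = cl f" using x by auto
      have t0: "t > 0" "t \<ge> 0" using t r by auto
      interpret finite_measure "\<mu>" by (rule finite_measure_lebesgue_on[OF \<Omega>(2)])
      have "t powr (- (\<nu> / 4)) \<le> r powr (- (\<nu> / 4))" using t r \<nu> by (intro powr_mono2') auto
      then have le: "C0 * t powr (- (\<nu> / 4)) * norm x \<le> c * norm x"
        unfolding c_def using C0 by (intro mult_right_mono mult_left_mono) auto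
      have ae: "AE z in \<mu>. (P t f z)\<^sup>2 \<le> (c * norm x)\<^sup>2"
        using ultracontractive_AE[OF uc C0 t0(1) f(1)]
      proof eventually_elim
        case (elim z)
        then have "\<bar>P t f z\<bar> \<le> c * norm x" using le f(2) by simp
        then show ?case by (rule square_le_square)
      qed
      have "(norm (L2_op \<Omega> (P t) x))\<^sup>2 = (LINT z|\<mu>. (P t f z)\<^sup>2)"
        using op[OF t0(2) f(1)] norm_L2_class_square[OF \<Omega>_sets PL[OF t0(2) f(1)]] f(2) by simp
      also have "\<dots> \<le> (LINT z|\<mu>. (c * norm x)\<^sup>2)"
        using PL[OF t0(2) f(1)] ae by (intro integral_mono_AE) (auto simp: Lp2_iff)
      also have "\<dots> = (c * sqrt m * norm x)\<^sup>2" by (simp add: m_def power_mult_distrib)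
      finally show ?thesis by (rule power2_le_imp_le) (use c in \<open>simp add: m_def\<close>)
    qed
    then show ?thesis using c by (intro exI[of _ "c * sqrt m"]) (auto simp: m_def)
  qed
  show "y \<bullet> x' = x \<bullet> y'" if "gen_L2 P x y" "gen_L2 P x' y'" for x y x' y'
  proof -
    obtain f g where fg: "f \<in> Lp 2 \<Omega>" "g \<in> Lp 2 \<Omega>" "x = cl f" "y = cl g"
      using \<open>gen_L2 P x y\<close> by auto
    obtain f' g' where fg': "f' \<in> Lp 2 \<Omega>" "g' \<in> Lp 2 \<Omega>" "x' = cl f'" "y' = cl g'"
      using \<open>gen_L2 P x' y'\<close> by auto
    have "generator \<Omega> P f g" "generator \<Omega> P f' g'"
      using that gen_L2_iff[OF P fg(1,2)] gen_L2_iff[OF P fg'(1,2)] fg(3,4) fg'(3,4) by auto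
    \<comment> \<open>The generator is minus the form operator; the two sign changes cancel in the
      symmetry relation.\<close>
    then have "form_operator U X \<Omega> f (\<lambda>x. - g x)" "form_operator U X \<Omega> f' (\<lambda>x. - g' x)"
      using heat by (auto simp: heat_semigroup_def)
    from form_symmetric[OF this] show ?thesis
      using inner_L2_class[OF \<Omega>_sets fg(2) fg'(1)] inner_L2_class[OF \<Omega>_sets fg(1) fg'(2)] fg(3,4) fg'(3,4) by simp
  qed
  have test_gen: "\<exists>y. gen_L2 P (cl \<phi>) y" if "\<phi> \<in> test_functions \<Omega>" for \<phi>
  proof -
    define g where "g x = - (\<Sum>j\<in>UNIV. transpose_op X [j] (directional_deriv (X j) \<phi>) x)" for x
    have fo: "form_operator U X \<Omega> \<phi> (\<lambda>x. - g x)" using form_operator_test[OF that] by (simp add: g_def)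
    then have "(\<lambda>x. - g x) \<in> Lp 2 \<Omega>" "\<phi> \<in> Lp 2 \<Omega>" by (auto simp: form_operator_def)
    then have "g \<in> Lp 2 \<Omega>" "\<phi> \<in> Lp 2 \<Omega>" using Lp2_scale[OF \<Omega>_sets, of "\<lambda>x. - g x" "-1"] by auto
    moreover have "generator \<Omega> P \<phi> g" using heat fo by (simp add: heat_semigroup_def)
    ultimately show ?thesis using gen_L2_iff[OF P] by blast
  qed
  show "V \<subseteq> closure {x. \<exists>y. gen_L2 P x y}"
  proof
    fix x assume "x \<in> V"
    then have "x \<in> closure (cl ` test_functions \<Omega>)" using L2_class_test_dense[OF \<Omega>(1,2)] by auto
    also have "\<dots> \<subseteq> closure {x. \<exists>y. gen_L2 P x y}" using test_gen by (intro closure_mono) blast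
    finally show "x \<in> closure {x. \<exists>y. gen_L2 P x y}" .
  qed
qed (rule refl)

end

section \<open>The logarithmic Sobolev inequality in L^2\<close>

context sobolev_setting
begin

text \<open>\<open>P_form_bound\<close> speaks of the domain of the generator, to which
  \<open>u\<close> need not belong. It is used on test functions, where its right-hand side is the
  energy; both sides then converge along an approximating sequence.\<close>

lemma form_bound:
  assumes heat: "heat_semigroup U X \<Omega> P" and C0: "C0 > 0" and \<nu>: "\<nu> \<ge> 0" and uc: "ultracontractive \<Omega> P \<nu> C0"
    and u: "u \<in> H1_0 U X \<Omega>" and s: "s > 0"
  shows "(cl u - L2_op \<Omega> (P s) (cl u)) \<bullet> cl u \<le> s * (Lp_norm 2 \<Omega> (weak_grad U X u))\<^sup>2"
proof -
  interpret densely_symmetric_semigroup V "\<lambda>t. L2_op \<Omega> (P t)" "gen_L2 P"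
    by (rule heat_semigroup_densely_symmetric[OF heat C0 \<nu> uc])
  have P: "C0_semigroup \<Omega> P" using heat by (simp add: heat_semigroup_def)
  have test: "(cl \<phi> - L2_op \<Omega> (P s) (cl \<phi>)) \<bullet> cl \<phi>
      \<le> s * (\<Sum>j\<in>UNIV. (norm (cl (directional_deriv (X j) \<phi>)))\<^sup>2)"
    if \<phi>: "\<phi> \<in> test_functions \<Omega>" for \<phi>
  proof -
    define h where "h x = (\<Sum>j\<in>UNIV. transpose_op X [j] (directional_deriv (X j) \<phi>) x)" for x
    define g where "g x = - h x" for x
    have fo: "form_operator U X \<Omega> \<phi> h" using form_operator_test[OF \<phi>] by (simp add: h_def[abs_def])
    then have hL: "h \<in> Lp 2 \<Omega>" "\<phi> \<in> Lp 2 \<Omega>" by (auto simp: form_operator_def)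
    have gL: "g \<in> Lp 2 \<Omega>" using Lp2_scale[OF \<Omega>_sets hL(1), of "-1"] by (simp add: g_def[abs_def])
    have "generator \<Omega> P \<phi> g" using heat fo by (simp add: heat_semigroup_def g_def)
    then have gen: "gen_L2 P (cl \<phi>) (cl g)" using gen_L2_iff[OF P hL(2) gL] by simp
    have "- (cl g \<bullet> cl \<phi>) = cl h \<bullet> cl \<phi>"
      using inner_L2_class[OF \<Omega>_sets gL hL(2)] inner_L2_class[OF \<Omega>_sets hL] by (simp add: g_def)
    also have "\<dots> = (\<Sum>j\<in>UNIV. (norm (cl (directional_deriv (X j) \<phi>)))\<^sup>2)"
      unfolding inner_L2_class[OF \<Omega>_sets hL] h_def by (rule form_test_self[OF \<phi>])
    finally have eq: "- (cl g \<bullet> cl \<phi>) = (\<Sum>j\<in>UNIV. (norm (cl (directional_deriv (X j) \<phi>)))\<^sup>2)" .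
    show ?thesis using P_form_bound[OF gen s] unfolding eq[symmetric] by simp
  qed
  obtain \<phi> where \<phi>: "\<And>n::nat. \<phi> n \<in> test_functions \<Omega>"
    "(\<lambda>n. cl (\<phi> n)) \<longlonglongrightarrow> cl u"
    "\<And>j. (\<lambda>n. cl (directional_deriv (X j) (\<phi> n))) \<longlonglongrightarrow> cl (weak_deriv U X [j] u)"
    using H1_0_approx[OF u] by metis
  have \<phi>V: "cl (\<phi> n) \<in> V" for n using test_functions_Lp2[OF \<Omega>(1) \<phi>(1) \<Omega>_sets] by blast
  have uV: "cl u \<in> V" using H1_0_Lp2(1)[OF u] by blast
  have "(\<lambda>n. L2_op \<Omega> (P s) (cl (\<phi> n))) \<longlonglongrightarrow> L2_op \<Omega> (P s) (cl u)"
    by (rule P_tendsto[OF _ \<phi>V uV \<phi>(2)]) (use s in simp)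
  then have L: "(\<lambda>n. (cl (\<phi> n) - L2_op \<Omega> (P s) (cl (\<phi> n))) \<bullet> cl (\<phi> n))
      \<longlonglongrightarrow> (cl u - L2_op \<Omega> (P s) (cl u)) \<bullet> cl u"
    by (intro tendsto_inner tendsto_diff \<phi>(2))
  have R: "(\<lambda>n. s * (\<Sum>j\<in>UNIV. (norm (cl (directional_deriv (X j) (\<phi> n))))\<^sup>2))
      \<longlonglongrightarrow> s * (\<Sum>j\<in>UNIV. (norm (cl (weak_deriv U X [j] u)))\<^sup>2)"
    by (intro tendsto_intros \<phi>(3))
  show ?thesis unfolding norm_weak_grad[OF u]
    by (rule LIMSEQ_le[OF L R]) (use test[OF \<phi>(1)] in auto)
qed

text \<open>\<open>log_sobolev\<close> at time \<epsilon>, where \<open>b n\<close> multiplies by a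
  bounded version of |u| to the power \<open>1 / 2 ^ n\<close>. Two points need analysis:
  ultracontractivity as an operator bound for the product, and convergence in L^2 of the quotients
  to u ln |u|.\<close>

lemma log_sobolev_L2:
  assumes heat: "heat_semigroup U X \<Omega> P" and C0: "C0 > 0" and \<nu>: "\<nu> \<ge> 0" and uc: "ultracontractive \<Omega> P \<nu> C0"
    and \<epsilon>: "\<epsilon> > 0" and u: "u \<in> H1_0 U X \<Omega>" and ub: "u \<in> Linf \<Omega>"
  shows "integrable \<mu> (\<lambda>x. \<bar>u x\<bar>\<^sup>2 * ln \<bar>u x\<bar>)"
    and "(LINT x|\<mu>. \<bar>u x\<bar>\<^sup>2 * ln \<bar>u x\<bar>)
          \<le> \<epsilon> * (Lp_norm 2 \<Omega> (weak_grad U X u))\<^sup>2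
            + (ln C0 - \<nu> / 4 * ln \<epsilon>) * (Lp_norm 2 \<Omega> u)\<^sup>2
            + (Lp_norm 2 \<Omega> u)\<^sup>2 * ln (Lp_norm 2 \<Omega> u)"
proof -
  interpret densely_symmetric_semigroup V "\<lambda>t. L2_op \<Omega> (P t)" "gen_L2 P"
    by (rule heat_semigroup_densely_symmetric[OF heat C0 \<nu> uc])
  have P: "C0_semigroup \<Omega> P" using heat by (simp add: heat_semigroup_def)
  have PL: "P t f \<in> Lp 2 \<Omega>" if "t \<ge> 0" "f \<in> Lp 2 \<Omega>" for t f using P that by (simp add: C0_semigroup_def)
  have uL: "u \<in> Lp 2 \<Omega>" by (rule H1_0_Lp2(1)[OF u])
  have um[measurable]: "u \<in> borel_measurable \<mu>" using uL by (simp add: Lp2_iff)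
  obtain M where M: "M \<ge> 0" "AE x in \<mu>. \<bar>u x\<bar> \<le> M" using Linf_bounded[OF ub] by metis
  \<comment> \<open>|u| truncated at its essential bound: equal to |u| almost everywhere, but
    bounded at every point, as \<open>Lp2_bounded_mult\<close> demands.\<close>
  define w where "w x = min \<bar>u x\<bar> M" for x
  define \<sigma> :: "nat \<Rightarrow> real" where "\<sigma> n = 1 / 2 ^ n" for n
  have \<sigma>: "0 < \<sigma> n" "\<sigma> n \<le> 1" for n by (auto simp: \<sigma>_def)
  have w: "0 \<le> w x" "w x \<le> M" "w x \<le> \<bar>u x\<bar>" for x using M(1) by (auto simp: w_def)
  have wu: "AE x in \<mu>. w x = \<bar>u x\<bar>" using M(2) by eventually_elim (simp add: w_def)
  have wm[measurable]: "w \<in> borel_measurable \<mu>" unfolding w_def by measurable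
  define h where "h n x = w x powr \<sigma> n" for n x
  have hm: "h n \<in> borel_measurable \<mu>" for n unfolding h_def by measurable
  have hb: "\<bar>h n x\<bar> \<le> M powr \<sigma> n" for n x
    using w[of x] \<sigma>[of n] by (auto simp: h_def intro!: powr_mono2)
  define b where "b n = L2_op \<Omega> (\<lambda>f x. h n x * f x)" for n
  have b: "b n (cl f) = cl (\<lambda>x. h n x * f x)" if "f \<in> Lp 2 \<Omega>" for n f
    unfolding b_def by (rule L2_op_mult[OF \<Omega>_sets that hm hb])
  note hL = Lp2_bounded_mult[OF \<Omega>_sets _ hm hb]
  define F where "F n x = 2 ^ n * (h n x * u x - u x)" for n x
  \<comment> \<open>\<open>W x\<close> is 0 at zeros of \<open>u\<close>, in agreement with 0 ln 0 =
    0, and so is every \<open>F n x\<close> there.\<close>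
  define W where "W x = u x * ln \<bar>u x\<bar>" for x
  have F: "(\<lambda>n. cl (F n)) \<longlonglongrightarrow> cl W" "W \<in> Lp 2 \<Omega>"
  proof -
    have c: "(\<lambda>x. 1 + M ^ 3) \<in> Lp 2 \<Omega>" by (rule Lp2_bounded[OF \<Omega>(2), of _ "\<bar>1 + M ^ 3\<bar>"]) auto
    have Fm: "F n \<in> borel_measurable \<mu>" for n
      unfolding F_def using hm[of n] by measurable
    have Wm: "W \<in> borel_measurable \<mu>" unfolding W_def by measurable
    have ab: "AE x in \<mu>. \<bar>F n x\<bar> \<le> 1 + M ^ 3" for n
      using wu
    proof eventually_elim
      case (elim x)
      have "\<bar>F n x\<bar> = \<bar>(w x powr \<sigma> n - 1) / \<sigma> n * w x\<bar>"
      proof -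
        have "F n x = (w x powr \<sigma> n - 1) / \<sigma> n * u x" by (simp add: F_def h_def \<sigma>_def algebra_simps)
        then show ?thesis using elim by (simp add: abs_mult)
      qed
      also have "\<dots> \<le> 1 + M ^ 3" using w[of x] \<sigma>[of n] by (intro powr_diff_quotient_bound) auto
      finally show ?case .
    qed
    have al: "AE x in \<mu>. (\<lambda>n. F n x) \<longlonglongrightarrow> W x"
      using wu
    proof eventually_elim
      case (elim x)
      show ?case
      proof (cases "u x = 0")
        case False
        then have "w x > 0" using elim by simp
        then have "(\<lambda>n. 2 ^ n * (w x powr (1 / 2 ^ n) - 1) * u x) \<longlonglongrightarrow> ln (w x) * u x"
          by (intro tendsto_intros powr_diff_quotient_tendsto)
        then show ?thesis by (simp add: F_def W_def h_def \<sigma>_def elim algebra_simps)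
      qed (simp add: F_def W_def)
    qed
    note L = L2_class_tendsto[OF \<Omega>_sets Fm Wm c ab al]
    show "(\<lambda>n. cl (F n)) \<longlonglongrightarrow> cl W" "W \<in> Lp 2 \<Omega>" using L(2,3) by auto
  qed
  have FW: "cl (F n) = 2 ^ n *\<^sub>R (b n (cl u) - cl u)" for n
    unfolding F_def b[OF uL]
    using L2_class_scale[OF \<Omega>_sets Lp2_diff[OF \<Omega>_sets hL(1)[OF uL] uL], of "2 ^ n" n]
      L2_class_diff[OF \<Omega>_sets hL(1)[OF uL] uL, of n] by simp
  have Wu: "(\<lambda>x. W x * u x) = (\<lambda>x. \<bar>u x\<bar>\<^sup>2 * ln \<bar>u x\<bar>)" by (auto simp: W_def power2_eq_square)
  show "integrable \<mu> (\<lambda>x. \<bar>u x\<bar>\<^sup>2 * ln \<bar>u x\<bar>)"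
    using Lp2_mult_integrable[OF \<Omega>_sets F(2) uL] unfolding Wu .
  define N where "N = norm (cl u)"
  have N: "Lp_norm 2 \<Omega> u = N" unfolding N_def by (rule norm_L2_class[OF \<Omega>_sets uL, symmetric])
  have I: "(LINT x|\<mu>. \<bar>u x\<bar>\<^sup>2 * ln \<bar>u x\<bar>) = cl W \<bullet> cl u"
    using inner_L2_class[OF \<Omega>_sets F(2) uL] unfolding Wu by simp
  have main: "cl W \<bullet> cl u \<le> \<epsilon> * (Lp_norm 2 \<Omega> (weak_grad U X u))\<^sup>2
      + ln (C0 * \<epsilon> powr (- (\<nu> / 4)) * N) * N\<^sup>2" if N0: "N > 0"
    unfolding N_def
  proof (rule log_sobolev[where b = b and t = \<epsilon>])
    fix n x y assume x: "x \<in> V" and y: "y \<in> V"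
    obtain f where f: "f \<in> Lp 2 \<Omega>" "x = cl f" using x by auto
    obtain g where g: "g \<in> Lp 2 \<Omega>" "y = cl g" using y by auto
    show "b n x \<bullet> y = x \<bullet> b n y"
      unfolding f(2) g(2) b[OF f(1)] b[OF g(1)] inner_L2_class[OF \<Omega>_sets hL(1)[OF f(1)] g(1)]
        inner_L2_class[OF \<Omega>_sets f(1) hL(1)[OF g(1)]] by (simp add: mult_ac)
  next
    fix n x assume x: "x \<in> V"
    obtain f where f: "f \<in> Lp 2 \<Omega>" "x = cl f" using x by auto
    show "b n x \<in> V" unfolding f(2) b[OF f(1)] using hL(1)[OF f(1)] by (rule imageI)
    have "(\<lambda>x. h (Suc n) x * (h (Suc n) x * f x)) = (\<lambda>x. h n x * f x)"
      by (simp add: h_def \<sigma>_def mult.assoc[symmetric] powr_add[symmetric])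
    then show "b (Suc n) (b (Suc n) x) = b n x"
      unfolding f(2) b[OF f(1)] b[OF hL(1)[OF f(1)]] by (rule arg_cong)
  next
    fix n
    show "\<exists>B\<ge>0. \<forall>x\<in>V. norm (b n x) \<le> B * norm x"
      using hL(2) b by (intro exI[of _ "M powr \<sigma> n"]) auto
  next
    fix x assume x: "x \<in> V"
    obtain f where f: "f \<in> Lp 2 \<Omega>" "x = cl f" using x by auto
    define c where "c = C0 * \<epsilon> powr (- (\<nu> / 4)) * norm x"
    have c: "c \<ge> 0" using C0 by (simp add: c_def)
    have pf: "P \<epsilon> f \<in> Lp 2 \<Omega>" using PL \<epsilon> f(1) by simp
    have "(norm (b 0 (L2_op \<Omega> (P \<epsilon>) x)))\<^sup>2 = (LINT z|\<mu>. (h 0 z * P \<epsilon> f z)\<^sup>2)"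
      using L2_op_semigroup[OF P _ f(1), of \<epsilon>] \<epsilon> b[OF pf] norm_L2_class_square[OF \<Omega>_sets hL(1)[OF pf]] f(2) by simp
    \<comment> \<open>As \<open>\<sigma> 0 = 1\<close>, the multiplier \<open>h 0\<close> is the
      truncation of |u| itself. The sup bound \<open>c\<close> of \<open>P \<epsilon> f\<close>
      comes out of the integral and leaves the norm of \<open>u\<close>.\<close>
    also have "\<dots> \<le> (LINT z|\<mu>. c\<^sup>2 * (u z)\<^sup>2)"
    proof (rule integral_mono_AE)
      show "integrable \<mu> (\<lambda>z. (h 0 z * P \<epsilon> f z)\<^sup>2)" using hL(1)[OF pf] by (simp add: Lp2_iff)
      show "integrable \<mu> (\<lambda>z. c\<^sup>2 * (u z)\<^sup>2)" using uL by (simp add: Lp2_iff)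
      show "AE z in \<mu>. (h 0 z * P \<epsilon> f z)\<^sup>2 \<le> c\<^sup>2 * (u z)\<^sup>2"
        using ultracontractive_AE[OF uc C0 \<epsilon> f(1)]
      proof eventually_elim
        case (elim z)
        have "\<bar>h 0 z * P \<epsilon> f z\<bar> \<le> \<bar>u z\<bar> * c"
          unfolding abs_mult by (rule mult_mono) (use elim w[of z] in \<open>auto simp: h_def \<sigma>_def c_def f(2)\<close>)
        from square_le_square[OF this] show ?case by (simp add: power_mult_distrib mult.commute)
      qed
    qed
    also have "\<dots> = (C0 * \<epsilon> powr (- (\<nu> / 4)) * norm (cl u) * norm x)\<^sup>2"
      using norm_L2_class_square[OF \<Omega>_sets uL] by (simp add: c_def power_mult_distrib)
    finally show "norm (b 0 (L2_op \<Omega> (P \<epsilon>) x)) \<le> C0 * \<epsilon> powr (- (\<nu> / 4)) * norm (cl u) * norm x"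
      by (rule power2_le_imp_le) (use C0 in simp)
  next
    show "C0 * \<epsilon> powr (- (\<nu> / 4)) * norm (cl u) > 0" using C0 \<epsilon> N0 by (simp add: N_def)
    show "(\<lambda>n. 2 ^ n *\<^sub>R (b n (cl u) - cl u)) \<longlonglongrightarrow> cl W" using F(1) unfolding FW .
  qed (use \<epsilon> uL form_bound[OF heat C0 \<nu> uc u] in auto)
  show "(LINT x|\<mu>. \<bar>u x\<bar>\<^sup>2 * ln \<bar>u x\<bar>)
          \<le> \<epsilon> * (Lp_norm 2 \<Omega> (weak_grad U X u))\<^sup>2
            + (ln C0 - \<nu> / 4 * ln \<epsilon>) * (Lp_norm 2 \<Omega> u)\<^sup>2
            + (Lp_norm 2 \<Omega> u)\<^sup>2 * ln (Lp_norm 2 \<Omega> u)"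
  \<comment> \<open>\<open>log_sobolev\<close> takes a positive \<open>K\<close>, which excludes the
    zero class; for it the left-hand side is 0 and the right-hand side reduces to the energy
    term.\<close>
  proof (cases "N = 0")
    case True
    then have "cl u = 0" by (simp add: N_def)
    then show ?thesis unfolding I N True using \<epsilon> by simp
  next
    case False
    then have N0: "N > 0" by (simp add: N_def)
    have eq: "ln (C0 * \<epsilon> powr (- (\<nu> / 4)) * N) = ln C0 - \<nu> / 4 * ln \<epsilon> + ln N"
      using C0 \<epsilon> N0 by (simp add: ln_mult ln_powr)
    show ?thesis using main[OF N0] unfolding I N eq by (simp add: algebra_simps)
  qed
qed

end

section \<open>The inequality in Lebesgue spaces of general exponent\<close>

text \<open>The tangent of ln at e. With \<open>x\<close> equal to C times the sum of the top-order
  norms, this is the first inequality between that sum and its logarithm.\<close>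

lemma ln_le_div_exp: "0 \<le> x \<Longrightarrow> ln x \<le> x / exp (1::real)"
proof (cases "x = 0")
  case False
  assume "0 \<le> x"
  then have "ln (x / exp 1) \<le> x / exp 1 - 1" using False by (intro ln_le_minus_one) simp
  then show ?thesis using False \<open>0 \<le> x\<close> by (simp add: ln_div)
qed simp

text \<open>A majorant for the entropy integrand. Upwards, ln y <= y - 1 at y = a^\<delta> bounds ln
  a by a^\<delta> / \<delta>; downwards, the same inequality at y = 1/a gives -a ln a <= 1.\<close>

lemma abs_mult_ln_le:
  assumes "0 \<le> (a::real)" "0 < \<delta>"
  shows "\<bar>a * ln a\<bar> \<le> 1 + a powr (1 + \<delta>) / \<delta>"
proof (cases "a = 0")
  case False
  then have a: "a > 0" using assms by simp
  have "ln (a powr \<delta>) \<le> a powr \<delta> - 1" using a by (intro ln_le_minus_one) simp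
  then have "\<delta> * ln a \<le> a powr \<delta>" using a by (simp add: ln_powr)
  then have "ln a \<le> a powr \<delta> / \<delta>" using assms by (simp add: field_simps)
  then have "a * ln a \<le> a * (a powr \<delta> / \<delta>)" using a by (intro mult_left_mono) auto
  also have "\<dots> = a powr (1 + \<delta>) / \<delta>" using a by (simp add: powr_add)
  finally have up: "a * ln a \<le> a powr (1 + \<delta>) / \<delta>" .
  have "ln (1 / a) \<le> 1 / a - 1" using a by (intro ln_le_minus_one) simp
  then have "a * - ln a \<le> a * (1 / a - 1)" using a by (intro mult_left_mono) (simp_all add: ln_div)
  also have "\<dots> \<le> 1" using a by (simp add: field_simps)
  finally have "- (a * ln a) \<le> 1" by simp
  moreover have "0 \<le> a powr (1 + \<delta>) / \<delta>" using assms by simp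
  ultimately show ?thesis using up by linarith
qed (use assms in simp)

text \<open>Jensen's inequality for the probability measure \<open>\<bar>u\<bar>\<^sup>p dx\<close>, from \<open>ln y \<le> y / m + ln m - 1\<close>
  with \<open>y = \<bar>u\<bar>\<^sup>q\<^sup>-\<^sup>p\<close> and \<open>m\<close> its mean.\<close>

lemma log_holder:
  fixes u :: "real^'n::finite \<Rightarrow> real"
  assumes S: "S \<in> lmeasurable" and pq: "0 < p" "p < q" and u: "u \<in> Lp q S" and norm: "Lp_norm p S u = 1"
    and N: "Lp_norm q S u \<le> N"
  shows "integrable (lebesgue_on S) (\<lambda>x. \<bar>u x\<bar> powr p * ln (\<bar>u x\<bar> powr p))"
    and "0 < N"
    and "(1 / p - 1 / q) * (LINT x|lebesgue_on S. \<bar>u x\<bar> powr p * ln (\<bar>u x\<bar> powr p)) \<le> ln N"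
proof -
  interpret finite_measure "lebesgue_on S" by (rule finite_measure_lebesgue_on[OF S])
  have um[measurable]: "u \<in> borel_measurable (lebesgue_on S)" and iq: "integrable (lebesgue_on S) (\<lambda>x. \<bar>u x\<bar> powr q)"
    using u by (auto simp: Lp_def)
  define f where "f x = \<bar>u x\<bar> powr p * ln (\<bar>u x\<bar> powr p)" for x
  define I where "I = integral\<^sup>L (lebesgue_on S) f"
  define m where "m = (LINT x|lebesgue_on S. \<bar>u x\<bar> powr q)"
  have p1: "(LINT x|lebesgue_on S. \<bar>u x\<bar> powr p) = 1"
  proof -
    have nn: "0 \<le> (LINT x|lebesgue_on S. \<bar>u x\<bar> powr p)" by simp
    have "(((LINT x|lebesgue_on S. \<bar>u x\<bar> powr p)) powr (1 / p)) powr p = 1"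
      using norm by (simp add: Lp_norm_def)
    then show ?thesis using pq nn by (simp add: powr_powr)
  qed
  \<comment> \<open>A function that is not integrable has integral 0, so the value 1 already implies
    integrability.\<close>
  have ip: "integrable (lebesgue_on S) (\<lambda>x. \<bar>u x\<bar> powr p)"
    using p1 not_integrable_integral_eq by fastforce
  \<comment> \<open>Chosen so that the power \<open>1 + \<delta>\<close> of |u|^p is |u|^q.\<close>
  define \<delta> where "\<delta> = q / p - 1"
  have \<delta>: "\<delta> > 0" "p * (1 + \<delta>) = q" using pq by (auto simp: \<delta>_def field_simps)
  have f: "integrable (lebesgue_on S) f"
  proof (rule Bochner_Integration.integrable_bound)
    show "integrable (lebesgue_on S) (\<lambda>x. 1 + \<bar>u x\<bar> powr q / \<delta>)" using iq by simp
    show "f \<in> borel_measurable (lebesgue_on S)" unfolding f_def by measurable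
    show "AE x in lebesgue_on S. norm (f x) \<le> norm (1 + \<bar>u x\<bar> powr q / \<delta>)"
    proof (rule AE_I2)
      fix x
      have "\<bar>f x\<bar> \<le> 1 + (\<bar>u x\<bar> powr p) powr (1 + \<delta>) / \<delta>"
        unfolding f_def by (rule abs_mult_ln_le) (use \<delta> in auto)
      then show "norm (f x) \<le> norm (1 + \<bar>u x\<bar> powr q / \<delta>)" using \<delta> by (simp add: powr_powr)
    qed
  qed
  have "m \<noteq> 0"
  proof
    assume "m = 0"
    then have "AE x in lebesgue_on S. \<bar>u x\<bar> powr q = 0"
      unfolding m_def using iq by (subst (asm) integral_nonneg_eq_0_iff_AE) auto
    then have "AE x in lebesgue_on S. \<bar>u x\<bar> powr p = 0" by eventually_elim simp
    then have "(LINT x|lebesgue_on S. \<bar>u x\<bar> powr p) = 0" by (rule integral_eq_zero_AE)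
    then show False using p1 by simp
  qed
  then have m: "m > 0" using iq unfolding m_def by (simp add: order_less_le)
  \<comment> \<open>The tangent inequality multiplied by |u|^p; at zeros of \<open>u\<close> every
    term is 0. On integration |u|^q / m and |u|^p both have mass 1, so the right-hand side becomes 1
    + (ln m - 1).\<close>
  have pw: "(q - p) / p * f x \<le> \<bar>u x\<bar> powr q / m + (ln m - 1) * \<bar>u x\<bar> powr p" for x
  proof (cases "u x = 0")
    case False
    define a where "a = \<bar>u x\<bar>"
    have a: "a > 0" using False by (simp add: a_def)
    have "ln (a powr (q - p) / m) \<le> a powr (q - p) / m - 1" using a m by (intro ln_le_minus_one) simp
    then have "(q - p) * ln a \<le> a powr (q - p) / m + (ln m - 1)" using a m by (simp add: ln_div ln_powr)
    then have "a powr p * ((q - p) * ln a) \<le> a powr p * (a powr (q - p) / m + (ln m - 1))"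
      by (intro mult_left_mono) auto
    also have "\<dots> = a powr q / m + (ln m - 1) * a powr p"
      by (simp add: distrib_left powr_add[symmetric] mult.commute)
    finally show ?thesis using a pq by (simp add: f_def a_def[symmetric] ln_powr mult_ac)
  qed (simp add: f_def)
  have "(q - p) / p * I = (LINT x|lebesgue_on S. (q - p) / p * f x)" by (simp add: I_def)
  also have "\<dots> \<le> (LINT x|lebesgue_on S. \<bar>u x\<bar> powr q / m + (ln m - 1) * \<bar>u x\<bar> powr p)"
    by (rule integral_mono) (use f iq ip pw in auto)
  also have "\<dots> = ln m" using iq ip p1 m by (simp add: m_def[symmetric])
  finally have 1: "(q - p) / p * I \<le> ln m" .
  have nq: "Lp_norm q S u = m powr (1 / q)" by (simp add: Lp_norm_def m_def)
  then have "Lp_norm q S u > 0" using m by simp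
  with N show "0 < N" by simp
  have "ln m / q = ln (Lp_norm q S u)" using m by (simp add: nq ln_powr)
  also have "\<dots> \<le> ln N" using N \<open>Lp_norm q S u > 0\<close> by simp
  finally have 2: "ln m / q \<le> ln N" .
  have "(1 / p - 1 / q) * I = ((q - p) / p * I) / q" using pq by (simp add: field_simps)
  also have "\<dots> \<le> ln m / q" using 1 pq by (intro divide_right_mono) auto
  finally have "(1 / p - 1 / q) * I \<le> ln N" using 2 by linarith
  then show "(1 / p - 1 / q) * (LINT x|lebesgue_on S. \<bar>u x\<bar> powr p * ln (\<bar>u x\<bar> powr p)) \<le> ln N"
    by (simp add: I_def f_def[abs_def])
  show "integrable (lebesgue_on S) (\<lambda>x. \<bar>u x\<bar> powr p * ln (\<bar>u x\<bar> powr p))" using f by (simp add: f_def[abs_def])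
qed

text \<open>Below the critical case the Sobolev exponent has 1/p - 1/q = k/\<nu>, the factor in
  front of the entropy. In the critical case 1/p itself is k/\<nu>, and the bound survives the limit
  because \<open>C\<close> is the same for all \<open>q\<close>.\<close>

lemma log_sobolev_Lp:
  fixes X :: "'m::finite \<Rightarrow> real^'n::finite \<Rightarrow> real^'n" and \<nu> :: real
  assumes \<Omega>: "\<Omega> \<in> lmeasurable" and \<nu>: "\<nu> = real (metivier_index X \<Omega>)"
    and pk: "p \<ge> 1" "k > 0" "real k * p \<le> \<nu>" and C: "sobolev_constant U X \<Omega> k p C"
    and u: "u \<in> sobolev0 U X \<Omega> k p" and norm: "Lp_norm p \<Omega> u = 1"
  shows "C / exp 1 * top_order_sum U X \<Omega> k p u \<ge> ln (C * top_order_sum U X \<Omega> k p u)"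
    and "integrable (lebesgue_on \<Omega>) (\<lambda>x. \<bar>u x\<bar> powr p * ln (\<bar>u x\<bar> powr p))"
    and "ln (C * top_order_sum U X \<Omega> k p u)
          \<ge> real k / \<nu> * (LINT x|lebesgue_on \<Omega>. \<bar>u x\<bar> powr p * ln (\<bar>u x\<bar> powr p))"
proof -
  define N where "N = C * top_order_sum U X \<Omega> k p u"
  define I where "I = (LINT x|lebesgue_on \<Omega>. \<bar>u x\<bar> powr p * ln (\<bar>u x\<bar> powr p))"
  have kp: "real k * p > 0" using pk by simp
  then have \<nu>0: "\<nu> > 0" using pk by linarith
  have "integrable (lebesgue_on \<Omega>) (\<lambda>x. \<bar>u x\<bar> powr p * ln (\<bar>u x\<bar> powr p)) \<and> 0 < N \<and> real k / \<nu> * I \<le> ln N"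
  proof (cases "real k * p < \<nu>")
    case True
    define q where "q = 1 / (1 / p - real k / \<nu>)"
    have pos: "1 / p - real k / \<nu> > 0" using True \<nu>0 pk by (simp add: field_simps)
    have q: "1 / q = 1 / p - real k / \<nu>" by (simp add: q_def)
    have "1 / q < 1 / p" using q pk \<nu>0 by simp
    moreover have "q > 0" using pos by (simp add: q_def)
    ultimately have pq: "p < q" using pk by (simp add: field_simps)
    have uq: "u \<in> Lp q \<Omega>" "Lp_norm q \<Omega> u \<le> N"
      using C True q u unfolding sobolev_constant_def \<nu>[symmetric] N_def Let_def by blast+
    have "1 / p - 1 / q = real k / \<nu>" using q by simp
    then show ?thesis using log_holder[OF \<Omega> _ pq uq(1) norm uq(2)] pk by (simp add: I_def)
  next
    case False
    then have eq: "real k * p = \<nu>" using pk by simp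
    have uq: "u \<in> Lp q \<Omega>" "Lp_norm q \<Omega> u \<le> N" if "q \<ge> 1" for q
      using C eq u that unfolding sobolev_constant_def \<nu>[symmetric] N_def Let_def by blast+
    \<comment> \<open>A sequence tending to infinity; \<open>Suc\<close> keeps every term strictly
      above \<open>p\<close>, as \<open>log_holder\<close> demands, and hence above 1.\<close>
    define q where "q n = p + real (Suc n)" for n
    have qn: "p < q n" "q n \<ge> 1" for n using pk by (auto simp: q_def)
    note lh = log_holder[OF \<Omega> _ qn(1) uq(1)[OF qn(2)] norm uq(2)[OF qn(2)], folded I_def]
    have "filterlim q at_top sequentially"
      unfolding q_def by (intro filterlim_tendsto_add_at_top[OF tendsto_const]
        filterlim_compose[OF filterlim_real_sequentially] filterlim_Suc)
    then have "(\<lambda>n. (1 / p - 1 / q n) * I) \<longlonglongrightarrow> (1 / p - 0) * I"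
      by (intro tendsto_intros real_tendsto_divide_at_top[OF tendsto_const])
    then have "(1 / p - 0) * I \<le> ln N" by (rule LIMSEQ_le_const2) (use lh(3) pk in auto)
    moreover have "1 / p = real k / \<nu>" using eq pk \<nu>0 by (simp add: field_simps)
    ultimately show ?thesis using lh(1,2) pk by simp
  qed
  then show "integrable (lebesgue_on \<Omega>) (\<lambda>x. \<bar>u x\<bar> powr p * ln (\<bar>u x\<bar> powr p))"
    "ln (C * top_order_sum U X \<Omega> k p u)
          \<ge> real k / \<nu> * (LINT x|lebesgue_on \<Omega>. \<bar>u x\<bar> powr p * ln (\<bar>u x\<bar> powr p))"
    and "C / exp 1 * top_order_sum U X \<Omega> k p u \<ge> ln (C * top_order_sum U X \<Omega> k p u)"
    using ln_le_div_exp[of N] by (auto simp: N_def I_def)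
qed

theorem theorem1p4:
  fixes U \<Omega> :: "(real^'n::finite) set"
    and X :: "'m::finite \<Rightarrow> real^'n \<Rightarrow> real^'n"
    and \<nu> :: real
  assumes "CARD('n) \<ge> 2"
    and "open U" and "connected U"
    and "\<forall>j. smooth_on U (X j)"
    and "hormander U X"
    and "open \<Omega>" and "compact (closure \<Omega>)" and "closure \<Omega> \<subseteq> U"
    and "\<nu> = real (metivier_index X \<Omega>)"
  shows
    "(\<forall>P C0 \<epsilon> u.
        heat_semigroup U X \<Omega> P \<longrightarrow> C0 > 0 \<longrightarrow> ultracontractive \<Omega> P \<nu> C0 \<longrightarrow>
        \<epsilon> > 0 \<longrightarrow> u \<in> H1_0 U X \<Omega> \<inter> Linf \<Omega> \<longrightarrow>
        integrable (lebesgue_on \<Omega>) (\<lambda>x. \<bar>u x\<bar>\<^sup>2 * ln \<bar>u x\<bar>) \<and>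
        integral\<^sup>L (lebesgue_on \<Omega>) (\<lambda>x. \<bar>u x\<bar>\<^sup>2 * ln \<bar>u x\<bar>)
          \<le> \<epsilon> * (Lp_norm 2 \<Omega> (weak_grad U X u))\<^sup>2
            + (ln C0 - \<nu> / 4 * ln \<epsilon>) * (Lp_norm 2 \<Omega> u)\<^sup>2
            + (Lp_norm 2 \<Omega> u)\<^sup>2 * ln (Lp_norm 2 \<Omega> u))
     \<and>
     (\<forall>p k C u.
        p \<ge> 1 \<longrightarrow> k > 0 \<longrightarrow> real k * p \<le> \<nu> \<longrightarrow> C > 0 \<longrightarrow> sobolev_constant U X \<Omega> k p C \<longrightarrow>
        u \<in> sobolev0 U X \<Omega> k p \<longrightarrow> Lp_norm p \<Omega> u = 1 \<longrightarrow>
        C / exp 1 * top_order_sum U X \<Omega> k p u \<ge> ln (C * top_order_sum U X \<Omega> k p u) \<and>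
        integrable (lebesgue_on \<Omega>) (\<lambda>x. \<bar>u x\<bar> powr p * ln (\<bar>u x\<bar> powr p)) \<and>
        ln (C * top_order_sum U X \<Omega> k p u)
          \<ge> real k / \<nu> * integral\<^sup>L (lebesgue_on \<Omega>) (\<lambda>x. \<bar>u x\<bar> powr p * ln (\<bar>u x\<bar> powr p)))"
proof -
  \<comment> \<open>Compactness of the closure makes \<Omega> bounded, hence of finite measure,
    which \<open>sobolev_setting\<close> and \<open>log_holder\<close> ask for.\<close>
  have lm: "\<Omega> \<in> lmeasurable"
    using assms(6,7) by (intro lmeasurable_open) (auto intro: bounded_subset[OF _ closure_subset] compact_imp_bounded)
  interpret sobolev_setting U \<Omega> X
    using assms lm closure_subset[of \<Omega>] by unfold_locales auto
  have "\<nu> \<ge> 0" using assms(9) by simp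
  then show ?thesis
    using log_sobolev_L2 log_sobolev_Lp[OF lm assms(9)] by (intro conjI allI impI) auto
qed

end
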